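(* Let $K$ be a field of characteristic zero, $n\ge 1$, and let $\mathcal{I}_n$ be the algebra of scalar integro-differential operators. Then: 1. ${}'\mathcal{C}_{\mathcal{I}_n}={}'S(\mathcal{I}_n)$ and ${}'Q_{l,cl}(\mathcal{I}_n)={}'Q(\mathcal{I}_n)\simeq {}'Q(\mathbb{S}_n)\simeq K(y_1,\ldots,y_n)$. 2. $\mathcal{C}'_{\mathcal{I}_n}=S'(\mathcal{I}_n)$ and $Q'_{r,cl}(\mathcal{I}_n)=Q'(\mathcal{I}_n)\simeq Q'(\mathbb{S}_n)\simeq K(x_1,\ldots,x_n)$. Here $K(y_1,\ldots,y_n)$ and $K(x_1,\ldots,x_n)$ are fields of rational functions in $n$ variables.
   Context: All rings are unital. A subset $S$ of a ring $R$ is multiplicative if $1\in S$, $SS\subseteq S$, $0\notin S$. A multiplicative set $S$ is a left Ore set if $Sr\cap Rs\neq\emptyset$ for all $r\in R$, $s\in S$; it is a left denominator set if moreover $rs=0$ ($r\in R,s\in S$) implies $tr=0$ for some $t\in S$; $S^{-1}R$ is the left localization. Right Ore sets, right denominator sets and right localizations $RS^{-1}$ are defined symmetrically. ${}'\mathcal{C}_R=\{c\in R\mid rc=0\Rightarrow r=0\}$ and $\mathcal{C}'_R=\{c\in R\mid cr=0\Rightarrow r=0\}$. ${}'S(R)$ is the largest left denominator set of $R$ contained in ${}'\mathcal{C}_R$ and $S'(R)$ is the largest right denominator set of $R$ contained in $\mathcal{C}'_R$ (both exist); ${}'Q(R):={}'S(R)^{-1}R$, $Q'(R):=R\,S'(R)^{-1}$.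 If ${}'\mathcal{C}_R$ is a left denominator set, ${}'Q_{l,cl}(R):={}'\mathcal{C}_R^{-1}R$; if $\mathcal{C}'_R$ is a right denominator set, $Q'_{r,cl}(R):=R\,\mathcal{C}_R'^{-1}$; statements about these rings include the assertion that they exist. The symbol $\simeq$ denotes isomorphism of $K$-algebras. $\mathbb{S}_n$ is the $K$-algebra generated by $x_1,\ldots,x_n,y_1,\ldots,y_n$ subject to $y_ix_i=1$ for all $i$ and $[x_i,y_j]=[x_i,x_j]=[y_i,y_j]=0$ for all $i\ne j$. Let $P_n=K[x_1,\ldots,x_n]$. $\mathcal{I}_n$ is the subalgebra of $\mathrm{End}_K(P_n)$ generated by the partial derivatives $\partial_i=\frac{\partial}{\partial x_i}$ and the integrations $\int_i: x^\alpha\mapsto(\alpha_i+1)^{-1}x_ix^\alpha$, $i=1,\ldots,n$. There is a $K$-algebra isomorphism $\mathbb{S}_n\to\mathcal{I}_n$, $x_i\mapsto\int_i$, $y_i\mapsto\partial_i$. *)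

theory Defs
  imports
    "HOL-Library.Poly_Mapping"
    "HOL-Library.FuncSet"
    "HOL-Computational_Algebra.Fraction_Field"
    "HOL-Algebra.Module"
    "HOL-Algebra.QuotRing"
    "HOL-Algebra.Subrings"
begin

text \<open>
  A (not necessarily commutative) algebra over a field \<open>'k\<close> (a type of class \<open>field\<close>) is represented
  by a \<open>('k, 'a) module\<close> record: the ring operations together with the scalar multiplication
  \<open>smult\<close>. The notions that only concern the ring structure are stated for arbitrary ring records.
\<close>

section \<open>Ore sets, denominator sets, localizations\<close>

definition multiplicative_set :: "('a, 'm) ring_scheme \<Rightarrow> 'a set \<Rightarrow> bool" where
  "multiplicative_set R S \<longleftrightarrow>
     S \<subseteq> carrier R \<and> \<one>\<^bsub>R\<^esub> \<in> S \<and> (\<forall>s\<in>S. \<forall>t\<in>S. s \<otimes>\<^bsub>R\<^esub> t \<in> S) \<and> \<zero>\<^bsub>R\<^esub> \<notin> S"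

definition left_Ore_set :: "('a, 'm) ring_scheme \<Rightarrow> 'a set \<Rightarrow> bool" where
  "left_Ore_set R S \<longleftrightarrow> multiplicative_set R S \<and>
     (\<forall>r\<in>carrier R. \<forall>s\<in>S. (\<lambda>t. t \<otimes>\<^bsub>R\<^esub> r) ` S \<inter> (\<lambda>q. q \<otimes>\<^bsub>R\<^esub> s) ` carrier R \<noteq> {})"

definition right_Ore_set :: "('a, 'm) ring_scheme \<Rightarrow> 'a set \<Rightarrow> bool" where
  "right_Ore_set R S \<longleftrightarrow> multiplicative_set R S \<and>
     (\<forall>r\<in>carrier R. \<forall>s\<in>S. (\<lambda>t. r \<otimes>\<^bsub>R\<^esub> t) ` S \<inter> (\<lambda>q. s \<otimes>\<^bsub>R\<^esub> q) ` carrier R \<noteq> {})"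

definition left_denominator_set :: "('a, 'm) ring_scheme \<Rightarrow> 'a set \<Rightarrow> bool" where
  "left_denominator_set R S \<longleftrightarrow> left_Ore_set R S \<and>
     (\<forall>r\<in>carrier R. \<forall>s\<in>S. r \<otimes>\<^bsub>R\<^esub> s = \<zero>\<^bsub>R\<^esub> \<longrightarrow> (\<exists>t\<in>S. t \<otimes>\<^bsub>R\<^esub> r = \<zero>\<^bsub>R\<^esub>))"

definition right_denominator_set :: "('a, 'm) ring_scheme \<Rightarrow> 'a set \<Rightarrow> bool" where
  "right_denominator_set R S \<longleftrightarrow> right_Ore_set R S \<and>
     (\<forall>r\<in>carrier R. \<forall>s\<in>S. s \<otimes>\<^bsub>R\<^esub> r = \<zero>\<^bsub>R\<^esub> \<longrightarrow> (\<exists>t\<in>S. r \<otimes>\<^bsub>R\<^esub> t = \<zero>\<^bsub>R\<^esub>))"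

text \<open>The sets written \<open>'C\<^sub>R\<close> and \<open>C'\<^sub>R\<close> in the literature.\<close>

definition left_regular :: "('a, 'm) ring_scheme \<Rightarrow> 'a set" where
  "left_regular R = {c \<in> carrier R. \<forall>r\<in>carrier R. r \<otimes>\<^bsub>R\<^esub> c = \<zero>\<^bsub>R\<^esub> \<longrightarrow> r = \<zero>\<^bsub>R\<^esub>}"

definition right_regular :: "('a, 'm) ring_scheme \<Rightarrow> 'a set" where
  "right_regular R = {c \<in> carrier R. \<forall>r\<in>carrier R. c \<otimes>\<^bsub>R\<^esub> r = \<zero>\<^bsub>R\<^esub> \<longrightarrow> r = \<zero>\<^bsub>R\<^esub>}"

text \<open>
  \<open>'S(R)\<close> and \<open>S'(R)\<close>. The order on sets is inclusion, so \<open>GREATEST\<close> yields the largest set with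
  the given property, not merely a maximal one.
\<close>

definition left_S :: "('a, 'm) ring_scheme \<Rightarrow> 'a set" where
  "left_S R = (GREATEST S. left_denominator_set R S \<and> S \<subseteq> left_regular R)"

definition right_S :: "('a, 'm) ring_scheme \<Rightarrow> 'a set" where
  "right_S R = (GREATEST S. right_denominator_set R S \<and> S \<subseteq> right_regular R)"

text \<open>
  The left localization \<open>S\<^sup>-\<^sup>1R\<close> at a left denominator set: a pair \<open>(s, r)\<close> stands for the left
  fraction \<open>s\<^sup>-\<^sup>1r\<close>, and fractions are identified if they agree after passing to a common denominator.
  A sum is formed over any common denominator \<open>cs = ds'\<close>; for a product \<open>s\<^sup>-\<^sup>1r s'\<^sup>-\<^sup>1r'\<close>
  one rewrites \<open>rs'\<^sup>-\<^sup>1 = t\<^sup>-\<^sup>1c\<close> with \<open>tr = cs'\<close> (Ore condition). As for quotient groups and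
  rings in the library, the operations take the union over all choices; for a left denominator set
  all choices give the same class.
\<close>

definition left_frac_rel :: "('a, 'm) ring_scheme \<Rightarrow> 'a set \<Rightarrow> (('a \<times> 'a) \<times> ('a \<times> 'a)) set" where
  "left_frac_rel R S = {((s, r), (s', r')).
     s \<in> S \<and> r \<in> carrier R \<and> s' \<in> S \<and> r' \<in> carrier R \<and>
     (\<exists>c\<in>carrier R. \<exists>d\<in>carrier R. c \<otimes>\<^bsub>R\<^esub> s \<in> S \<and> c \<otimes>\<^bsub>R\<^esub> s = d \<otimes>\<^bsub>R\<^esub> s' \<and> c \<otimes>\<^bsub>R\<^esub> r = d \<otimes>\<^bsub>R\<^esub> r')}"

definition left_frac :: "('a, 'm) ring_scheme \<Rightarrow> 'a set \<Rightarrow> 'a \<Rightarrow> 'a \<Rightarrow> ('a \<times> 'a) set" where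
  "left_frac R S s r = left_frac_rel R S `` {(s, r)}"

definition left_localization :: "('k, 'a) module \<Rightarrow> 'a set \<Rightarrow> ('k, ('a \<times> 'a) set) module" where
  "left_localization R S =
     \<lparr>carrier = (S \<times> carrier R) // left_frac_rel R S,
      mult = (\<lambda>A B. \<Union>{left_frac R S (t \<otimes>\<^bsub>R\<^esub> s) (c \<otimes>\<^bsub>R\<^esub> r') | s r s' r' t c.
                (s, r) \<in> A \<and> (s', r') \<in> B \<and> t \<in> S \<and> c \<in> carrier R \<and> t \<otimes>\<^bsub>R\<^esub> r = c \<otimes>\<^bsub>R\<^esub> s'}),
      one = left_frac R S \<one>\<^bsub>R\<^esub> \<one>\<^bsub>R\<^esub>,
      zero = left_frac R S \<one>\<^bsub>R\<^esub> \<zero>\<^bsub>R\<^esub>,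
      add = (\<lambda>A B. \<Union>{left_frac R S (c \<otimes>\<^bsub>R\<^esub> s) ((c \<otimes>\<^bsub>R\<^esub> r) \<oplus>\<^bsub>R\<^esub> (d \<otimes>\<^bsub>R\<^esub> r')) | s r s' r' c d.
                (s, r) \<in> A \<and> (s', r') \<in> B \<and> c \<in> carrier R \<and> d \<in> carrier R \<and>
                c \<otimes>\<^bsub>R\<^esub> s \<in> S \<and> c \<otimes>\<^bsub>R\<^esub> s = d \<otimes>\<^bsub>R\<^esub> s'}),
      smult = (\<lambda>k A. \<Union>{left_frac R S s (k \<odot>\<^bsub>R\<^esub> r) | s r. (s, r) \<in> A})\<rparr>"

text \<open>
  The right localization \<open>RS\<^sup>-\<^sup>1\<close> is the mirror image, obtained by passing to opposite rings;
  here a pair \<open>(s, r)\<close> stands for the right fraction \<open>rs\<^sup>-\<^sup>1\<close>.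
\<close>

definition opposite :: "('k, 'a) module \<Rightarrow> ('k, 'a) module" where
  "opposite R = R\<lparr>mult := (\<lambda>a b. b \<otimes>\<^bsub>R\<^esub> a)\<rparr>"

definition right_localization :: "('k, 'a) module \<Rightarrow> 'a set \<Rightarrow> ('k, ('a \<times> 'a) set) module" where
  "right_localization R S = opposite (left_localization (opposite R) S)"

text \<open>\<open>'Q(R)\<close>, \<open>Q'(R)\<close>, \<open>'Q\<^sub>l\<^sub>,\<^sub>c\<^sub>l(R)\<close> and \<open>Q'\<^sub>r\<^sub>,\<^sub>c\<^sub>l(R)\<close>. The last two are meaningful only if
  \<open>'C\<^sub>R\<close>, respectively \<open>C'\<^sub>R\<close>, is a left, respectively right, denominator set.\<close>

definition left_Q :: "('k, 'a) module \<Rightarrow> ('k, ('a \<times> 'a) set) module" where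
  "left_Q R = left_localization R (left_S R)"

definition right_Q :: "('k, 'a) module \<Rightarrow> ('k, ('a \<times> 'a) set) module" where
  "right_Q R = right_localization R (right_S R)"

definition left_Q_cl :: "('k, 'a) module \<Rightarrow> ('k, ('a \<times> 'a) set) module" where
  "left_Q_cl R = left_localization R (left_regular R)"

definition right_Q_cl :: "('k, 'a) module \<Rightarrow> ('k, ('a \<times> 'a) set) module" where
  "right_Q_cl R = right_localization R (right_regular R)"


section \<open>Isomorphisms and generated subalgebras\<close>

definition alg_iso :: "('k, 'a) module \<Rightarrow> ('k, 'b) module \<Rightarrow> bool" (infix \<open>\<simeq>\<^sub>a\<^sub>l\<^sub>g\<close> 50) where
  "A \<simeq>\<^sub>a\<^sub>l\<^sub>g B \<longleftrightarrow> (\<exists>h\<in>ring_hom A B. bij_betw h (carrier A) (carrier B) \<and>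
     (\<forall>k. \<forall>a\<in>carrier A. h (k \<odot>\<^bsub>A\<^esub> a) = k \<odot>\<^bsub>B\<^esub> h a))"

definition generated_subalgebra :: "('k, 'a) module \<Rightarrow> 'a set \<Rightarrow> ('k, 'a) module" where
  "generated_subalgebra A G =
     A\<lparr>carrier := \<Inter>{B. subring B A \<and> (\<forall>k. \<forall>b\<in>B. k \<odot>\<^bsub>A\<^esub> b \<in> B) \<and> G \<subseteq> B}\<rparr>"


section \<open>Polynomials in \<open>n\<close> variables and rational functions\<close>

text \<open>
  Polynomials in the variables \<open>x\<^sub>0, x\<^sub>1, \<dots>\<close> are finitely supported functions on the exponents
  \<open>nat \<Rightarrow>\<^sub>0 nat\<close>; \<open>P\<^sub>n\<close> consists of those that only involve \<open>x\<^sub>0, \<dots>, x\<^sub>n\<^sub>-\<^sub>1\<close>. Thus the variables and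
  generators are indexed by \<open>0, \<dots>, n - 1\<close> instead of \<open>1, \<dots>, n\<close>.
\<close>

type_synonym 'k mpol = "(nat \<Rightarrow>\<^sub>0 nat) \<Rightarrow>\<^sub>0 'k"

definition polys :: "nat \<Rightarrow> 'k::zero mpol set" where
  "polys n = {p. \<forall>m\<in>Poly_Mapping.keys p. Poly_Mapping.keys m \<subseteq> {..<n}}"

definition const_pol :: "'k::zero \<Rightarrow> 'k mpol" where
  "const_pol k = Poly_Mapping.single 0 k"

text \<open>The field of rational functions in \<open>n\<close> variables over \<open>'k\<close>, as a \<open>'k\<close>-algebra. The argument of
  type \<open>'k itself\<close> here and below only serves to name the ground field.\<close>

definition rational_functions :: "'k::field itself \<Rightarrow> nat \<Rightarrow> ('k, 'k mpol fract) module" where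
  "rational_functions K n =
     \<lparr>carrier = {Fraction_Field.Fract p q | p q. p \<in> polys n \<and> q \<in> polys n \<and> q \<noteq> 0},
      mult = (*), one = 1, zero = 0, add = (+),
      smult = (\<lambda>k f. Fraction_Field.Fract (const_pol k) 1 * f)\<rparr>"


section \<open>The algebra of scalar integro-differential operators\<close>

text \<open>Endomorphisms are functions on \<open>P\<^sub>n\<close>, extended by \<open>undefined\<close> outside \<open>P\<^sub>n\<close>.\<close>

definition End_polys :: "'k::field itself \<Rightarrow> nat \<Rightarrow> ('k, 'k mpol \<Rightarrow> 'k mpol) module" where
  "End_polys K n =
     \<lparr>carrier = {f \<in> polys n \<rightarrow>\<^sub>E polys n.
                   (\<forall>p\<in>polys n. \<forall>q\<in>polys n. f (p + q) = f p + f q) \<and>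
                   (\<forall>k. \<forall>p\<in>polys n. f (const_pol k * p) = const_pol k * f p)},
      mult = (\<lambda>f g. compose (polys n) f g),
      one = (\<lambda>p\<in>polys n. p),
      zero = (\<lambda>p\<in>polys n. 0),
      add = (\<lambda>f g. \<lambda>p\<in>polys n. f p + g p),
      smult = (\<lambda>k f. \<lambda>p\<in>polys n. const_pol k * f p)\<rparr>"

text \<open>The truncated subtraction of exponents in \<open>partial\<close> is harmless: if \<open>x\<^sub>i\<close> does not occur in the
  monomial, the coefficient is zero.\<close>

definition partial :: "nat \<Rightarrow> 'k::field mpol \<Rightarrow> 'k mpol" where
  "partial i p = (\<Sum>m\<in>Poly_Mapping.keys p. Poly_Mapping.single (m - Poly_Mapping.single i 1)
     (of_nat (Poly_Mapping.lookup m i) * Poly_Mapping.lookup p m))"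

definition integration :: "nat \<Rightarrow> 'k::field mpol \<Rightarrow> 'k mpol" where
  "integration i p = (\<Sum>m\<in>Poly_Mapping.keys p. Poly_Mapping.single (m + Poly_Mapping.single i 1)
     (inverse (of_nat (Poly_Mapping.lookup m i + 1)) * Poly_Mapping.lookup p m))"

definition integro_differential ::
    "'k::field_char_0 itself \<Rightarrow> nat \<Rightarrow> ('k, 'k mpol \<Rightarrow> 'k mpol) module" where
  "integro_differential K n = generated_subalgebra (End_polys K n)
     ({restrict (partial i) (polys n) | i. i < n} \<union> {restrict (integration i) (polys n) | i. i < n})"


section \<open>The algebra \<open>S\<^sub>n\<close> of one-sided inverses\<close>

text \<open>The free (noncommutative) algebra on a set of generators has the words in them as basis.\<close>

definition free_algebra :: "'k::field itself \<Rightarrow> 'g set \<Rightarrow> ('k, 'g list \<Rightarrow>\<^sub>0 'k) module" where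
  "free_algebra K G =
     \<lparr>carrier = {f. Poly_Mapping.keys f \<subseteq> lists G},
      mult = (\<lambda>f g. \<Sum>u\<in>Poly_Mapping.keys f. \<Sum>v\<in>Poly_Mapping.keys g.
                 Poly_Mapping.single (u @ v) (Poly_Mapping.lookup f u * Poly_Mapping.lookup g v)),
      one = Poly_Mapping.single [] 1,
      zero = 0,
      add = (+),
      smult = (\<lambda>k f. Poly_Mapping.map ((*) k) f)\<rparr>"

definition quotient_algebra :: "('k, 'a) module \<Rightarrow> 'a set \<Rightarrow> ('k, 'a set) module" where
  "quotient_algebra A I = ring.extend (A Quot I)
     (module.fields (\<lambda>k B. \<Union>b\<in>B. I +>\<^bsub>A\<^esub> (k \<odot>\<^bsub>A\<^esub> b)))"

datatype Sn_gen = Gen_x nat | Gen_y nat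

definition Sn_free :: "'k::field itself \<Rightarrow> nat \<Rightarrow> ('k, Sn_gen list \<Rightarrow>\<^sub>0 'k) module" where
  "Sn_free K n = free_algebra K (Gen_x ` {..<n} \<union> Gen_y ` {..<n})"

definition word :: "'g list \<Rightarrow> ('g list \<Rightarrow>\<^sub>0 'k::field)" where
  "word w = Poly_Mapping.single w 1"

definition Sn_relators :: "nat \<Rightarrow> (Sn_gen list \<Rightarrow>\<^sub>0 'k::field) set" where
  "Sn_relators n =
     {word [Gen_y i, Gen_x i] - word [] | i. i < n} \<union>
     {word [Gen_x i, Gen_y j] - word [Gen_y j, Gen_x i] | i j. i < n \<and> j < n \<and> i \<noteq> j} \<union>
     {word [Gen_x i, Gen_x j] - word [Gen_x j, Gen_x i] | i j. i < n \<and> j < n \<and> i \<noteq> j} \<union>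
     {word [Gen_y i, Gen_y j] - word [Gen_y j, Gen_y i] | i j. i < n \<and> j < n \<and> i \<noteq> j}"

definition Sn_algebra :: "'k::field itself \<Rightarrow> nat \<Rightarrow> ('k, (Sn_gen list \<Rightarrow>\<^sub>0 'k) set) module" where
  "Sn_algebra K n = quotient_algebra (Sn_free K n) (Idl\<^bsub>Sn_free K n\<^esub> (Sn_relators n))"

end

theory Submission
  imports Defs "HOL-Library.Multiset"
begin

text \<open>
  Let \<open>R\<close> be \<open>\<I>\<^sub>n\<close> or \<open>\<S>\<^sub>n\<close> and \<open>A = K[y\<^sub>1, \<dots>, y\<^sub>n]\<close>. Since \<open>y\<^sub>i x\<^sub>i = 1\<close>, every element of \<open>R\<close> is
  carried into \<open>A\<close> by left multiplication with some nonzero element of \<open>A\<close>. Moreover \<open>r a = 0\<close> with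
  \<open>0 \<noteq> a \<in> A\<close> forces \<open>r = 0\<close>, because in characteristic zero a nonzero differential operator with
  constant coefficients is surjective on polynomials. These two facts alone make \<open>'\<C>\<^sub>R\<close> a left
  denominator set and identify the localization with the fraction field of \<open>A\<close>: if \<open>c s = a\<close> and
  \<open>c r = b\<close> lie in \<open>A\<close>, then \<open>s\<^sup>-\<^sup>1r\<close> corresponds to \<open>b / a\<close>. The right-hand version is the same argument
  in the opposite ring, with the integrations generating a polynomial ring that acts injectively. In
  divided power coordinates the integrations become multiplications by variables and the derivations
  the transposed contractions. Finally \<open>\<S>\<^sub>n \<simeq> \<I>\<^sub>n\<close>, because the operators \<open>x\<^sup>\<alpha> y\<^sup>\<beta>\<close> on polynomials are
  linearly independent.
\<close>


text \<open>The localization map is far from injective: y_i (1 - x_i y_i) = 0, although r y_i = 0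
  forces r = 0 and 1 - x_i y_i is not zero. Hence fractions cannot be compared by cross
  multiplication in R, and a multiplier that clears r may kill it. What survives is one-sided: a
  nonzero r is never killed by a nonzero element of A on its right, and a denominator stays nonzero
  when it is cleared.

  Commutativity of A supplies the rest. If c r = b and c s = a lie in A, then (a c) r = a b = b a =
  (b c) s, which is the Ore condition. If c r = a and d s = b lie in A, then (d c)(r s) = d a s = a
  d s = a b, so the elements that can be cleared are closed under products, and clearing need only
  be checked on generators.

  Divided powers are used because there both families of generators shift exponents with coefficient
  one; surjectivity then becomes triangularity for the lexicographic order. The regularity of A in
  \<open>Sn_algebra\<close> is not visible in the presentation. It is transported from the
  operators, and for this the action on polynomials has to be faithful.\<close>

lemma polys_0 [simp]: "0 \<in> polys n"
  and polys_1 [simp]: "1 \<in> polys n"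
  and polys_const [simp]: "const_pol k \<in> polys n"
  by (auto simp: polys_def const_pol_def)

lemma polys_add [simp]: "p \<in> polys n \<Longrightarrow> q \<in> polys n \<Longrightarrow> p + q \<in> polys n"
  unfolding polys_def using keys_add[of p q] by blast

lemma polys_diff [simp]:
  fixes p q :: "'k::field mpol"
  shows "p \<in> polys n \<Longrightarrow> q \<in> polys n \<Longrightarrow> p - q \<in> polys n"
  unfolding polys_def using keys_diff[of p q] by blast

lemma polys_mult [simp]:
  fixes p q :: "'k::field mpol"
  assumes "p \<in> polys n" "q \<in> polys n"
  shows "p * q \<in> polys n"
  unfolding polys_def
proof (intro CollectI ballI)
  fix m assume "m \<in> Poly_Mapping.keys (p * q)"
  then obtain a b where "m = a + b" "a \<in> Poly_Mapping.keys p" "b \<in> Poly_Mapping.keys q"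
    using keys_mult by blast
  then show "Poly_Mapping.keys m \<subseteq> {..<n}"
    using assms keys_add[of a b] unfolding polys_def by blast
qed

lemma polys_single: "Poly_Mapping.keys m \<subseteq> {..<n} \<Longrightarrow> Poly_Mapping.single m k \<in> polys n"
  by (auto simp: polys_def)


section \<open>Isomorphisms and opposite algebras\<close>

text \<open>\<open>ring_hom\<close> does not say that its source is closed under the operations. The
  closure assumptions let values of the inverse be recognised by applying \<open>h\<close>, which is
  injective on the carrier only.\<close>

lemma alg_iso_sym:
  assumes iso: "A \<simeq>\<^sub>a\<^sub>l\<^sub>g B"
    and one: "\<one>\<^bsub>A\<^esub> \<in> carrier A"
    and mult: "\<And>a b. a \<in> carrier A \<Longrightarrow> b \<in> carrier A \<Longrightarrow> a \<otimes>\<^bsub>A\<^esub> b \<in> carrier A"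
    and add: "\<And>a b. a \<in> carrier A \<Longrightarrow> b \<in> carrier A \<Longrightarrow> a \<oplus>\<^bsub>A\<^esub> b \<in> carrier A"
    and smult: "\<And>k a. a \<in> carrier A \<Longrightarrow> k \<odot>\<^bsub>A\<^esub> a \<in> carrier A"
  shows "B \<simeq>\<^sub>a\<^sub>l\<^sub>g A"
proof -
  obtain h where h: "h \<in> ring_hom A B" and bij: "bij_betw h (carrier A) (carrier B)"
    and sm: "\<And>k a. a \<in> carrier A \<Longrightarrow> h (k \<odot>\<^bsub>A\<^esub> a) = k \<odot>\<^bsub>B\<^esub> h a"
    using iso unfolding alg_iso_def by blast
  define g where "g = inv_into (carrier A) h"
  have gA: "g b \<in> carrier A" and hg: "h (g b) = b" if "b \<in> carrier B" for b
    using that bij unfolding g_def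
    by (auto simp: bij_betw_def inv_into_into f_inv_into_f)
  have gI: "g b = a" if "a \<in> carrier A" "h a = b" for a b
    using that bij unfolding g_def by (auto simp: bij_betw_def)
  have "g \<in> ring_hom B A"
    by (rule ring_hom_memI)
       (auto intro!: gI gA one mult add
             simp: hg ring_hom_mult[OF h] ring_hom_add[OF h] ring_hom_one[OF h] gA)
  moreover have "bij_betw g (carrier B) (carrier A)"
    unfolding g_def by (rule bij_betw_inv_into[OF bij])
  moreover have "g (k \<odot>\<^bsub>B\<^esub> b) = k \<odot>\<^bsub>A\<^esub> g b" if "b \<in> carrier B" for k b
    by (rule gI) (use that in \<open>auto simp: sm gA hg smult\<close>)
  ultimately show ?thesis unfolding alg_iso_def by blast
qed

lemma alg_iso_trans:
  assumes "A \<simeq>\<^sub>a\<^sub>l\<^sub>g B" "B \<simeq>\<^sub>a\<^sub>l\<^sub>g C"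
  shows "A \<simeq>\<^sub>a\<^sub>l\<^sub>g C"
proof -
  obtain h where h: "h \<in> ring_hom A B" "bij_betw h (carrier A) (carrier B)"
    "\<And>k a. a \<in> carrier A \<Longrightarrow> h (k \<odot>\<^bsub>A\<^esub> a) = k \<odot>\<^bsub>B\<^esub> h a"
    using assms(1) unfolding alg_iso_def by blast
  obtain g where g: "g \<in> ring_hom B C" "bij_betw g (carrier B) (carrier C)"
    "\<And>k b. b \<in> carrier B \<Longrightarrow> g (k \<odot>\<^bsub>B\<^esub> b) = k \<odot>\<^bsub>C\<^esub> g b"
    using assms(2) unfolding alg_iso_def by blast
  have "(g \<circ> h) (k \<odot>\<^bsub>A\<^esub> a) = k \<odot>\<^bsub>C\<^esub> (g \<circ> h) a" if "a \<in> carrier A" for k a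
    using that h g ring_hom_closed[OF h(1)] by simp
  then show ?thesis
    unfolding alg_iso_def using ring_hom_trans[OF h(1) g(1)] bij_betw_trans[OF h(2) g(2)] by blast
qed

lemma opposite_simps [simp]:
  "carrier (opposite R) = carrier R" "\<one>\<^bsub>opposite R\<^esub> = \<one>\<^bsub>R\<^esub>" "\<zero>\<^bsub>opposite R\<^esub> = \<zero>\<^bsub>R\<^esub>"
  "a \<oplus>\<^bsub>opposite R\<^esub> b = a \<oplus>\<^bsub>R\<^esub> b" "a \<otimes>\<^bsub>opposite R\<^esub> b = b \<otimes>\<^bsub>R\<^esub> a" "k \<odot>\<^bsub>opposite R\<^esub> a = k \<odot>\<^bsub>R\<^esub> a"
  by (auto simp: opposite_def)

lemma alg_iso_opposite: "A \<simeq>\<^sub>a\<^sub>l\<^sub>g B \<Longrightarrow> opposite A \<simeq>\<^sub>a\<^sub>l\<^sub>g opposite B"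
  unfolding alg_iso_def ring_hom_def by simp blast

lemma ring_opposite:
  assumes "ring R"
  shows "ring (opposite R)"
proof -
  interpret ring R by fact
  have "abelian_group (opposite R)"
    by (rule abelian_groupI) (auto simp: a_ac intro: l_neg a_inv_closed)
  moreover have "monoid (opposite R)"
    by (rule monoidI) (auto simp: m_assoc)
  ultimately show ?thesis
    by (rule ringI) (auto simp: l_distr r_distr)
qed

lemma opposite_rational_functions [simp]:
  "opposite (rational_functions K n) = rational_functions K n"
  by (simp add: opposite_def rational_functions_def mult.commute)

lemma right_regular_opposite: "right_regular R = left_regular (opposite R)"
  by (simp add: right_regular_def left_regular_def)

lemma right_denominator_set_opposite:
  "right_denominator_set R S = left_denominator_set (opposite R) S"
  by (simp add: right_denominator_set_def left_denominator_set_def right_Ore_set_def left_Ore_set_def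
      multiplicative_set_def) blast

lemma right_S_opposite: "right_S R = left_S (opposite R)"
  by (simp add: right_S_def left_S_def right_denominator_set_opposite right_regular_opposite)


section \<open>Closure of the rational functions under sum and product\<close>

lemma rational_functionsI:
  "p \<in> polys n \<Longrightarrow> q \<in> polys n \<Longrightarrow> q \<noteq> 0 \<Longrightarrow>
    Fraction_Field.Fract p q \<in> carrier (rational_functions K n)"
  by (auto simp: rational_functions_def)

lemma rational_functionsE:
  assumes "z \<in> carrier (rational_functions K n)"
  obtains p q where "z = Fraction_Field.Fract p q" "p \<in> polys n" "q \<in> polys n" "q \<noteq> 0"
  using assms by (auto simp: rational_functions_def)

lemma rational_functions_simps:
  "a \<otimes>\<^bsub>rational_functions K n\<^esub> b = a * b" "a \<oplus>\<^bsub>rational_functions K n\<^esub> b = a + b"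
  "\<one>\<^bsub>rational_functions K n\<^esub> = 1"
  "k \<odot>\<^bsub>rational_functions K n\<^esub> a = Fraction_Field.Fract (const_pol k) 1 * a"
  by (simp_all add: rational_functions_def)

lemma rational_functions_closed:
  assumes "a \<in> carrier (rational_functions K n)" "b \<in> carrier (rational_functions K n)"
  shows "a * b \<in> carrier (rational_functions K n)" "a + b \<in> carrier (rational_functions K n)"
proof -
  obtain p q where a: "a = Fraction_Field.Fract p q" "p \<in> polys n" "q \<in> polys n" "q \<noteq> 0"
    using rational_functionsE[OF assms(1)] .
  obtain p' q' where b: "b = Fraction_Field.Fract p' q'" "p' \<in> polys n" "q' \<in> polys n" "q' \<noteq> 0"
    using rational_functionsE[OF assms(2)] .
  show "a * b \<in> carrier (rational_functions K n)" "a + b \<in> carrier (rational_functions K n)"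
    using a b by (auto intro!: rational_functionsI)
qed


section \<open>Rings that become polynomial after left multiplication by polynomials\<close>

text \<open>Regularity is one-sided: the factor tested stands to the left of
  \<open>\<eta> p\<close>, and products in the other order may vanish. Clearing is kept apart from
  these axioms because they are verified in the full endomorphism ring, while clearing is proved for
  the subalgebra generated by the operators.\<close>

locale polynomial_hom = ring R for R :: "('k::field, 'a) module" (structure) +
  fixes n :: nat and \<eta> :: "'k mpol \<Rightarrow> 'a"
  assumes one_neq_zero: "\<one> \<noteq> \<zero>"
    and smult_closed: "r \<in> carrier R \<Longrightarrow> k \<odot> r \<in> carrier R"
    and mult_smult: "r \<in> carrier R \<Longrightarrow> s \<in> carrier R \<Longrightarrow> r \<otimes> (k \<odot> s) = k \<odot> (r \<otimes> s)"
    and eta_closed: "p \<in> polys n \<Longrightarrow> \<eta> p \<in> carrier R"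
    and eta_add: "p \<in> polys n \<Longrightarrow> q \<in> polys n \<Longrightarrow> \<eta> (p + q) = \<eta> p \<oplus> \<eta> q"
    and eta_mult: "p \<in> polys n \<Longrightarrow> q \<in> polys n \<Longrightarrow> \<eta> (p * q) = \<eta> p \<otimes> \<eta> q"
    and eta_one: "\<eta> 1 = \<one>"
    and eta_smult: "p \<in> polys n \<Longrightarrow> \<eta> (const_pol k * p) = k \<odot> \<eta> p"
    and eta_regular: "p \<in> polys n \<Longrightarrow> p \<noteq> 0 \<Longrightarrow> r \<in> carrier R \<Longrightarrow> r \<otimes> \<eta> p = \<zero> \<Longrightarrow> r = \<zero>"
begin

lemma eta_zero: "\<eta> 0 = \<zero>"
  using eta_add[of 0 0] eta_closed[of 0] by (simp add: add.l_cancel_one)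

text \<open>This is regularity with the left factor \<open>\<one>\<close>, applied to the difference
  of the two polynomials.\<close>

lemma eta_inj:
  assumes "p \<in> polys n" "q \<in> polys n" "\<eta> p = \<eta> q"
  shows "p = q"
proof (rule ccontr)
  assume "p \<noteq> q"
  have "\<eta> ((p - q) + q) = \<eta> (p - q) \<oplus> \<eta> q" using assms by (intro eta_add) auto
  then have "\<one> \<otimes> \<eta> (p - q) = \<zero>" using assms eta_closed by (simp add: add.l_cancel_one)
  then show False using eta_regular[of "p - q" \<one>] assms \<open>p \<noteq> q\<close> one_neq_zero by auto
qed

end

locale left_polynomial_ring = polynomial_hom R n \<eta>
  for R :: "('k::field, 'a) module" (structure) and n :: nat and \<eta> :: "'k mpol \<Rightarrow> 'a" +
  assumes clear_left: "r \<in> carrier R \<Longrightarrow> \<exists>c\<in>polys n. c \<noteq> 0 \<and> \<eta> c \<otimes> r \<in> \<eta> ` polys n"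
begin

abbreviation "C \<equiv> left_regular R"

lemma eta_in_C: "p \<in> polys n \<Longrightarrow> p \<noteq> 0 \<Longrightarrow> \<eta> p \<in> C"
  by (simp add: left_regular_def eta_closed eta_regular)

lemma C_carrier: "s \<in> C \<Longrightarrow> s \<in> carrier R"
  by (simp add: left_regular_def)

lemma C_regular: "s \<in> C \<Longrightarrow> r \<in> carrier R \<Longrightarrow> r \<otimes> s = \<zero> \<Longrightarrow> r = \<zero>"
  by (simp add: left_regular_def)

lemma C_mult:
  assumes "s \<in> C" "t \<in> C"
  shows "s \<otimes> t \<in> C"
proof -
  note carr = assms[THEN C_carrier]
  have "r = \<zero>" if r: "r \<in> carrier R" "r \<otimes> (s \<otimes> t) = \<zero>" for r
  proof -
    have "(r \<otimes> s) \<otimes> t = \<zero>" using r carr by (simp add: m_assoc)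
    then have "r \<otimes> s = \<zero>" using C_regular[OF assms(2)] r carr by simp
    then show ?thesis using C_regular[OF assms(1)] r by simp
  qed
  then show ?thesis using carr by (simp add: left_regular_def)
qed

lemma C_one: "\<one> \<in> C"
  by (simp add: left_regular_def)

section \<open>Common clearing multipliers and the Ore condition\<close>

lemma common_clear:
  assumes "finite F" "F \<subseteq> carrier R"
  shows "\<exists>c\<in>polys n. c \<noteq> 0 \<and> (\<forall>r\<in>F. \<eta> c \<otimes> r \<in> \<eta> ` polys n)"
  using assms
proof (induction F)
  case empty
  then show ?case by (intro bexI[of _ 1]) auto
next
  case (insert r F)
  then obtain c where c: "c \<in> polys n" "c \<noteq> 0" "\<forall>r\<in>F. \<eta> c \<otimes> r \<in> \<eta> ` polys n" by auto
  obtain d where d: "d \<in> polys n" "d \<noteq> 0" "\<eta> d \<otimes> r \<in> \<eta> ` polys n"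
    using clear_left[of r] insert.prems by auto
  have "\<eta> (c * d) \<otimes> x \<in> \<eta> ` polys n" if x: "x \<in> insert r F" for x
  proof -
    have xc: "x \<in> carrier R" using x insert.prems by auto
    \<comment> \<open>Since polynomials commute, either factor of \<open>c * d\<close> can be made
      to act first, so the product clears whatever one of its factors clears.\<close>
    have *: "\<eta> (p * q) \<otimes> x \<in> \<eta> ` polys n"
      if pq: "p \<in> polys n" "q \<in> polys n" "\<eta> q \<otimes> x \<in> \<eta> ` polys n" for p q
    proof -
      obtain a where a: "a \<in> polys n" "\<eta> q \<otimes> x = \<eta> a" using pq(3) by auto
      then have "\<eta> (p * q) \<otimes> x = \<eta> (p * a)"
        using pq xc by (simp add: eta_mult m_assoc eta_closed)
      then show ?thesis using a pq by auto
    qed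
    show ?thesis using x *[of c d] *[of d c] c d by (auto simp: mult.commute)
  qed
  then show ?case using c d by (intro bexI[of _ "c * d"]) auto
qed

lemma common_clear2:
  assumes "r \<in> carrier R" "s \<in> carrier R"
  obtains c a b where "c \<in> polys n" "c \<noteq> 0" "a \<in> polys n" "b \<in> polys n"
    "\<eta> c \<otimes> r = \<eta> a" "\<eta> c \<otimes> s = \<eta> b"
  using common_clear[of "{r, s}"] assms by auto

text \<open>If the cleared value were zero, left regularity of \<open>s\<close> would give
  \<open>\<eta> c = \<zero>\<close>. This makes the cleared denominator an admissible denominator of
  a rational function.\<close>

lemma eta_mult_C_neq_0:
  assumes "c \<in> polys n" "c \<noteq> 0" "s \<in> C" "a \<in> polys n" "\<eta> c \<otimes> s = \<eta> a"
  shows "a \<noteq> 0"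
proof
  assume "a = 0"
  then have "\<eta> c = \<eta> 0"
    using assms C_regular[of s "\<eta> c"] eta_closed eta_zero by auto
  then show False using assms eta_inj[of c 0] by auto
qed

lemma left_denominator_set_C: "left_denominator_set R C"
proof -
  have ore: "(\<lambda>t. t \<otimes> r) ` C \<inter> (\<lambda>q. q \<otimes> s) ` carrier R \<noteq> {}" if r: "r \<in> carrier R" and s: "s \<in> C" for r s
  proof -
    obtain c b a where *: "c \<in> polys n" "c \<noteq> 0" "b \<in> polys n" "a \<in> polys n"
      "\<eta> c \<otimes> r = \<eta> b" "\<eta> c \<otimes> s = \<eta> a"
      using common_clear2[OF r C_carrier[OF s]] .
    have "a \<noteq> 0" using eta_mult_C_neq_0 * s by blast
    \<comment> \<open>The common multiple is (a c) r = a b = b a = (b c) s; the two middle terms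
      agree because polynomials commute.\<close>
    then have "\<eta> (a * c) \<in> C" "\<eta> (b * c) \<in> carrier R"
      using * by (auto intro: eta_in_C eta_closed)
    moreover have "\<eta> (a * c) \<otimes> r = \<eta> (a * b)"
      using * r by (simp add: eta_mult m_assoc eta_closed)
    moreover have "\<eta> (b * c) \<otimes> s = \<eta> (b * a)"
      using * C_carrier[OF s] by (simp add: eta_mult m_assoc eta_closed)
    ultimately have "\<eta> (a * c) \<otimes> r \<in> (\<lambda>t. t \<otimes> r) ` C \<inter> (\<lambda>q. q \<otimes> s) ` carrier R"
      by (simp add: mult.commute image_iff) metis
    then show ?thesis by blast
  qed
  have "\<zero> \<notin> C" using one_neq_zero by (auto simp: left_regular_def)
  then have mult: "multiplicative_set R C"
    unfolding multiplicative_set_def using C_carrier C_mult C_one by auto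
  \<comment> \<open>Here \<open>r \<otimes> s = \<zero>\<close> already gives
    \<open>r = \<zero>\<close>, so \<open>t = \<one>\<close> serves.\<close>
  have "\<exists>t\<in>C. t \<otimes> r = \<zero>" if "r \<in> carrier R" "s \<in> C" "r \<otimes> s = \<zero>" for r s
    using C_one C_regular[OF that(2,1,3)] by (intro bexI[of _ \<one>]) auto
  then show ?thesis
    unfolding left_denominator_set_def left_Ore_set_def using mult ore by simp
qed

lemma left_S_eq: "left_S R = C"
  unfolding left_S_def by (rule Greatest_equality) (simp_all add: left_denominator_set_C)

section \<open>The rational function represented by a left fraction\<close>

text \<open>The idea is that s^-1 r = (t s)^-1 (t r) = b / a. The witness \<open>t\<close> is far
  from unique, so this is a relation whose single-valuedness is proved later. It ranges over the
  whole ring instead of the polynomials, so that a witness for a multiple of the pair by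
  \<open>u\<close> yields the witness \<open>t \<otimes> u\<close> for the pair itself.\<close>

definition fraction_of :: "'a \<Rightarrow> 'a \<Rightarrow> 'k mpol fract \<Rightarrow> bool" where
  "fraction_of s r z \<longleftrightarrow> (\<exists>t\<in>carrier R. \<exists>a\<in>polys n. \<exists>b\<in>polys n.
     a \<noteq> 0 \<and> t \<otimes> s = \<eta> a \<and> t \<otimes> r = \<eta> b \<and> z = Fraction_Field.Fract b a)"

lemma fraction_ofI:
  assumes "t \<in> carrier R" "a \<in> polys n" "b \<in> polys n" "a \<noteq> 0" "t \<otimes> s = \<eta> a" "t \<otimes> r = \<eta> b"
  shows "fraction_of s r (Fraction_Field.Fract b a)"
  unfolding fraction_of_def by (intro bexI conjI) (fact refl assms)+

lemma fraction_ofE: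
  assumes "fraction_of s r z"
  obtains t a b where "t \<in> carrier R" "a \<in> polys n" "b \<in> polys n" "a \<noteq> 0"
    "t \<otimes> s = \<eta> a" "t \<otimes> r = \<eta> b" "z = Fraction_Field.Fract b a"
  using assms unfolding fraction_of_def by (elim bexE conjE)

lemma fraction_of_ex:
  assumes "s \<in> C" "r \<in> carrier R"
  shows "\<exists>z. fraction_of s r z"
proof -
  obtain c a b where c: "c \<in> polys n" "c \<noteq> 0" "a \<in> polys n" "b \<in> polys n"
      "\<eta> c \<otimes> s = \<eta> a" "\<eta> c \<otimes> r = \<eta> b"
    using common_clear2[OF C_carrier[OF assms(1)] assms(2)] .
  then have "a \<noteq> 0" using eta_mult_C_neq_0[OF c(1,2) assms(1)] by simp
  then have "fraction_of s r (Fraction_Field.Fract b a)"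
    using c eta_closed by (intro fraction_ofI) auto
  then show ?thesis by (rule exI)
qed

text \<open>The witnesses \<open>t\<close> and \<open>t'\<close> need not commute, so a common
  \<open>c\<close> first turns them into polynomials \<open>d\<close> and \<open>d'\<close>.
  Multiplying \<open>u\<close> by \<open>d\<close> and \<open>d'\<close> in both orders gives
  \<open>d' * x = d * x'\<close>. With \<open>u = s\<close> and \<open>u = r\<close> this yields
  \<open>d' * (b * a') = d' * (b' * a)\<close>, and \<open>d'\<close> is cancelled.\<close>

lemma fraction_of_unique:
  assumes sr: "s \<in> carrier R" "r \<in> carrier R" and "fraction_of s r z" "fraction_of s r z'"
  shows "z = z'"
proof -
  obtain t a b where t: "t \<in> carrier R" "a \<in> polys n" "b \<in> polys n" "a \<noteq> 0"
    "t \<otimes> s = \<eta> a" "t \<otimes> r = \<eta> b" "z = Fraction_Field.Fract b a"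
    using fraction_ofE[OF assms(3)] .
  obtain t' a' b' where t': "t' \<in> carrier R" "a' \<in> polys n" "b' \<in> polys n" "a' \<noteq> 0"
    "t' \<otimes> s = \<eta> a'" "t' \<otimes> r = \<eta> b'" "z' = Fraction_Field.Fract b' a'"
    using fraction_ofE[OF assms(4)] .
  obtain c d d' where c: "c \<in> polys n" "c \<noteq> 0" "d \<in> polys n" "d' \<in> polys n"
    "\<eta> c \<otimes> t = \<eta> d" "\<eta> c \<otimes> t' = \<eta> d'"
    using common_clear2[OF t(1) t'(1)] .
  have *: "d' * x = d * x'"
    if "u \<in> carrier R" "x \<in> polys n" "x' \<in> polys n" "t \<otimes> u = \<eta> x" "t' \<otimes> u = \<eta> x'" for u x x'
  proof -
    have du: "\<eta> d \<otimes> u = \<eta> (c * x)" "\<eta> d' \<otimes> u = \<eta> (c * x')"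
      using that c t t' by (simp_all add: m_assoc eta_closed eta_mult flip: c(5,6))
    have "\<eta> (d' * (c * x)) = \<eta> d' \<otimes> (\<eta> d \<otimes> u)"
      using that c by (simp add: du eta_mult[of d'])
    also have "\<dots> = \<eta> (d' * d) \<otimes> u"
      using that c by (simp add: m_assoc eta_closed eta_mult)
    also have "\<dots> = \<eta> (d * d') \<otimes> u"
      by (simp only: mult.commute)
    also have "\<dots> = \<eta> d \<otimes> (\<eta> d' \<otimes> u)"
      using that c by (simp add: m_assoc eta_closed eta_mult)
    also have "\<dots> = \<eta> (d * (c * x'))"
      using that c by (simp add: du eta_mult[of d])
    finally have "\<eta> (d' * (c * x)) = \<eta> (d * (c * x'))" .
    then have "d' * (c * x) = d * (c * x')" using that c by (intro eta_inj) auto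
    then have "c * (d' * x) = c * (d * x')" by (simp add: ac_simps)
    then show ?thesis using c by simp
  qed
  have e: "d' * a = d * a'" "d' * b = d * b'"
    using *[OF sr(1) t(2) t'(2) t(5) t'(5)] *[OF sr(2) t(3) t'(3) t(6) t'(6)] .
  \<comment> \<open>If \<open>d'\<close> vanished, then so would
    \<open>\<eta> d' \<otimes> s\<close>, which equals \<open>\<eta> (c * a')\<close>; but
    \<open>c\<close> and \<open>a'\<close> are nonzero.\<close>
  have "d' \<noteq> 0"
  proof
    assume "d' = 0"
    then have "(\<eta> c \<otimes> t') \<otimes> s = \<zero>" using c sr by (simp add: eta_zero)
    moreover have "(\<eta> c \<otimes> t') \<otimes> s = \<eta> c \<otimes> \<eta> a'"
      using m_assoc[of "\<eta> c" t' s] c t' sr by (simp only: eta_closed)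
    ultimately have "\<eta> (c * a') = \<eta> 0"
      using c t' by (simp add: eta_zero eta_mult)
    then have "c * a' = 0" by (rule eta_inj[rotated 2]) (use c t' in auto)
    then show False using c t' by simp
  qed
  have "d' * (b * a') = d' * (b' * a)"
  proof -
    have "d' * (b * a') = (d' * b) * a'" by (simp only: mult.assoc)
    also have "\<dots> = (d * a') * b'" unfolding e by (simp only: ac_simps)
    also have "\<dots> = d' * (b' * a)" unfolding e(1)[symmetric] by (simp only: ac_simps)
    finally show ?thesis .
  qed
  then have "b * a' = b' * a" using \<open>d' \<noteq> 0\<close> by simp
  then show ?thesis using t t' by (simp add: eq_fract)
qed

lemma fraction_of_cancel:
  assumes "u \<in> carrier R" "s \<in> carrier R" "r \<in> carrier R" "fraction_of (u \<otimes> s) (u \<otimes> r) z"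
  shows "fraction_of s r z"
proof -
  obtain t a b where t: "t \<in> carrier R" "a \<in> polys n" "b \<in> polys n" "a \<noteq> 0"
    "t \<otimes> (u \<otimes> s) = \<eta> a" "t \<otimes> (u \<otimes> r) = \<eta> b" "z = Fraction_Field.Fract b a"
    using fraction_ofE[OF assms(4)] .
  show ?thesis unfolding t(7)
    by (rule fraction_ofI[of "t \<otimes> u"]) (use t assms in \<open>auto simp: m_assoc\<close>)
qed

text \<open>A witness for \<open>(s, r)\<close> need not factor through \<open>u\<close>. Instead
  the expanded pair has some value because its denominator is regular; cancelling \<open>u\<close>
  makes it a value of \<open>(s, r)\<close>, and uniqueness identifies it with
  \<open>z\<close>.\<close>

lemma fraction_of_expand:
  assumes "u \<in> carrier R" "s \<in> carrier R" "r \<in> carrier R" "fraction_of s r z" "u \<otimes> s \<in> C"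
  shows "fraction_of (u \<otimes> s) (u \<otimes> r) z"
proof -
  obtain z' where z': "fraction_of (u \<otimes> s) (u \<otimes> r) z'"
    using fraction_of_ex[OF assms(5), of "u \<otimes> r"] assms by auto
  then have "z' = z"
    using fraction_of_unique[OF assms(2,3) _ assms(4)] fraction_of_cancel[OF assms(1-3)] by simp
  then show ?thesis using z' by simp
qed

lemma fraction_of_add:
  assumes "s \<in> C" "r \<in> carrier R" "r' \<in> carrier R"
    "fraction_of s r z" "fraction_of s r' z'"
  shows "fraction_of s (r \<oplus> r') (z + z')"
proof -
  have sc: "s \<in> carrier R" using C_carrier assms by blast
  obtain c where c: "c \<in> polys n" "c \<noteq> 0" "\<forall>r\<in>{s, r, r'}. \<eta> c \<otimes> r \<in> \<eta> ` polys n"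
    using common_clear[of "{s, r, r'}"] assms C_carrier by auto
  then obtain a b b' where e: "a \<in> polys n" "b \<in> polys n" "b' \<in> polys n"
    "\<eta> c \<otimes> s = \<eta> a" "\<eta> c \<otimes> r = \<eta> b" "\<eta> c \<otimes> r' = \<eta> b'" by auto
  have a: "a \<noteq> 0" using eta_mult_C_neq_0[OF c(1,2) assms(1) e(1,4)] .
  have "fraction_of s r (Fraction_Field.Fract b a)" "fraction_of s r' (Fraction_Field.Fract b' a)"
    using a c e eta_closed by (auto intro!: fraction_ofI[of "\<eta> c"])
  then have z: "z = Fraction_Field.Fract b a" "z' = Fraction_Field.Fract b' a"
    using fraction_of_unique[OF sc] assms by metis+
  have "z + z' = Fraction_Field.Fract (b + b') a"
    unfolding z using a by (simp add: eq_fract algebra_simps)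
  moreover have "\<eta> c \<otimes> (r \<oplus> r') = \<eta> (b + b')"
    using c e assms by (simp add: r_distr eta_closed eta_add)
  ultimately show ?thesis
    using a c e eta_closed by (simp add: fraction_ofI[of "\<eta> c"])
qed

lemma fraction_of_smult:
  assumes "r \<in> carrier R" "s \<in> carrier R" "fraction_of s r z"
  shows "fraction_of s (k \<odot> r) (Fraction_Field.Fract (const_pol k) 1 * z)"
proof -
  obtain t a b where t: "t \<in> carrier R" "a \<in> polys n" "b \<in> polys n" "a \<noteq> 0"
    "t \<otimes> s = \<eta> a" "t \<otimes> r = \<eta> b" "z = Fraction_Field.Fract b a"
    using fraction_ofE[OF assms(3)] .
  have "t \<otimes> (k \<odot> r) = \<eta> (const_pol k * b)"
    using t assms by (simp add: mult_smult eta_smult)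
  then show ?thesis using t by (simp add: fraction_ofI[of t])
qed

text \<open>One multiplier \<open>v\<close> clears all four elements involved. As
  \<open>t \<otimes> r = c \<otimes> s'\<close>, the first factor is b / a. The polynomial
  \<open>e\<close> obtained from \<open>v\<close> and \<open>c\<close> is a witness for
  \<open>(s', r')\<close>, so the second factor is d / b, and \<open>b\<close> cancels in the
  product.\<close>

lemma fraction_of_mult:
  assumes "s \<in> C" "r \<in> carrier R" "s' \<in> C" "r' \<in> carrier R" "t \<in> C" "c \<in> carrier R"
    and tc: "t \<otimes> r = c \<otimes> s'" and z: "fraction_of s r z" and z': "fraction_of s' r' z'"
  shows "fraction_of (t \<otimes> s) (c \<otimes> r') (z * z')"
proof -
  have carr: "s \<in> carrier R" "s' \<in> carrier R" "t \<in> carrier R" using C_carrier assms by auto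
  have ts: "t \<otimes> s \<in> C" using C_mult[OF assms(5,1)] .
  obtain v where v: "v \<in> polys n" "v \<noteq> 0"
    "\<forall>r\<in>{t \<otimes> s, c \<otimes> s', c \<otimes> r', c}. \<eta> v \<otimes> r \<in> \<eta> ` polys n"
    using common_clear[of "{t \<otimes> s, c \<otimes> s', c \<otimes> r', c}"] assms carr by auto
  then obtain a b d e where e: "a \<in> polys n" "b \<in> polys n" "d \<in> polys n" "e \<in> polys n"
    "\<eta> v \<otimes> (t \<otimes> s) = \<eta> a" "\<eta> v \<otimes> (c \<otimes> s') = \<eta> b" "\<eta> v \<otimes> (c \<otimes> r') = \<eta> d" "\<eta> v \<otimes> c = \<eta> e"
    by auto
  have a: "a \<noteq> 0" using eta_mult_C_neq_0[OF v(1,2) ts e(1,5)] .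
  have eb: "\<eta> e \<otimes> s' = \<eta> b" "\<eta> e \<otimes> r' = \<eta> d"
    using m_assoc[of "\<eta> v" c s'] m_assoc[of "\<eta> v" c r'] eta_closed[OF v(1)] e(6-8) carr assms(4,6)
    by simp_all
  have "fraction_of (t \<otimes> s) (t \<otimes> r) z"
    using fraction_of_expand[OF carr(3,1) assms(2) z ts] .
  moreover have "fraction_of (t \<otimes> s) (t \<otimes> r) (Fraction_Field.Fract b a)"
    unfolding tc using a v e eta_closed by (intro fraction_ofI[of "\<eta> v"]) auto
  ultimately have zeq: "z = Fraction_Field.Fract b a"
    using fraction_of_unique assms carr by (metis m_closed)
  have "z * z' = Fraction_Field.Fract d a"
  proof (cases "e = 0")
    \<comment> \<open>A nonzero \<open>v\<close> can still annihilate \<open>c\<close>. Then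
      \<open>e\<close> is no witness for \<open>(s', r')\<close>, but \<open>z = 0\<close> and both
      sides vanish.\<close>
    case True
    then have "\<eta> b = \<eta> 0" "\<eta> d = \<eta> 0"
      using carr assms(4) by (simp_all add: eta_zero flip: eb)
    then have "b = 0" "d = 0" using eta_inj[of _ 0] e by auto
    then show ?thesis using zeq by (simp add: fract_collapse)
  next
    case False
    have b: "b \<noteq> 0" using eta_mult_C_neq_0[OF e(4) False assms(3) e(2) eb(1)] .
    then have "fraction_of s' r' (Fraction_Field.Fract d b)"
      using eb e eta_closed by (intro fraction_ofI[of "\<eta> e"]) auto
    then have "z' = Fraction_Field.Fract d b"
      using fraction_of_unique[OF carr(2) assms(4) z'] by simp
    then show ?thesis using zeq a b by (simp add: eq_fract)
  qed
  then show ?thesis using a v e eta_closed by (simp add: fraction_ofI[of "\<eta> v"])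
qed

section \<open>The localization as the field of rational functions\<close>

text \<open>Indexing the classes by their values gives the isomorphism as an explicit map out of the
  rational functions, with no choice of representatives; the other direction comes from
  \<open>alg_iso_sym\<close>.\<close>

definition frac_class :: "'k mpol fract \<Rightarrow> ('a \<times> 'a) set" where
  "frac_class z = {(s, r). s \<in> C \<and> r \<in> carrier R \<and> fraction_of s r z}"

text \<open>In one direction, expand by \<open>c\<close> and cancel \<open>d\<close>. In the other,
  clear the two pairs to b / a and b' / a'. The multipliers \<open>\<eta> (a' * c)\<close> and
  \<open>\<eta> (a * c')\<close> bring both denominators to the product of \<open>a\<close> and
  \<open>a'\<close>, and the numerators then agree because \<open>b * a' = b' * a\<close>.\<close>

lemma left_frac_rel_iff:
  assumes "s \<in> C" "r \<in> carrier R" "s' \<in> C" "r' \<in> carrier R" "fraction_of s r z"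
  shows "((s, r), (s', r')) \<in> left_frac_rel R C \<longleftrightarrow> fraction_of s' r' z"
proof
  assume "((s, r), (s', r')) \<in> left_frac_rel R C"
  then obtain c d where cd: "c \<in> carrier R" "d \<in> carrier R" "c \<otimes> s \<in> C"
    "c \<otimes> s = d \<otimes> s'" "c \<otimes> r = d \<otimes> r'"
    unfolding left_frac_rel_def by blast
  then have "fraction_of (c \<otimes> s) (c \<otimes> r) z"
    using fraction_of_expand[OF cd(1) _ assms(2,5)] assms C_carrier by simp
  then show "fraction_of s' r' z"
    unfolding cd(4,5) using fraction_of_cancel[OF cd(2) _ assms(4)] assms C_carrier by simp
next
  assume z': "fraction_of s' r' z"
  have carr: "s \<in> carrier R" "s' \<in> carrier R" using C_carrier assms by auto
  obtain c a b where c: "c \<in> polys n" "c \<noteq> 0" "a \<in> polys n" "b \<in> polys n"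
      "\<eta> c \<otimes> s = \<eta> a" "\<eta> c \<otimes> r = \<eta> b"
    using common_clear2[OF carr(1) assms(2)] .
  obtain c' a' b' where c': "c' \<in> polys n" "c' \<noteq> 0" "a' \<in> polys n" "b' \<in> polys n"
      "\<eta> c' \<otimes> s' = \<eta> a'" "\<eta> c' \<otimes> r' = \<eta> b'"
    using common_clear2[OF carr(2) assms(4)] .
  have a: "a \<noteq> 0" "a' \<noteq> 0"
    using eta_mult_C_neq_0[OF c(1,2) assms(1) c(3,5)]
      eta_mult_C_neq_0[OF c'(1,2) assms(3) c'(3,5)] .
  have "fraction_of s r (Fraction_Field.Fract b a)"
    "fraction_of s' r' (Fraction_Field.Fract b' a')"
    using fraction_ofI[OF eta_closed[OF c(1)] c(3,4) a(1) c(5,6)]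
      fraction_ofI[OF eta_closed[OF c'(1)] c'(3,4) a(2) c'(5,6)] .
  then have "z = Fraction_Field.Fract b a" "z = Fraction_Field.Fract b' a'"
    using fraction_of_unique[OF _ _ assms(5)] fraction_of_unique[OF _ _ z'] carr assms by simp_all
  then have "b * a' = b' * a" using a by (simp add: eq_fract)
  moreover have "\<eta> (a' * c) \<otimes> s = \<eta> (a' * a)" "\<eta> (a * c') \<otimes> s' = \<eta> (a * a')"
     "\<eta> (a' * c) \<otimes> r = \<eta> (a' * b)" "\<eta> (a * c') \<otimes> r' = \<eta> (a * b')"
    using c c' carr assms by (simp_all add: eta_mult m_assoc eta_closed)
  moreover have "\<eta> (a' * a) \<in> C" using eta_in_C c c' a by simp
  moreover have "\<eta> (a' * c) \<in> carrier R" "\<eta> (a * c') \<in> carrier R" using c c' eta_closed by auto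
  ultimately have "\<exists>c\<in>carrier R. \<exists>d\<in>carrier R.
      c \<otimes> s \<in> C \<and> c \<otimes> s = d \<otimes> s' \<and> c \<otimes> r = d \<otimes> r'"
    by - (rule bexI[of _ "\<eta> (a' * c)"], rule bexI[of _ "\<eta> (a * c')"],
        simp_all add: mult.commute)
  then show "((s, r), (s', r')) \<in> left_frac_rel R C"
    unfolding left_frac_rel_def using assms by simp
qed

lemma left_frac_eq:
  assumes "s \<in> C" "r \<in> carrier R" "fraction_of s r z"
  shows "left_frac R C s r = frac_class z"
proof -
  have "(s', r') \<in> left_frac R C s r \<longleftrightarrow> (s', r') \<in> frac_class z" for s' r'
    using left_frac_rel_iff[OF assms(1,2) _ _ assms(3)]
    unfolding left_frac_def frac_class_def by (auto simp: left_frac_rel_def)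
  then show ?thesis by auto
qed

lemma carrier_rational_functions_iff:
  "z \<in> carrier (rational_functions K n) \<longleftrightarrow> (\<exists>s\<in>C. \<exists>r\<in>carrier R. fraction_of s r z)"
proof
  assume "z \<in> carrier (rational_functions K n)"
  then obtain p q where "z = Fraction_Field.Fract p q" "p \<in> polys n" "q \<in> polys n" "q \<noteq> 0"
    by (rule rational_functionsE)
  moreover from this have "fraction_of (\<eta> q) (\<eta> p) z"
    using eta_closed by (auto intro!: fraction_ofI[of \<one>])
  ultimately show "\<exists>s\<in>C. \<exists>r\<in>carrier R. fraction_of s r z" using eta_in_C eta_closed by metis
next
  assume "\<exists>s\<in>C. \<exists>r\<in>carrier R. fraction_of s r z"
  then show "z \<in> carrier (rational_functions K n)"
    by (auto simp: rational_functions_def fraction_of_def)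
qed

lemma frac_classE:
  assumes "z \<in> carrier (rational_functions K n)"
  obtains s r where "(s, r) \<in> frac_class z" "s \<in> C" "r \<in> carrier R"
  using assms unfolding carrier_rational_functions_iff frac_class_def by blast

lemma carrier_left_localization:
  "carrier (left_localization R C) = frac_class ` carrier (rational_functions K n)"
proof -
  have "(C \<times> carrier R) // left_frac_rel R C = {left_frac R C s r | s r. s \<in> C \<and> r \<in> carrier R}"
    unfolding quotient_def left_frac_def by auto
  also have "\<dots> = frac_class ` carrier (rational_functions K n)"
  proof (intro subset_antisym subsetI)
    fix A assume "A \<in> {left_frac R C s r | s r. s \<in> C \<and> r \<in> carrier R}"
    then obtain s r where sr: "A = left_frac R C s r" "s \<in> C" "r \<in> carrier R" by blast
    obtain z where z: "fraction_of s r z" using fraction_of_ex[OF sr(2,3)] by (rule exE)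
    then have "z \<in> carrier (rational_functions K n)"
      using sr carrier_rational_functions_iff by blast
    then show "A \<in> frac_class ` carrier (rational_functions K n)"
      using left_frac_eq[OF sr(2,3) z] sr(1) by simp
  next
    fix A assume "A \<in> frac_class ` carrier (rational_functions K n)"
    then obtain z where z: "z \<in> carrier (rational_functions K n)" "A = frac_class z" by (rule imageE)
    then obtain s r where "s \<in> C" "r \<in> carrier R" "fraction_of s r z"
      unfolding carrier_rational_functions_iff by blast
    then show "A \<in> {left_frac R C s r | s r. s \<in> C \<and> r \<in> carrier R}"
      using left_frac_eq[symmetric] z(2) by simp metis
  qed
  finally show ?thesis by (simp add: left_localization_def)
qed

text \<open>The operations of the localization are unions over all choices. What has to be shown is
  that every choice gives the same class and that at least one choice exists; the latter is where
  the Ore condition enters for sums and products.\<close>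

lemma Union_frac_classI:
  assumes "X \<noteq> {}" "\<And>x. x \<in> X \<Longrightarrow> x = frac_class z"
  shows "\<Union>X = frac_class z"
proof -
  have "X = {frac_class z}" using assms by blast
  then show ?thesis by simp
qed

lemma Ore:
  assumes "r \<in> carrier R" "s \<in> C"
  obtains t q where "t \<in> C" "q \<in> carrier R" "t \<otimes> r = q \<otimes> s"
proof -
  have "(\<lambda>t. t \<otimes> r) ` C \<inter> (\<lambda>q. q \<otimes> s) ` carrier R \<noteq> {}"
    using left_denominator_set_C assms
    unfolding left_denominator_set_def left_Ore_set_def by simp
  then obtain x where "x \<in> (\<lambda>t. t \<otimes> r) ` C" "x \<in> (\<lambda>q. q \<otimes> s) ` carrier R" by blast
  then show ?thesis using that by (elim imageE) simp
qed

lemma frac_class_mult: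
  assumes "z \<in> carrier (rational_functions K n)" "z' \<in> carrier (rational_functions K n)"
  shows "frac_class z \<otimes>\<^bsub>left_localization R C\<^esub> frac_class z' = frac_class (z * z')"
proof -
  let ?X = "{left_frac R C (t \<otimes> s) (c \<otimes> r') | s r s' r' t c.
                (s, r) \<in> frac_class z \<and> (s', r') \<in> frac_class z' \<and> t \<in> C \<and> c \<in> carrier R \<and>
                t \<otimes> r = c \<otimes> s'}"
  have "\<Union>?X = frac_class (z * z')"
  proof (rule Union_frac_classI)
    obtain s r where sr: "(s, r) \<in> frac_class z" "s \<in> C" "r \<in> carrier R"
      using frac_classE[OF assms(1)] .
    obtain s' r' where sr': "(s', r') \<in> frac_class z'" "s' \<in> C" "r' \<in> carrier R"
      using frac_classE[OF assms(2)] .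
    obtain t c where "t \<in> C" "c \<in> carrier R" "t \<otimes> r = c \<otimes> s'"
      using Ore[OF sr(3) sr'(2)] .
    then show "?X \<noteq> {}" using sr sr' by blast
    fix x assume "x \<in> ?X"
    then obtain s r s' r' t c where x: "x = left_frac R C (t \<otimes> s) (c \<otimes> r')"
      "(s, r) \<in> frac_class z" "(s', r') \<in> frac_class z'" "t \<in> C" "c \<in> carrier R"
      "t \<otimes> r = c \<otimes> s'" by blast
    then have sr: "s \<in> C" "r \<in> carrier R" "fraction_of s r z"
      "s' \<in> C" "r' \<in> carrier R" "fraction_of s' r' z'"
      by (simp_all add: frac_class_def)
    show "x = frac_class (z * z')"
      unfolding x(1)
      by (rule left_frac_eq[OF C_mult[OF x(4) sr(1)] m_closed[OF x(5) sr(5)]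
            fraction_of_mult[OF sr(1,2,4,5) x(4-6) sr(3,6)]])
  qed
  then show ?thesis by (simp add: left_localization_def)
qed

lemma frac_class_add:
  assumes "z \<in> carrier (rational_functions K n)" "z' \<in> carrier (rational_functions K n)"
  shows "frac_class z \<oplus>\<^bsub>left_localization R C\<^esub> frac_class z' = frac_class (z + z')"
proof -
  let ?X = "{left_frac R C (c \<otimes> s) ((c \<otimes> r) \<oplus> (d \<otimes> r')) | s r s' r' c d.
                (s, r) \<in> frac_class z \<and> (s', r') \<in> frac_class z' \<and> c \<in> carrier R \<and> d \<in> carrier R \<and>
                c \<otimes> s \<in> C \<and> c \<otimes> s = d \<otimes> s'}"
  have "\<Union>?X = frac_class (z + z')"
  proof (rule Union_frac_classI)
    obtain s r where sr: "(s, r) \<in> frac_class z" "s \<in> C" "r \<in> carrier R"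
      using frac_classE[OF assms(1)] .
    obtain s' r' where sr': "(s', r') \<in> frac_class z'" "s' \<in> C" "r' \<in> carrier R"
      using frac_classE[OF assms(2)] .
    \<comment> \<open>The Ore condition for the two denominators provides a common one, and it lies
      in \<open>C\<close> because both \<open>t\<close> and \<open>s\<close> do.\<close>
    obtain t c where tc: "t \<in> C" "c \<in> carrier R" "t \<otimes> s = c \<otimes> s'"
      using Ore[OF C_carrier[OF sr(2)] sr'(2)] .
    then have "left_frac R C (t \<otimes> s) ((t \<otimes> r) \<oplus> (c \<otimes> r')) \<in> ?X"
      using sr sr' C_carrier[OF tc(1)] C_mult[OF tc(1) sr(2)] by blast
    then show "?X \<noteq> {}" by blast
    fix x assume "x \<in> ?X"
    then obtain s r s' r' c d where x: "x = left_frac R C (c \<otimes> s) ((c \<otimes> r) \<oplus> (d \<otimes> r'))"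
      "s \<in> C" "r \<in> carrier R" "fraction_of s r z"
      "s' \<in> C" "r' \<in> carrier R" "fraction_of s' r' z'"
      "c \<in> carrier R" "d \<in> carrier R" "c \<otimes> s \<in> C" "c \<otimes> s = d \<otimes> s'"
      unfolding frac_class_def by blast
    have "fraction_of (c \<otimes> s) (c \<otimes> r) z" "fraction_of (c \<otimes> s) (d \<otimes> r') z'"
      using fraction_of_expand[of c s r z] fraction_of_expand[of d s' r' z'] x C_carrier by auto
    then show "x = frac_class (z + z')"
      unfolding x(1) using fraction_of_add[OF x(10)] x by (intro left_frac_eq) auto
  qed
  then show ?thesis by (simp add: left_localization_def)
qed

lemma frac_class_smult:
  assumes "z \<in> carrier (rational_functions K n)"
  shows "k \<odot>\<^bsub>left_localization R C\<^esub> frac_class z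
       = frac_class (Fraction_Field.Fract (const_pol k) 1 * z)"
proof -
  let ?X = "{left_frac R C s (k \<odot> r) | s r. (s, r) \<in> frac_class z}"
  have "\<Union>?X = frac_class (Fraction_Field.Fract (const_pol k) 1 * z)"
  proof (rule Union_frac_classI)
    obtain s r where "(s, r) \<in> frac_class z" using frac_classE[OF assms] .
    then have "left_frac R C s (k \<odot> r) \<in> ?X" by auto
    then show "?X \<noteq> {}" by blast
    fix x assume "x \<in> ?X"
    then obtain s r where x: "x = left_frac R C s (k \<odot> r)" "s \<in> C" "r \<in> carrier R" "fraction_of s r z"
      unfolding frac_class_def by blast
    show "x = frac_class (Fraction_Field.Fract (const_pol k) 1 * z)"
      unfolding x(1)
      by (rule left_frac_eq[OF x(2) smult_closed[OF x(3)]
            fraction_of_smult[OF x(3) C_carrier[OF x(2)] x(4)]])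
  qed
  then show ?thesis by (simp add: left_localization_def)
qed

lemma frac_class_one: "frac_class 1 = \<one>\<^bsub>left_localization R C\<^esub>"
proof -
  have "fraction_of \<one> \<one> 1"
    unfolding One_fract_def by (rule fraction_ofI[of \<one>]) (simp_all add: eta_one)
  then show ?thesis by (simp add: left_localization_def left_frac_eq C_one)
qed

lemma rational_functions_iso: "rational_functions K n \<simeq>\<^sub>a\<^sub>l\<^sub>g left_localization R C"
proof -
  let ?Q = "rational_functions K n"
  have "frac_class \<in> ring_hom ?Q (left_localization R C)"
    by (rule ring_hom_memI)
       (auto simp: rational_functions_simps frac_class_mult frac_class_add frac_class_one carrier_left_localization[of K])
  moreover have "inj_on frac_class (carrier ?Q)"
  proof (rule inj_onI)
    fix z z' assume z: "z \<in> carrier ?Q" "z' \<in> carrier ?Q" "frac_class z = frac_class z'"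
    obtain s r where sr: "(s, r) \<in> frac_class z" "s \<in> C" "r \<in> carrier R"
      using frac_classE[OF z(1)] .
    then have "fraction_of s r z" "fraction_of s r z'"
      using z(3) by (auto simp: frac_class_def)
    then show "z = z'"
      using fraction_of_unique[OF C_carrier] sr by blast
  qed
  ultimately show ?thesis
    unfolding alg_iso_def
    by (intro bexI[of _ frac_class])
       (auto simp: bij_betw_def carrier_left_localization[of K] frac_class_smult
           rational_functions_simps)
qed

lemma left_Q_iso: "left_Q R \<simeq>\<^sub>a\<^sub>l\<^sub>g rational_functions K n" "rational_functions K n \<simeq>\<^sub>a\<^sub>l\<^sub>g left_Q R"
proof -
  show 1: "rational_functions K n \<simeq>\<^sub>a\<^sub>l\<^sub>g left_Q R"
    using rational_functions_iso by (simp add: left_Q_def left_S_eq)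
  show "left_Q R \<simeq>\<^sub>a\<^sub>l\<^sub>g rational_functions K n"
    by (rule alg_iso_sym[OF 1])
       (auto simp: rational_functions_simps One_fract_def
             intro!: rational_functions_closed rational_functionsI)
qed

end

text \<open>The axioms of the locale involve only the algebra operations, so composing
  \<open>\<eta>\<close> with the inverse isomorphism transports them. In this way
  \<open>Sn_algebra\<close> and its opposite receive their polynomial subrings from the
  operators.\<close>

lemma left_polynomial_ring_iso:
  fixes R :: "('k::field, 'a) module" and S :: "('k, 'b) module"
  assumes "left_polynomial_ring R n \<eta>" and iso: "S \<simeq>\<^sub>a\<^sub>l\<^sub>g R" and S: "ring S"
    and smult_closed: "\<And>k s. s \<in> carrier S \<Longrightarrow> k \<odot>\<^bsub>S\<^esub> s \<in> carrier S"
  shows "\<exists>\<theta>. left_polynomial_ring S n \<theta>"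
proof -
  interpret R: left_polynomial_ring R n \<eta> by fact
  interpret S: ring S by fact
  obtain h where h: "h \<in> ring_hom S R" and bij: "bij_betw h (carrier S) (carrier R)"
    and sm: "\<And>k a. a \<in> carrier S \<Longrightarrow> h (k \<odot>\<^bsub>S\<^esub> a) = k \<odot>\<^bsub>R\<^esub> h a"
    using iso unfolding alg_iso_def by blast
  interpret h: ring_hom_ring S R h by (simp add: ring_hom_ringI2 h R.ring_axioms S)
  define \<theta> where "\<theta> = inv_into (carrier S) h \<circ> \<eta>"
  have th: "\<theta> p \<in> carrier S" "h (\<theta> p) = \<eta> p" if "p \<in> polys n" for p
    using that bij R.eta_closed unfolding \<theta>_def
    by (auto simp: bij_betw_def inv_into_into f_inv_into_f)
  \<comment> \<open>Identities in \<open>S\<close> are verified after applying \<open>h\<close>. It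
    is injective on the carrier only, so both sides must be known to lie there, scalar multiples
    included.\<close>
  have eqI: "a = b" if "h a = h b" "a \<in> carrier S" "b \<in> carrier S" for a b
    using that bij by (auto simp: bij_betw_def inj_on_def)
  have "left_polynomial_ring S n \<theta>"
  proof
    show "\<one>\<^bsub>S\<^esub> \<noteq> \<zero>\<^bsub>S\<^esub>" using R.one_neq_zero by (metis h.hom_one h.hom_zero)
  next
    fix r s k assume "r \<in> carrier S" "s \<in> carrier S"
    then show "r \<otimes>\<^bsub>S\<^esub> (k \<odot>\<^bsub>S\<^esub> s) = k \<odot>\<^bsub>S\<^esub> (r \<otimes>\<^bsub>S\<^esub> s)"
      by (intro eqI) (auto simp: sm smult_closed R.mult_smult)
  next
    fix r assume r: "r \<in> carrier S"
    obtain c a where c: "c \<in> polys n" "c \<noteq> 0" "a \<in> polys n" "\<eta> c \<otimes>\<^bsub>R\<^esub> h r = \<eta> a"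
      using R.clear_left[OF h.hom_closed[OF r]] by auto
    then have "\<theta> c \<otimes>\<^bsub>S\<^esub> r = \<theta> a" using r by (intro eqI) (auto simp: th)
    then show "\<exists>c\<in>polys n. c \<noteq> 0 \<and> \<theta> c \<otimes>\<^bsub>S\<^esub> r \<in> \<theta> ` polys n" using c by auto
  next
    fix p r assume *: "p \<in> polys n" "p \<noteq> 0" "r \<in> carrier S" "r \<otimes>\<^bsub>S\<^esub> \<theta> p = \<zero>\<^bsub>S\<^esub>"
    then have "h r \<otimes>\<^bsub>R\<^esub> \<eta> p = \<zero>\<^bsub>R\<^esub>" by (metis h.hom_mult h.hom_zero th)
    then have "h r = \<zero>\<^bsub>R\<^esub>" using R.eta_regular[of p "h r"] * by auto
    then show "r = \<zero>\<^bsub>S\<^esub>" using * by (intro eqI) auto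
  next
    fix p :: "'k mpol" and k assume "p \<in> polys n"
    then show "\<theta> (const_pol k * p) = k \<odot>\<^bsub>S\<^esub> \<theta> p"
      by (intro eqI) (auto simp: th smult_closed R.eta_smult sm)
  qed (auto intro!: eqI simp: th smult_closed R.eta_add R.eta_mult R.eta_one sm)
  then show ?thesis by blast
qed


section \<open>Generated subalgebras\<close>

lemma opposite_opposite [simp]: "opposite (opposite R) = R"
  by (simp add: opposite_def)

lemma a_inv_opposite [simp]: "a_inv (opposite R) = a_inv R"
  by (simp add: fun_eq_iff a_inv_def m_inv_def)

lemma subring_oppositeI:
  assumes "ring R" "subring B R"
  shows "subring B (opposite R)"
  using subringE[OF assms(2)]
  by (intro ring.subringI ring_opposite assms(1)) auto

lemma subring_opposite: "ring R \<Longrightarrow> subring B (opposite R) \<longleftrightarrow> subring B R"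
  using subring_oppositeI ring_opposite opposite_opposite by metis

text \<open>A ring and its opposite have the same subrings, hence the same intersection of
  subalgebras. This lets the criterion for left clearing be applied on the right-hand side as
  well.\<close>

lemma generated_subalgebra_opposite:
  assumes "ring R"
  shows "generated_subalgebra (opposite R) G = opposite (generated_subalgebra R G)"
  unfolding generated_subalgebra_def subring_opposite[OF assms]
  by (simp add: opposite_def)

lemma generated_subalgebra_simps [simp]:
  "\<one>\<^bsub>generated_subalgebra R G\<^esub> = \<one>\<^bsub>R\<^esub>" "\<zero>\<^bsub>generated_subalgebra R G\<^esub> = \<zero>\<^bsub>R\<^esub>"
  "a \<oplus>\<^bsub>generated_subalgebra R G\<^esub> b = a \<oplus>\<^bsub>R\<^esub> b" "a \<otimes>\<^bsub>generated_subalgebra R G\<^esub> b = a \<otimes>\<^bsub>R\<^esub> b"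
  "k \<odot>\<^bsub>generated_subalgebra R G\<^esub> a = k \<odot>\<^bsub>R\<^esub> a"
  by (auto simp: generated_subalgebra_def)

lemma carrier_generated_subalgebra_subset:
  assumes "subring B R" "\<And>k b. b \<in> B \<Longrightarrow> k \<odot>\<^bsub>R\<^esub> b \<in> B" "G \<subseteq> B"
  shows "carrier (generated_subalgebra R G) \<subseteq> B"
  using assms by (auto simp: generated_subalgebra_def)

lemma generators_subset: "G \<subseteq> carrier (generated_subalgebra R G)"
  by (auto simp: generated_subalgebra_def)

lemma generated_subalgebra_smult_closed:
  "a \<in> carrier (generated_subalgebra R G) \<Longrightarrow> k \<odot>\<^bsub>R\<^esub> a \<in> carrier (generated_subalgebra R G)"
  by (auto simp: generated_subalgebra_def)

lemma subring_generated_subalgebra: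
  assumes "ring R" "G \<subseteq> carrier R" "\<And>k a. a \<in> carrier R \<Longrightarrow> k \<odot>\<^bsub>R\<^esub> a \<in> carrier R"
  shows "subring (carrier (generated_subalgebra R G)) R"
proof -
  interpret ring R by fact
  show ?thesis
    using carrier_is_subring assms
    by (auto simp: generated_subalgebra_def intro!: subring_Inter)
qed

lemma ring_generated_subalgebra:
  assumes "ring R" "G \<subseteq> carrier R" "\<And>k a. a \<in> carrier R \<Longrightarrow> k \<odot>\<^bsub>R\<^esub> a \<in> carrier R"
  shows "ring (generated_subalgebra R G)"
proof -
  interpret ring R by fact
  have "ring (R\<lparr>carrier := carrier (generated_subalgebra R G)\<rparr>)"
    by (rule subring_is_ring[OF subring_generated_subalgebra]) (use assms in auto)
  then show ?thesis by (simp add: generated_subalgebra_def)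
qed

section \<open>Induction over finite supports and over polynomials\<close>

text \<open>The bound \<open>S\<close> is carried along, so one rule serves exponents in
  \<open>n\<close> variables, combinations of words in given letters, sums of smaller exponents and,
  with \<open>UNIV\<close>, arbitrary elements.\<close>

lemma poly_mapping_induct_keys [consumes 1, case_names zero single add]:
  fixes p :: "'x \<Rightarrow>\<^sub>0 'y::comm_monoid_add"
  assumes "Poly_Mapping.keys p \<subseteq> S" "P 0" "\<And>m k. m \<in> S \<Longrightarrow> P (Poly_Mapping.single m k)"
    and "\<And>p q. Poly_Mapping.keys p \<subseteq> S \<Longrightarrow> Poly_Mapping.keys q \<subseteq> S \<Longrightarrow> P p \<Longrightarrow> P q \<Longrightarrow> P (p + q)"
  shows "P p"
proof -
  have "P p" if "finite F" "F = Poly_Mapping.keys p" "F \<subseteq> S" for F and p :: "'x \<Rightarrow>\<^sub>0 'y"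
    using that
  proof (induction F arbitrary: p rule: finite_induct)
    case empty
    then show ?case using assms(2) by (metis lookup_eq_zero_in_keys_contradict lookup_zero empty_iff in_keys_iff poly_mapping_eqI)
  next
    case (insert m F)
    define q where "q = Poly_Mapping.update m 0 p"
    have q: "Poly_Mapping.keys q = F"
      using insert by (auto simp: q_def keys_update)
    moreover have "p = q + Poly_Mapping.single m (Poly_Mapping.lookup p m)"
      by (rule poly_mapping_eqI) (auto simp: q_def lookup_add lookup_update lookup_single when_def)
    moreover have "P q" using insert q by auto
    moreover have "Poly_Mapping.keys (Poly_Mapping.single m (Poly_Mapping.lookup p m)) \<subseteq> S"
      using insert by auto
    ultimately show ?case using assms(3,4) insert by (metis insert_subset)
  qed
  then show ?thesis using assms by auto
qed

definition var :: "nat \<Rightarrow> 'k::field mpol" where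
  "var i = Poly_Mapping.single (Poly_Mapping.single i 1) 1"

lemma var_in_polys [simp]: "i < n \<Longrightarrow> var i \<in> polys n"
  by (auto simp: var_def intro: polys_single)

lemma single_eq_const_mult: "Poly_Mapping.single m k = const_pol k * Poly_Mapping.single m (1::'k::field)"
  by (simp add: const_pol_def mult_single)

text \<open>The previous rule is used twice: on exponents, to build monomials from variables, and
  then on polynomials, to build sums from monomials.\<close>

lemma polys_induct [consumes 1, case_names const var add mult]:
  fixes p :: "'k::field mpol"
  assumes p: "p \<in> polys n" and const: "\<And>k. P (const_pol k)" and var: "\<And>i. i < n \<Longrightarrow> P (var i)"
    and add: "\<And>p q. p \<in> polys n \<Longrightarrow> q \<in> polys n \<Longrightarrow> P p \<Longrightarrow> P q \<Longrightarrow> P (p + q)"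
    and mult: "\<And>p q. p \<in> polys n \<Longrightarrow> q \<in> polys n \<Longrightarrow> P p \<Longrightarrow> P q \<Longrightarrow> P (p * q)"
  shows "P p"
proof -
  have one: "P (Poly_Mapping.single m 1)" if m: "Poly_Mapping.keys m \<subseteq> {..<n}" for m
    using m
  proof (induction m rule: poly_mapping_induct_keys)
    case zero
    then show ?case using const[of 1] by (simp add: const_pol_def)
  next
    case (single i k)
    then show ?case
    proof (induction k)
      case 0
      then show ?case using const[of 1] by (simp add: const_pol_def)
    next
      case (Suc k)
      have "Poly_Mapping.single (Poly_Mapping.single i (Suc k)) 1
          = var i * Poly_Mapping.single (Poly_Mapping.single i k) (1::'k)"
        by (simp add: var_def mult_single flip: single_add)
      then show ?case using Suc var by (auto intro!: mult polys_single split: if_splits)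
    qed
  next
    case (add a b)
    then show ?case
      using mult[of "Poly_Mapping.single a 1" "Poly_Mapping.single b 1"]
      by (auto simp: mult_single intro!: polys_single)
  qed
  have "Poly_Mapping.keys p \<subseteq> {m. Poly_Mapping.keys m \<subseteq> {..<n}}" using p by (auto simp: polys_def)
  then show ?thesis
  proof (induction p rule: poly_mapping_induct_keys)
    case zero
    then show ?case using const[of 0] by (simp add: const_pol_def)
  next
    case (single m k)
    then show ?case
      by (subst single_eq_const_mult) (auto intro!: mult const one polys_single)
  next
    case (add p q)
    then show ?case by (intro assms(4)) (unfold polys_def, blast+)
  qed
qed

text \<open>The elements that can be cleared form a subalgebra \<open>B\<close> of the ambient ring,
  and \<open>B\<close> contains the generators. Regularity is inherited from the ambient ring, so
  clearing the generators is all that remains to be checked in an application.\<close>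

lemma (in polynomial_hom) left_polynomial_ring_generated:
  assumes smult_mult: "\<And>k r s. r \<in> carrier R \<Longrightarrow> s \<in> carrier R \<Longrightarrow> (k \<odot> r) \<otimes> s = k \<odot> (r \<otimes> s)"
    and G: "G \<subseteq> carrier R"
    and var: "\<And>i. i < n \<Longrightarrow> \<eta> (var i) \<in> G"
    and clear: "\<And>g. g \<in> G \<Longrightarrow> \<exists>c\<in>polys n. c \<noteq> 0 \<and> \<eta> c \<otimes> g \<in> \<eta> ` polys n"
  shows "left_polynomial_ring (generated_subalgebra R G) n \<eta>"
proof -
  let ?H = "generated_subalgebra R G"
  have sub: "subring (carrier ?H) R"
    by (rule subring_generated_subalgebra[OF ring_axioms G smult_closed])
  have eta_const: "\<eta> (const_pol k) = k \<odot> \<one>" for k using eta_smult[of 1 k] eta_one by simp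
  have sr: "carrier ?H \<subseteq> carrier R" using subringE(1)[OF sub] .
  have eta: "\<eta> p \<in> carrier ?H" if "p \<in> polys n" for p
    using that
  proof (induction rule: polys_induct)
    case (const k)
    then show ?case
      using subringE(3)[OF sub] by (simp add: eta_const generated_subalgebra_smult_closed)
  next
    case (var i)
    then show ?case by (intro subsetD[OF generators_subset] assms(3))
  next
    case (add p q)
    then show ?case using subringE(7)[OF sub] by (simp add: eta_add)
  next
    case (mult p q)
    then show ?case using subringE(6)[OF sub] by (simp add: eta_mult)
  qed
  define B where "B = {r \<in> carrier R. \<exists>c\<in>polys n. c \<noteq> 0 \<and> \<eta> c \<otimes> r \<in> \<eta> ` polys n}"
  have BI: "r \<in> B" if "r \<in> carrier R" "c \<in> polys n" "c \<noteq> 0" "a \<in> polys n" "\<eta> c \<otimes> r = \<eta> a" for r c a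
    using that unfolding B_def by blast
  have BE: thesis if "r \<in> B" "\<And>c a. r \<in> carrier R \<Longrightarrow> c \<in> polys n \<Longrightarrow> c \<noteq> 0 \<Longrightarrow> a \<in> polys n \<Longrightarrow>
      \<eta> c \<otimes> r = \<eta> a \<Longrightarrow> thesis" for r thesis
    using that unfolding B_def by blast
  have comm: "\<eta> c \<otimes> (\<eta> d \<otimes> r) = \<eta> d \<otimes> (\<eta> c \<otimes> r)"
    if "c \<in> polys n" "d \<in> polys n" "r \<in> carrier R" for c d r
  proof -
    have "\<eta> c \<otimes> (\<eta> d \<otimes> r) = \<eta> (c * d) \<otimes> r"
      using m_assoc[of "\<eta> c" "\<eta> d" r] that by (simp only: eta_mult eta_closed)
    also have "\<dots> = \<eta> d \<otimes> (\<eta> c \<otimes> r)"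
      using m_assoc[of "\<eta> d" "\<eta> c" r] that by (simp only: mult.commute[of c d] eta_mult eta_closed)
    finally show ?thesis .
  qed
  have Bs: "k \<odot> b \<in> B" if b: "b \<in> B" for k b
  proof (rule BE[OF b])
    fix c a assume *: "b \<in> carrier R" "c \<in> polys n" "c \<noteq> 0" "a \<in> polys n" "\<eta> c \<otimes> b = \<eta> a"
    then have "\<eta> c \<otimes> (k \<odot> b) = \<eta> (const_pol k * a)"
      by (simp add: mult_smult eta_smult eta_closed)
    then show ?thesis using * by (intro BI[of _ c]) (auto simp: smult_closed)
  qed
  have "subring B R"
  proof (rule subringI)
    show "B \<subseteq> carrier R" by (auto simp: B_def)
    show "\<one> \<in> B" by (rule BI[of _ 1 1]) (auto simp: eta_one)
  next
    fix r assume r: "r \<in> B"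
    \<comment> \<open>The locale has no module laws to quote. That the scalar -1 negates is obtained
      from the constant polynomials, through
      \<open>\<eta> (const_pol (-1) + 1) = \<eta> 0\<close>.\<close>
    have "(- 1) \<odot> r \<oplus> r = \<zero>" if "r \<in> carrier R"
    proof -
      have "((- 1) \<odot> \<one>) \<oplus> \<one> = \<eta> (const_pol (-1) + 1)"
        by (simp only: eta_const eta_add polys_const polys_1 eta_one)
      also have "const_pol (-1) + 1 = (0 :: 'k mpol)"
        by (simp add: const_pol_def flip: single_one single_add)
      finally have "((- 1) \<odot> \<one> \<oplus> \<one>) \<otimes> r = \<zero>" using that by (simp add: eta_zero)
      then show ?thesis using that by (simp add: l_distr smult_closed smult_mult)
    qed
    then have "\<ominus> r = (- 1) \<odot> r"
      using r by (intro minus_equality) (auto simp: B_def smult_closed)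
    then show "\<ominus> r \<in> B" using Bs[OF r] by simp
  next
    fix r s assume "r \<in> B" "s \<in> B"
    obtain c a where r: "r \<in> carrier R" "c \<in> polys n" "c \<noteq> 0" "a \<in> polys n" "\<eta> c \<otimes> r = \<eta> a"
      using BE[OF \<open>r \<in> B\<close>] .
    obtain d b where s: "s \<in> carrier R" "d \<in> polys n" "d \<noteq> 0" "b \<in> polys n" "\<eta> d \<otimes> s = \<eta> b"
      using BE[OF \<open>s \<in> B\<close>] .
    have ds: "\<eta> (d * c) \<otimes> x = \<eta> d \<otimes> (\<eta> c \<otimes> x)" if "x \<in> carrier R" for x
      using m_assoc[of "\<eta> d" "\<eta> c" x] r(2) s(2) that by (simp only: eta_mult eta_closed)
    have dr: "\<eta> (d * c) \<otimes> r = \<eta> (d * a)" "\<eta> (d * c) \<otimes> s = \<eta> (c * b)"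
      using r s by (simp_all add: ds eta_mult[of d a] eta_mult[of c b] comm[of d c s])
    have "\<eta> (d * c) \<otimes> (r \<oplus> s) = \<eta> (d * a + c * b)"
      using r_distr[OF r(1) s(1) eta_closed[of "d * c"]] r s by (simp only: dr eta_add polys_mult)
    then show "r \<oplus> s \<in> B" using r s by (intro BI[of _ "d * c"]) auto
    \<comment> \<open>First \<open>c\<close> turns \<open>r\<close> into \<open>a\<close>. Then
      \<open>d\<close> is moved past \<open>a\<close>, both being polynomials, so that it meets
      \<open>s\<close> and gives \<open>b\<close>.\<close>
    have "\<eta> (d * c) \<otimes> (r \<otimes> s) = \<eta> (d * a) \<otimes> s"
      using m_assoc[OF eta_closed[of "d * c"] r(1) s(1)] r s by (simp only: dr polys_mult)
    also have "\<dots> = \<eta> d \<otimes> (\<eta> a \<otimes> s)"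
      using m_assoc[of "\<eta> d" "\<eta> a" s] r s by (simp only: eta_mult eta_closed)
    also have "\<dots> = \<eta> a \<otimes> \<eta> b" using comm[of d a s] r s by simp
    also have "\<dots> = \<eta> (a * b)" using r s by (simp only: eta_mult)
    finally show "r \<otimes> s \<in> B" using r s by (intro BI[of _ "d * c"]) auto
  qed
  then have HB: "carrier ?H \<subseteq> B"
    by (rule carrier_generated_subalgebra_subset) (use Bs G clear in \<open>auto simp: B_def\<close>)
  interpret H: ring ?H
    by (rule ring_generated_subalgebra[OF ring_axioms G smult_closed])
  show ?thesis
  proof
    fix p :: "'k mpol" and r
    assume "p \<in> polys n" "p \<noteq> 0" "r \<in> carrier ?H" "r \<otimes>\<^bsub>?H\<^esub> \<eta> p = \<zero>\<^bsub>?H\<^esub>"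
    then show "r = \<zero>\<^bsub>?H\<^esub>" using eta_regular[of p r] sr by auto
  next
    fix r assume "r \<in> carrier ?H"
    then show "\<exists>c\<in>polys n. c \<noteq> 0 \<and> \<eta> c \<otimes>\<^bsub>?H\<^esub> r \<in> \<eta> ` polys n"
      using HB by (auto simp: B_def)
  next
    fix p :: "'k mpol" and k assume "p \<in> polys n"
    then show "\<eta> (const_pol k * p) = k \<odot>\<^bsub>?H\<^esub> \<eta> p" by (simp add: eta_smult)
  qed (use sr one_neq_zero in \<open>auto simp: generated_subalgebra_smult_closed mult_smult subsetD
        eta eta_add eta_mult eta_one\<close>)
qed


section \<open>Multiplication and contraction in divided power coordinates\<close>

lemma lookup_const_pol_mult [simp]:
  "Poly_Mapping.lookup (const_pol k * p) m = k * Poly_Mapping.lookup p m"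
  by (simp add: const_pol_def map.rep_eq when_def flip: mult_map_scale_conv_mult)

lemma lookup_single_mult_add:
  fixes f :: "'k::field mpol"
  shows "Poly_Mapping.lookup (Poly_Mapping.single t k * f) (t + g) = k * Poly_Mapping.lookup f g"
proof -
  have "Poly_Mapping.keys f \<subseteq> UNIV" by simp
  then show ?thesis
    by (induction f rule: poly_mapping_induct_keys)
       (auto simp: mult_single lookup_single when_def distrib_left lookup_add)
qed

section \<open>Multi-index factorials and divided power coordinates\<close>

definition rescale :: "((nat \<Rightarrow>\<^sub>0 nat) \<Rightarrow> 'k) \<Rightarrow> 'k::field mpol \<Rightarrow> 'k mpol" where
  "rescale c = Poly_Mapping.mapp (\<lambda>m a. c m * a)"

lemma lookup_rescale [simp]: "Poly_Mapping.lookup (rescale c p) m = c m * Poly_Mapping.lookup p m"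
  by (simp add: rescale_def lookup_mapp when_def in_keys_iff)

lemma rescale_add: "rescale c (p + q) = rescale c p + rescale c q"
  by (rule poly_mapping_eqI) (simp add: lookup_add distrib_left)

lemma rescale_0 [simp]: "rescale c 0 = 0"
  by (rule poly_mapping_eqI) simp

lemma rescale_const_mult: "rescale c (const_pol k * p) = const_pol k * rescale c p"
  by (rule poly_mapping_eqI) (simp add: mult.left_commute)

lemma rescale_single [simp]:
  "rescale c (Poly_Mapping.single m k) = Poly_Mapping.single m (c m * k)"
  by (rule poly_mapping_eqI) (simp add: lookup_single when_def)

lemma rescale_in_polys [simp]: "p \<in> polys n \<Longrightarrow> rescale c p \<in> polys n"
  by (auto simp: polys_def in_keys_iff)

definition fac :: "(nat \<Rightarrow>\<^sub>0 nat) \<Rightarrow> 'k::field_char_0" where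
  "fac m = (\<Prod>i\<in>Poly_Mapping.keys m. fact (Poly_Mapping.lookup m i))"

lemma fac_neq_0 [simp]: "fac m \<noteq> 0"
  by (simp add: fac_def)

lemma fac_superset:
  assumes "finite A" "Poly_Mapping.keys m \<subseteq> A"
  shows "fac m = (\<Prod>i\<in>A. fact (Poly_Mapping.lookup m i))"
  unfolding fac_def by (rule prod.mono_neutral_left) (use assms in \<open>auto simp: in_keys_iff\<close>)

text \<open>Raising one exponent changes a single factor. This ratio is the source of the
  coefficients in both \<open>partial\<close> and \<open>integration\<close>.\<close>

lemma fac_add_single:
  "fac (m + Poly_Mapping.single i 1) = (of_nat (Poly_Mapping.lookup m i + 1) * fac m :: 'k::field_char_0)"
proof -
  define A where "A = insert i (Poly_Mapping.keys m)"
  have A: "finite A" "i \<in> A" by (auto simp: A_def)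
  have "fac (m + Poly_Mapping.single i 1)
      = (\<Prod>j\<in>A. fact (Poly_Mapping.lookup (m + Poly_Mapping.single i 1) j) :: 'k)"
    by (rule fac_superset) (use keys_add[of m "Poly_Mapping.single i 1"] in \<open>auto simp: A_def\<close>)
  also have "\<dots> = fact (Poly_Mapping.lookup m i + 1) * (\<Prod>j\<in>A - {i}. fact (Poly_Mapping.lookup m j))"
    using A by (subst prod.remove[of A i])
      (auto simp: lookup_add lookup_single when_def intro!: prod.cong)
  also have "\<dots> = of_nat (Poly_Mapping.lookup m i + 1) * (\<Prod>j\<in>A. fact (Poly_Mapping.lookup m j))"
    by (simp add: prod.remove[OF A] algebra_simps)
  also have "(\<Prod>j\<in>A. fact (Poly_Mapping.lookup m j)) = (fac m :: 'k)"
    by (rule fac_superset[symmetric]) (auto simp: A_def)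
  finally show ?thesis .
qed

text \<open>\<open>divided p\<close> lists the coordinates of \<open>p\<close> in the basis x^m /
  m!, where integration and derivation become shifts of exponents. Characteristic zero enters here,
  through the invertibility of m!.\<close>

abbreviation "divided \<equiv> rescale fac"
abbreviation "undivided \<equiv> rescale (\<lambda>m. inverse (fac m))"

lemma divided_undivided [simp]: "divided (undivided p) = p" "undivided (divided p) = p"
  by (auto intro!: poly_mapping_eqI)

text \<open>The contraction action of \<open>K[y\<^sub>1, \<dots>, y\<^sub>n]\<close> on divided powers (Macaulay's inverse system).\<close>

definition contract :: "'k::field mpol \<Rightarrow> 'k mpol \<Rightarrow> 'k mpol" where
  "contract p f = Abs_poly_mapping (\<lambda>g. \<Sum>m\<in>Poly_Mapping.keys p.
     Poly_Mapping.lookup p m * Poly_Mapping.lookup f (m + g))"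

text \<open>The content is that the support is finite: for each of the finitely many
  \<open>m\<close>, the translation by \<open>m\<close> is injective, so only finitely many
  \<open>g\<close> are sent into the support of \<open>f\<close>.\<close>

lemma lookup_contract:
  "Poly_Mapping.lookup (contract p f) g =
     (\<Sum>m\<in>Poly_Mapping.keys p. Poly_Mapping.lookup p m * Poly_Mapping.lookup f (m + g))"
proof -
  let ?c = "\<lambda>g. \<Sum>m\<in>Poly_Mapping.keys p. Poly_Mapping.lookup p m * Poly_Mapping.lookup f (m + g)"
  have "{g. ?c g \<noteq> 0} \<subseteq> (\<Union>m\<in>Poly_Mapping.keys p. {g. m + g \<in> Poly_Mapping.keys f})"
    by (auto simp: in_keys_iff elim!: sum.not_neutral_contains_not_neutral)
  moreover have "finite {g. m + g \<in> Poly_Mapping.keys f}" for m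
    using finite_vimageI[of "Poly_Mapping.keys f" "\<lambda>g. m + g"] by (simp add: vimage_def)
  ultimately have "finite {g. ?c g \<noteq> 0}"
    by (meson finite_UN_I finite_keys finite_subset)
  then show ?thesis by (simp add: contract_def)
qed

lemma lookup_contract_superset:
  assumes "finite A" "Poly_Mapping.keys p \<subseteq> A"
  shows "Poly_Mapping.lookup (contract p f) g =
     (\<Sum>m\<in>A. Poly_Mapping.lookup p m * Poly_Mapping.lookup f (m + g))"
  unfolding lookup_contract
  by (rule sum.mono_neutral_left) (use assms in \<open>auto simp: in_keys_iff\<close>)

lemma contract_add_left: "contract (p + q) f = contract p f + contract q f"
proof (rule poly_mapping_eqI)
  fix g
  let ?A = "Poly_Mapping.keys p \<union> Poly_Mapping.keys q"
  show "Poly_Mapping.lookup (contract (p + q) f) g = Poly_Mapping.lookup (contract p f + contract q f) g"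
    using keys_add[of p q]
    by (simp add: lookup_add lookup_contract_superset[of ?A] sum.distrib[symmetric] distrib_right)
qed

lemma contract_add_right: "contract p (f + g) = contract p f + contract p g"
  by (rule poly_mapping_eqI) (simp add: lookup_contract lookup_add distrib_left sum.distrib)

lemma contract_0 [simp]: "contract 0 f = 0" "contract p 0 = 0"
  by (auto intro!: poly_mapping_eqI simp: lookup_contract)

lemma lookup_contract_single [simp]:
  "Poly_Mapping.lookup (contract (Poly_Mapping.single m k) f) g = k * Poly_Mapping.lookup f (m + g)"
  by (subst lookup_contract_superset[of "{m}"]) auto

lemma contract_const [simp]: "contract (const_pol k) f = const_pol k * f"
proof -
  have "contract (const_pol k) f = contract (Poly_Mapping.single 0 k) f" by (simp add: const_pol_def)
  then show ?thesis by (simp add: poly_mapping_eq_iff fun_eq_iff)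
qed

text \<open>On monomials both sides read the coefficient of \<open>f\<close> at the sum of the two
  shifts; additivity in each argument does the rest.\<close>

lemma contract_mult: "contract (p * q) f = contract p (contract q f)"
proof -
  have single: "contract (Poly_Mapping.single a k * q) f = contract (Poly_Mapping.single a k) (contract q f)"
    for a k
  proof -
    have "Poly_Mapping.keys q \<subseteq> UNIV" by simp
    then show ?thesis
    proof (induction q rule: poly_mapping_induct_keys)
      case (single b l)
      then show ?case by (auto intro!: poly_mapping_eqI simp: mult_single ac_simps)
    qed (auto simp: distrib_left contract_add_left contract_add_right)
  qed
  have "Poly_Mapping.keys p \<subseteq> UNIV" by simp
  then show ?thesis
    by (induction p rule: poly_mapping_induct_keys) (auto simp: distrib_right contract_add_left single)
qed

lemma contract_in_polys:
  assumes "f \<in> polys n"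
  shows "contract p f \<in> polys n"
proof -
  have "Poly_Mapping.keys g \<subseteq> {..<n}" if "g \<in> Poly_Mapping.keys (contract p f)" for g
  proof -
    from that obtain m where "m + g \<in> Poly_Mapping.keys f"
      by (auto simp: in_keys_iff lookup_contract elim!: sum.not_neutral_contains_not_neutral)
    then have "Poly_Mapping.keys (m + g) \<subseteq> {..<n}" using assms by (auto simp: polys_def)
    then show ?thesis by (auto simp: in_keys_iff lookup_add subset_iff)
  qed
  then show ?thesis by (auto simp: polys_def)
qed

section \<open>The order on exponents and surjectivity of contractions\<close>

text \<open>Exponents are compared lexicographically, at the first index where they differ. A
  nonzero exponent is positive at its first nonzero entry, hence exceeds 0.\<close>

lemma add_nonneg_exponent: "(m :: nat \<Rightarrow>\<^sub>0 nat) \<le> m + g"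
proof -
  have "(0 :: nat \<Rightarrow>\<^sub>0 nat) \<le> g"
  proof (cases "g = 0")
    case False
    then have ex: "\<exists>k. Poly_Mapping.lookup g k \<noteq> 0"
      using poly_mapping_eqI[of g 0] by fastforce
    define k where "k = (LEAST k. Poly_Mapping.lookup g k \<noteq> 0)"
    have k: "Poly_Mapping.lookup g k \<noteq> 0" unfolding k_def by (rule LeastI_ex[OF ex])
    have "Poly_Mapping.lookup g j = 0" if "j < k" for j
      using not_less_Least that unfolding k_def by blast
    then have "0 < g"
      unfolding less_poly_mapping.rep_eq less_fun_def using k by (intro exI[of _ k]) simp
    then show ?thesis by simp
  qed simp
  then show ?thesis using add_left_mono[of 0 g m] by simp
qed

text \<open>With infinitely many variables this order is not well founded: the exponents of x_0,
  x_1, x_2, ... form a descending chain. Bounding the variables by \<open>n\<close> turns exponents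
  into lists of length \<open>n\<close> under the lexicographic order.\<close>

lemma wf_exponents: "wf {(a, b). (a :: nat \<Rightarrow>\<^sub>0 nat) < b \<and> Poly_Mapping.keys a \<subseteq> {..<n} \<and> Poly_Mapping.keys b \<subseteq> {..<n}}"
proof (rule wf_subset)
  let ?f = "\<lambda>a. map (Poly_Mapping.lookup a) [0..<n]"
  show "wf (inv_image (lexn less_than n) ?f)"
    by (rule wf_inv_image[OF wf_lexn]) simp
  show "{(a, b). (a :: nat \<Rightarrow>\<^sub>0 nat) < b \<and> Poly_Mapping.keys a \<subseteq> {..<n} \<and> Poly_Mapping.keys b \<subseteq> {..<n}}
      \<subseteq> inv_image (lexn less_than n) ?f"
  proof clarify
    fix a b :: "nat \<Rightarrow>\<^sub>0 nat"
    assume "a < b" and keys: "Poly_Mapping.keys a \<subseteq> {..<n}" "Poly_Mapping.keys b \<subseteq> {..<n}"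
    then obtain k where k: "Poly_Mapping.lookup a k < Poly_Mapping.lookup b k"
      "\<And>j. j < k \<Longrightarrow> Poly_Mapping.lookup a j = Poly_Mapping.lookup b j"
      by (auto simp: less_poly_mapping.rep_eq less_fun_def)
    then have "k \<in> Poly_Mapping.keys b" by (auto simp: in_keys_iff)
    then have "k < n" using keys by auto
    then have split: "[0..<n] = [0..<k] @ k # [Suc k..<n]"
      by (metis upt_conv_Cons upt_add_eq_append le_add_diff_inverse less_imp_le zero_le)
    show "(a, b) \<in> inv_image (lexn less_than n) ?f"
      unfolding in_inv_image lexn_conv using k \<open>k < n\<close>
      by (auto simp: split intro!: exI[of _ "map (Poly_Mapping.lookup b) [0..<k]"])
  qed
qed

text \<open>Let \<open>b\<close> be the least exponent of \<open>p\<close>. Contracting the monomial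
  with exponent b + c by \<open>p\<close> gives a nonzero multiple of the monomial with exponent
  \<open>c\<close>, plus terms with smaller exponents. So well-founded induction on \<open>c\<close>
  puts every monomial into the image \<open>W\<close>.\<close>

lemma contract_surj:
  fixes p :: "'k::field mpol"
  assumes p: "p \<in> polys n" "p \<noteq> 0" and f: "f \<in> polys n"
  shows "\<exists>g\<in>polys n. contract p g = f"
proof -
  define W where "W = contract p ` polys n"
  have W0: "0 \<in> W" by (auto simp: W_def intro!: image_eqI[of _ _ 0])
  have Wadd: "u + v \<in> W" if "u \<in> W" "v \<in> W" for u v
    using that by (auto simp: W_def simp flip: contract_add_right)
  have contract_scale: "contract p (const_pol k * u) = const_pol k * contract p u" for k u
    by (metis contract_const contract_mult mult.commute)
  have Wscale: "const_pol k * u \<in> W" if "u \<in> W" for k u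
    using that by (auto simp: W_def simp flip: contract_scale)
  define b where "b = Min (Poly_Mapping.keys p)"
  have b: "b \<in> Poly_Mapping.keys p" "\<And>m. m \<in> Poly_Mapping.keys p \<Longrightarrow> b \<le> m"
    using p by (auto simp: b_def)
  have *: "Poly_Mapping.single c 1 \<in> W" if "Poly_Mapping.keys c \<subseteq> {..<n}" for c
    using that
  proof (induction c rule: wf_induct_rule[OF wf_exponents[of n]])
    case (1 c)
    \<comment> \<open>The remainder after removing the leading term; it has to consist of smaller
      exponents in the same \<open>n\<close> variables.\<close>
    define h where "h = contract p (Poly_Mapping.single (b + c) 1)
        - const_pol (Poly_Mapping.lookup p b) * Poly_Mapping.single c 1"
    have "Poly_Mapping.keys b \<subseteq> {..<n}" using b p by (simp add: polys_def)
    then have bc: "Poly_Mapping.single (b + c) (1::'k) \<in> polys n"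
      using keys_add[of b c] 1 by (intro polys_single) blast
    have "Poly_Mapping.keys h \<subseteq> {d. d < c \<and> Poly_Mapping.keys d \<subseteq> {..<n}}"
    proof
      fix d assume d: "d \<in> Poly_Mapping.keys h"
      have "h \<in> polys n" unfolding h_def
        by (intro polys_diff contract_in_polys bc polys_mult polys_const polys_single 1)
      then have dn: "Poly_Mapping.keys d \<subseteq> {..<n}" using d by (auto simp: polys_def)
      have lh: "Poly_Mapping.lookup h d = (\<Sum>m\<in>Poly_Mapping.keys p. Poly_Mapping.lookup p m
          * (if b + c = m + d then 1 else 0)) - (if c = d then Poly_Mapping.lookup p b else 0)"
        by (simp add: h_def lookup_minus lookup_contract lookup_single when_def)
      \<comment> \<open>At exponent \<open>c\<close> only \<open>m = b\<close> contributes, and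
        \<open>h\<close> subtracts precisely this term.\<close>
      have "d \<noteq> c"
      proof
        assume "d = c"
        then have "Poly_Mapping.lookup h d = (\<Sum>m\<in>Poly_Mapping.keys p. 
          (if b = m then Poly_Mapping.lookup p m else 0)) - Poly_Mapping.lookup p b"
          unfolding lh by (intro arg_cong2[where f = minus] sum.cong) auto
        then show False using d b by (auto simp: in_keys_iff)
      qed
      then have "(\<Sum>m\<in>Poly_Mapping.keys p. Poly_Mapping.lookup p m
          * (if b + c = m + d then 1 else 0)) \<noteq> 0" using d lh by (auto simp: in_keys_iff)
      then obtain m where m: "m \<in> Poly_Mapping.keys p" "b + c = m + d"
        by (auto elim!: sum.not_neutral_contains_not_neutral split: if_splits)
      \<comment> \<open>In \<open>b + c = m + d\<close> the choice of \<open>b\<close> gives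
        \<open>b \<le> m\<close>, so \<open>d\<close> cannot exceed \<open>c\<close>.\<close>
      have "d \<le> c"
      proof (rule ccontr)
        assume "\<not> d \<le> c"
        then have "b + c < m + d" using b(2)[OF m(1)] by (intro add_le_less_mono) auto
        then show False using m by simp
      qed
      then show "d \<in> {d. d < c \<and> Poly_Mapping.keys d \<subseteq> {..<n}}" using dn \<open>d \<noteq> c\<close> by auto
    qed
    then have "h \<in> W"
    proof (induction h rule: poly_mapping_induct_keys)
      case (single m k)
      then show ?case
        by (subst single_eq_const_mult) (intro Wscale, use 1 in auto)
    qed (auto simp: W0 Wadd)
    moreover have "contract p (Poly_Mapping.single (b + c) 1) \<in> W" using bc by (auto simp: W_def)
    \<comment> \<open>Solve for the leading term and divide by its coefficient, which is nonzero
      because \<open>b\<close> lies in the support of \<open>p\<close>.\<close>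
    ultimately have "const_pol (inverse (Poly_Mapping.lookup p b)) *
        (contract p (Poly_Mapping.single (b + c) 1) + const_pol (- 1) * h) \<in> W"
      by (intro Wscale Wadd)
    moreover have "const_pol (- 1) * h = - h"
      by (rule poly_mapping_eqI) simp
    then have "contract p (Poly_Mapping.single (b + c) 1) + const_pol (- 1) * h =
        const_pol (Poly_Mapping.lookup p b) * Poly_Mapping.single c 1"
      by (simp add: h_def)
    moreover have "const_pol (inverse (Poly_Mapping.lookup p b)) *
        (const_pol (Poly_Mapping.lookup p b) * Poly_Mapping.single c 1) = Poly_Mapping.single c 1"
      using b by (simp add: const_pol_def mult_single in_keys_iff)
    ultimately show ?case by simp
  qed
  have "Poly_Mapping.keys f \<subseteq> {m. Poly_Mapping.keys m \<subseteq> {..<n}}" using f by (auto simp: polys_def)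
  then have "f \<in> W"
  proof (induction f rule: poly_mapping_induct_keys)
    case (single m k)
    then show ?case by (subst single_eq_const_mult) (intro Wscale *, simp)
  qed (auto simp: W0 Wadd)
  then show ?thesis by (auto simp: W_def)
qed


section \<open>Endomorphisms of the polynomial algebra\<close>

lemma End_simps [simp]:
  "\<one>\<^bsub>End_polys K n\<^esub> = (\<lambda>p\<in>polys n. p)" "\<zero>\<^bsub>End_polys K n\<^esub> = (\<lambda>p\<in>polys n. 0)"
  "f \<oplus>\<^bsub>End_polys K n\<^esub> g = (\<lambda>p\<in>polys n. f p + g p)"
  "f \<otimes>\<^bsub>End_polys K n\<^esub> g = compose (polys n) f g"
  "k \<odot>\<^bsub>End_polys K n\<^esub> f = (\<lambda>p\<in>polys n. const_pol k * f p)"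
  by (simp_all add: End_polys_def)

lemma End_carrierI:
  assumes "f \<in> extensional (polys n)" "\<And>p. p \<in> polys n \<Longrightarrow> f p \<in> polys n"
    "\<And>p q. p \<in> polys n \<Longrightarrow> q \<in> polys n \<Longrightarrow> f (p + q) = f p + f q"
    "\<And>k p. p \<in> polys n \<Longrightarrow> f (const_pol k * p) = const_pol k * f p"
  shows "f \<in> carrier (End_polys K n)"
  using assms by (auto simp: End_polys_def PiE_def)

lemma End_carrierD:
  assumes "f \<in> carrier (End_polys K n)"
  shows "f \<in> extensional (polys n)" "p \<in> polys n \<Longrightarrow> f p \<in> polys n"
    "p \<in> polys n \<Longrightarrow> q \<in> polys n \<Longrightarrow> f (p + q) = f p + f q"
    "p \<in> polys n \<Longrightarrow> f (const_pol k * p) = const_pol k * f p"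
  using assms by (auto simp: End_polys_def PiE_def)

lemma End_eqI:
  assumes "f \<in> extensional (polys n)" "g \<in> extensional (polys n)"
    "\<And>p. p \<in> polys n \<Longrightarrow> f p = g p"
  shows "f = g"
  using assms by (rule extensionalityI)

lemma ring_End: "ring (End_polys (K :: 'k::field itself) n)"
proof (rule ringI)
  let ?E = "End_polys K n"
  show "abelian_group ?E"
  proof (rule abelian_groupI)
    fix f assume f: "f \<in> carrier ?E"
    have minus: "const_pol (- 1) * p = - p" for p :: "'k mpol"
      by (rule poly_mapping_eqI) simp
    have "(\<lambda>p\<in>polys n. const_pol (- 1) * f p) \<in> carrier ?E"
      using End_carrierD[OF f]
      by (intro End_carrierI) (auto simp: distrib_left mult.left_commute)
    then show "\<exists>g\<in>carrier ?E. g \<oplus>\<^bsub>?E\<^esub> f = \<zero>\<^bsub>?E\<^esub>"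
      by (rule rev_bexI) (auto intro!: End_eqI simp: minus)
  qed (auto intro!: End_carrierI End_eqI
        simp: End_carrierD distrib_left add.assoc add.commute add.left_commute)
  show "monoid ?E"
    by (rule monoidI) (auto intro!: End_carrierI End_eqI simp: End_carrierD compose_def)
qed (auto intro!: End_eqI simp: End_carrierD compose_def)

lemma End_smult_closed: "f \<in> carrier (End_polys K n) \<Longrightarrow> k \<odot>\<^bsub>End_polys K n\<^esub> f \<in> carrier (End_polys K n)"
  by (auto intro!: End_carrierI simp: End_carrierD distrib_left mult.left_commute)

lemma End_mult_smult:
  assumes "f \<in> carrier (End_polys K n)" "g \<in> carrier (End_polys K n)"
  shows "f \<otimes>\<^bsub>End_polys K n\<^esub> (k \<odot>\<^bsub>End_polys K n\<^esub> g) = k \<odot>\<^bsub>End_polys K n\<^esub> (f \<otimes>\<^bsub>End_polys K n\<^esub> g)"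
  using assms by (auto intro!: End_eqI simp: End_carrierD compose_def)

lemma End_smult_mult:
  assumes "f \<in> carrier (End_polys K n)" "g \<in> carrier (End_polys K n)"
  shows "(k \<odot>\<^bsub>End_polys K n\<^esub> f) \<otimes>\<^bsub>End_polys K n\<^esub> g = k \<odot>\<^bsub>End_polys K n\<^esub> (f \<otimes>\<^bsub>End_polys K n\<^esub> g)"
  using assms by (auto intro!: End_eqI simp: End_carrierD compose_def)

section \<open>Endomorphisms given by actions of the polynomial ring\<close>

text \<open>Conjugation by \<open>divided\<close> carries an action in divided power coordinates
  back to ordinary polynomials.\<close>

definition operator ::
    "('k::field_char_0 mpol \<Rightarrow> 'k mpol \<Rightarrow> 'k mpol) \<Rightarrow> nat \<Rightarrow> 'k mpol \<Rightarrow> 'k mpol \<Rightarrow> 'k mpol" where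
  "operator A n p = (\<lambda>f\<in>polys n. undivided (A p (divided f)))"

locale polynomial_action =
  fixes A :: "'k::field_char_0 mpol \<Rightarrow> 'k mpol \<Rightarrow> 'k mpol" and n :: nat
  assumes add_left: "A (p + q) f = A p f + A q f"
    and add_right: "A p (f + g) = A p f + A p g"
    and mult: "A (p * q) f = A p (A q f)"
    and const: "A (const_pol k) f = const_pol k * f"
    and closed: "p \<in> polys n \<Longrightarrow> f \<in> polys n \<Longrightarrow> A p f \<in> polys n"
begin

text \<open>Linearity over the ground field comes from commutativity: constants act as scalars, and
  they commute with \<open>p\<close>.\<close>

lemma const_right: "A p (const_pol k * f) = const_pol k * A p f"
  by (metis const mult mult.commute)

lemma operator_closed: "p \<in> polys n \<Longrightarrow> operator A n p \<in> carrier (End_polys K n)"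
  by (rule End_carrierI) (auto simp: operator_def closed rescale_add add_right rescale_const_mult const_right)

lemma operator_add:
  "operator A n (p + q) = operator A n p \<oplus>\<^bsub>End_polys K n\<^esub> operator A n q"
  by (auto intro!: End_eqI simp: operator_def add_left rescale_add)

lemma operator_mult: "q \<in> polys n \<Longrightarrow>
    operator A n (p * q) = operator A n p \<otimes>\<^bsub>End_polys K n\<^esub> operator A n q"
  by (auto intro!: End_eqI simp: operator_def mult compose_def closed)

lemma operator_one: "operator A n 1 = \<one>\<^bsub>End_polys K n\<^esub>"
  using const[of 1] by (auto intro!: End_eqI simp: operator_def const_pol_def)

lemma operator_smult: "operator A n (const_pol k * p) = k \<odot>\<^bsub>End_polys K n\<^esub> operator A n p"
  by (auto intro!: End_eqI simp: operator_def mult const rescale_const_mult)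

end

lemma polynomial_action_contract: "polynomial_action contract n"
  by unfold_locales
     (auto simp: contract_add_left contract_add_right contract_mult contract_in_polys)

lemma polynomial_action_times: "polynomial_action (*) n"
  by unfold_locales (auto simp: distrib_left distrib_right mult.assoc)

lemma End_one_neq_zero: "\<one>\<^bsub>End_polys K n\<^esub> \<noteq> \<zero>\<^bsub>End_polys (K :: 'k::field itself) n\<^esub>"
proof
  assume "\<one>\<^bsub>End_polys K n\<^esub> = \<zero>\<^bsub>End_polys K n\<^esub>"
  then have "(\<lambda>p\<in>polys n. p) (1 :: 'k mpol) = (\<lambda>p\<in>polys n. 0) (1 :: 'k mpol)" by simp
  then show False by simp
qed

lemma polynomial_hom_contract:
  fixes K :: "'k::field_char_0 itself"
  shows "polynomial_hom (End_polys K n) n (operator contract n)"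
proof -
  interpret A: polynomial_action contract n by (rule polynomial_action_contract)
  interpret ring "End_polys K n" by (rule ring_End)
  show ?thesis
  proof
    fix p r assume p: "p \<in> polys n" "p \<noteq> 0" and r: "r \<in> carrier (End_polys K n)"
      "r \<otimes>\<^bsub>End_polys K n\<^esub> operator contract n p = \<zero>\<^bsub>End_polys K n\<^esub>"
    have "r f = 0" if f: "f \<in> polys n" for f
    proof -
      \<comment> \<open>A preimage in divided power coordinates; \<open>undivided g\<close> is then
        sent to \<open>f\<close>, so \<open>r f\<close> is a value of the vanishing
        composite.\<close>
      obtain g where g: "g \<in> polys n" "contract p g = divided f"
        using contract_surj[OF p, of "divided f"] f by auto
      have "(r \<otimes>\<^bsub>End_polys K n\<^esub> operator contract n p) (undivided g) = r f"
        using g by (simp add: compose_def operator_def)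
      then show ?thesis using r g by simp
    qed
    then show "r = \<zero>\<^bsub>End_polys K n\<^esub>"
      using End_carrierD(1)[OF r(1)] by (intro End_eqI) auto
  qed (auto simp del: End_simps simp: End_one_neq_zero End_smult_closed End_mult_smult
      A.operator_closed A.operator_add[where K = K] A.operator_mult[where K = K] A.operator_one[where K = K] A.operator_smult[where K = K])
qed

lemma polynomial_hom_times:
  fixes K :: "'k::field_char_0 itself"
  shows "polynomial_hom (opposite (End_polys K n)) n (operator (*) n)"
proof -
  interpret A: polynomial_action "(*)" n by (rule polynomial_action_times)
  interpret ring "opposite (End_polys K n)" by (rule ring_opposite[OF ring_End])
  show ?thesis
  proof
    fix p r assume p: "p \<in> polys n" "p \<noteq> 0" and r: "r \<in> carrier (opposite (End_polys K n))"
      "r \<otimes>\<^bsub>opposite (End_polys K n)\<^esub> operator (*) n p = \<zero>\<^bsub>opposite (End_polys K n)\<^esub>"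
    have "r f = 0" if f: "f \<in> polys n" for f
    proof -
      have "(operator (*) n p \<otimes>\<^bsub>End_polys K n\<^esub> r) f = 0" using r(2) f by simp
      \<comment> \<open>In the opposite ring the operator of \<open>p\<close> is applied after
        \<open>r\<close>. Injectivity is what is needed here, and multiplication by a nonzero
        polynomial has it.\<close>
      then have "undivided (p * divided (r f)) = 0"
        using f r End_carrierD(2)[of r K n f] by (simp add: compose_def operator_def)
      then have "p * divided (r f) = 0"
        by (metis divided_undivided(1) rescale_0)
      then show ?thesis using p by (metis divided_undivided(2) rescale_0 mult_eq_0_iff)
    qed
    then show "r = \<zero>\<^bsub>opposite (End_polys K n)\<^esub>"
      using End_carrierD(1)[of r K n] r by (auto intro!: End_eqI)
  next
    fix p q :: "'k mpol" assume "p \<in> polys n" "q \<in> polys n"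
    then show "operator (*) n (p * q) = operator (*) n p \<otimes>\<^bsub>opposite (End_polys K n)\<^esub> operator (*) n q"
      using A.operator_mult[of p q K] by (simp add: mult.commute)
  qed (auto simp del: End_simps simp: End_one_neq_zero End_smult_closed End_smult_mult
      A.operator_closed A.operator_add[where K = K] A.operator_one[where K = K] A.operator_smult[where K = K])
qed

section \<open>Derivations and integrations in divided power coordinates\<close>

lemma poly_mapping_sum_single: "p = (\<Sum>m\<in>Poly_Mapping.keys p. Poly_Mapping.single m (Poly_Mapping.lookup p m))"
proof (rule poly_mapping_eqI)
  fix k
  show "Poly_Mapping.lookup p k = Poly_Mapping.lookup
     (\<Sum>m\<in>Poly_Mapping.keys p. Poly_Mapping.single m (Poly_Mapping.lookup p m)) k"
    by (auto simp: lookup_sum lookup_single when_def in_keys_iff)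
qed

lemma additive_sum:
  assumes "\<And>p q. F (p + q) = F p + (F q :: 'b::comm_monoid_add)" "F 0 = 0"
  shows "F (\<Sum>i\<in>I. f i) = (\<Sum>i\<in>I. F (f i))"
  by (induction I rule: infinite_finite_induct) (auto simp: assms)

text \<open>On a monomial, conjugating the shift by factorials produces m! / (m + e_i)! = 1 / (m_i +
  1), the coefficient of integration.\<close>

lemma integration_eq: "integration i f = undivided (var i * divided f)"
proof -
  define F where "F f = undivided (var i * divided f)" for f :: "'a mpol"
  have "F f = (\<Sum>m\<in>Poly_Mapping.keys f. F (Poly_Mapping.single m (Poly_Mapping.lookup f m)))"
    by (subst (1) poly_mapping_sum_single[of f], rule additive_sum)
       (auto simp: F_def rescale_add distrib_left)
  also have "\<dots> = integration i f"
    unfolding integration_def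
  proof (rule sum.cong[OF refl])
    fix m
    have cancel: "inverse (c * b) * (b * a) = inverse c * a" if "b \<noteq> 0" for a b c :: 'a
      using that by (simp add: field_simps)
    have "inverse (fac (m + Poly_Mapping.single i 1)) * (fac m * a) =
        inverse (of_nat (Poly_Mapping.lookup m i + 1)) * a" for a :: 'a
      unfolding fac_add_single by (rule cancel) simp
    then show "F (Poly_Mapping.single m (Poly_Mapping.lookup f m)) =
      Poly_Mapping.single (m + Poly_Mapping.single i 1)
        (inverse (of_nat (Poly_Mapping.lookup m i + 1)) * Poly_Mapping.lookup f m)"
      unfolding F_def var_def rescale_single mult_single add.commute[of _ m] by (simp only: mult_1)
  qed
  finally show ?thesis by (simp add: F_def)
qed

lemma contract_var_single_eq_0:
  assumes "Poly_Mapping.lookup m i = 0"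
  shows "contract (var i) (Poly_Mapping.single m a) = 0"
proof -
  have "m \<noteq> Poly_Mapping.single i 1 + g" for g
    using assms by (auto simp: lookup_add)
  then show ?thesis
    unfolding var_def by (intro poly_mapping_eqI) (simp add: lookup_single when_def del: One_nat_def)
qed

lemma contract_var_single_add:
  "contract (var i) (Poly_Mapping.single (g + Poly_Mapping.single i 1) a) = Poly_Mapping.single g a"
proof (rule poly_mapping_eqI)
  fix k
  have "g + Poly_Mapping.single i 1 = Poly_Mapping.single i 1 + k \<longleftrightarrow> g = k"
    unfolding add.commute[of _ k] by simp
  then show "Poly_Mapping.lookup (contract (var i) (Poly_Mapping.single (g + Poly_Mapping.single i 1) a)) k =
      Poly_Mapping.lookup (Poly_Mapping.single g a) k"
    by (simp add: var_def lookup_single when_def del: One_nat_def)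
qed

lemma exponent_split:
  fixes m :: "nat \<Rightarrow>\<^sub>0 nat"
  assumes "Poly_Mapping.lookup m i \<noteq> 0"
  shows "m = (m - Poly_Mapping.single i 1) + Poly_Mapping.single i 1"
  using assms by (auto simp: lookup_add lookup_minus lookup_single when_def intro!: poly_mapping_eqI)

text \<open>On a monomial with m_i > 0 the factor is m! / (m - e_i)! = m_i. If m_i = 0, the
  contraction vanishes, as does the coefficient m_i.\<close>

lemma partial_eq: "partial i f = undivided (contract (var i) (divided f))"
proof -
  define F where "F f = undivided (contract (var i) (divided f))" for f :: "'a mpol"
  have "F f = (\<Sum>m\<in>Poly_Mapping.keys f. F (Poly_Mapping.single m (Poly_Mapping.lookup f m)))"
    by (subst (1) poly_mapping_sum_single[of f], rule additive_sum)
       (auto simp: F_def rescale_add contract_add_right)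
  also have "\<dots> = partial i f"
    unfolding partial_def
  proof (rule sum.cong[OF refl])
    fix m
    show "F (Poly_Mapping.single m (Poly_Mapping.lookup f m)) =
      Poly_Mapping.single (m - Poly_Mapping.single i 1)
        (of_nat (Poly_Mapping.lookup m i) * Poly_Mapping.lookup f m)"
    proof (cases "Poly_Mapping.lookup m i = 0")
      case True
      then show ?thesis by (simp add: F_def contract_var_single_eq_0)
    next
      case False
      define g where "g = m - Poly_Mapping.single i 1"
      have m: "m = g + Poly_Mapping.single i 1"
        unfolding g_def using False by (rule exponent_split)
      have "F (Poly_Mapping.single m (Poly_Mapping.lookup f m))
         = Poly_Mapping.single g (inverse (fac g) * (fac m * Poly_Mapping.lookup f m))"
        unfolding F_def rescale_single by (subst (1) m, subst contract_var_single_add) simp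
      also have "inverse (fac g) * (fac m * Poly_Mapping.lookup f m)
          = of_nat (Poly_Mapping.lookup m i) * Poly_Mapping.lookup f m"
        unfolding m fac_add_single by (simp add: lookup_add field_simps)
      finally show ?thesis by (simp add: g_def)
    qed
  qed
  finally show ?thesis by (simp add: F_def)
qed

lemma restrict_partial: "restrict (partial i) (polys n) = operator contract n (var i)"
  by (auto simp: operator_def partial_eq)

lemma restrict_integration: "restrict (integration i) (polys n) = operator (*) n (var i)"
  by (auto simp: operator_def integration_eq)

lemma contract_var_mult: "contract (var i) (var i * f) = f"
  unfolding var_def by (rule poly_mapping_eqI) (simp add: lookup_single_mult_add)

text \<open>Whether a monomial is killed depends on its exponent at \<open>j\<close>, and
  multiplication by another variable leaves that exponent alone. For equal indices this fails: the
  constant 1 is fixed by the left side and killed by the right.\<close>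

lemma contract_var_var_mult:
  assumes "i \<noteq> j"
  shows "contract (var j) (var i * f) = var i * contract (var j) f"
proof -
  have "Poly_Mapping.keys f \<subseteq> UNIV" by simp
  then show ?thesis
  proof (induction f rule: poly_mapping_induct_keys)
    case (single m k)
    have vm: "var i * Poly_Mapping.single m' k = Poly_Mapping.single (m' + Poly_Mapping.single i 1) k" for m'
      by (simp add: var_def mult_single add.commute)
    show ?case
    proof (cases "Poly_Mapping.lookup m j = 0")
      case True
      moreover from True have "Poly_Mapping.lookup (m + Poly_Mapping.single i 1) j = 0"
        using assms by (simp add: lookup_add lookup_single when_def)
      ultimately show ?thesis unfolding vm by (simp only: contract_var_single_eq_0 mult_zero_right)
    next
      case False
      define g where "g = m - Poly_Mapping.single j 1"
      have m: "m = g + Poly_Mapping.single j 1" unfolding g_def using False by (rule exponent_split)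
      have "m + Poly_Mapping.single i 1 = (g + Poly_Mapping.single i 1) + Poly_Mapping.single j 1"
        unfolding m by (simp only: ac_simps)
      then have "contract (var j) (var i * Poly_Mapping.single m k) = Poly_Mapping.single (g + Poly_Mapping.single i 1) k"
        unfolding vm by (simp only: contract_var_single_add)
      also have "\<dots> = var i * contract (var j) (Poly_Mapping.single m k)"
        unfolding m contract_var_single_add vm ..
      finally show ?thesis .
    qed
  qed (auto simp: distrib_left contract_add_right)
qed

lemma partial_integration:
  assumes "i < n"
  shows "operator contract n (var i) \<otimes>\<^bsub>End_polys K n\<^esub> operator (*) n (var i) = \<one>\<^bsub>End_polys K n\<^esub>"
  using assms
  by (auto intro!: End_eqI simp: compose_def operator_def contract_var_mult)

definition gens :: "'k::field_char_0 itself \<Rightarrow> nat \<Rightarrow> ('k mpol \<Rightarrow> 'k mpol) set" where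
  "gens K n = {operator contract n (var i) | i. i < n} \<union> {operator (*) n (var i) | i. i < n}"

lemma integro_differential_eq: "integro_differential K n = generated_subalgebra (End_polys K n) (gens K n)"
  by (simp add: integro_differential_def gens_def restrict_partial restrict_integration)

lemma gens_subset: "gens K n \<subseteq> carrier (End_polys K n)"
  by (auto simp: gens_def intro!: polynomial_action.operator_closed
      polynomial_action_contract polynomial_action_times)

lemma var_neq_0: "var i \<noteq> 0"
  unfolding var_def by (metis lookup_single_eq lookup_zero zero_neq_one)

lemma left_polynomial_ring_integro_differential:
  "left_polynomial_ring (integro_differential K n) n (operator contract n)"
proof -
  interpret polynomial_hom "End_polys K n" n "operator contract n" by (rule polynomial_hom_contract)
  show ?thesis
    unfolding integro_differential_eq
  proof (rule left_polynomial_ring_generated[OF End_smult_mult gens_subset])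
    show "operator contract n (var i) \<in> gens K n" if "i < n" for i
      using that by (auto simp: gens_def)
    fix g assume "g \<in> gens K n"
    then consider i where "i < n" "g = operator contract n (var i)"
      | i where "i < n" "g = operator (*) n (var i)" by (auto simp: gens_def)
    then show "\<exists>c\<in>polys n. c \<noteq> 0 \<and> operator contract n c \<otimes>\<^bsub>End_polys K n\<^esub> g \<in> operator contract n ` polys n"
    proof cases
      case 1
      have "operator contract n 1 \<otimes>\<^bsub>End_polys K n\<^esub> g = operator contract n (var i)"
        using 1 eta_mult[of 1 "var i"] by simp
      then show ?thesis using 1 by (intro bexI[of _ 1]) (auto simp del: End_simps)
    next
      case 2
      \<comment> \<open>The relation y_i x_i = 1: the generator x_i is cleared by the polynomial
        y_i.\<close>
      have "operator contract n (var i) \<otimes>\<^bsub>End_polys K n\<^esub> g = operator contract n 1"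
        using 2 partial_integration[of i n K] eta_one by (simp del: End_simps)
      then show ?thesis using 2 by (intro bexI[of _ "var i"]) (auto simp del: End_simps simp: var_neq_0)
    qed
  qed
qed

text \<open>The two families exchange roles. In the opposite ring the relation y_i x_i = 1 is read
  backwards, and the derivation y_i is cleared by the integration x_i.\<close>

lemma left_polynomial_ring_opposite_integro_differential:
  "left_polynomial_ring (opposite (integro_differential K n)) n (operator (*) n)"
proof -
  interpret polynomial_hom "opposite (End_polys K n)" n "operator (*) n" by (rule polynomial_hom_times)
  show ?thesis
    unfolding integro_differential_eq generated_subalgebra_opposite[OF ring_End, symmetric]
  proof (rule left_polynomial_ring_generated)
    show "gens K n \<subseteq> carrier (opposite (End_polys K n))" using gens_subset by (simp del: End_simps)
    show "(k \<odot>\<^bsub>opposite (End_polys K n)\<^esub> r) \<otimes>\<^bsub>opposite (End_polys K n)\<^esub> s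
        = k \<odot>\<^bsub>opposite (End_polys K n)\<^esub> (r \<otimes>\<^bsub>opposite (End_polys K n)\<^esub> s)"
      if "r \<in> carrier (opposite (End_polys K n))" "s \<in> carrier (opposite (End_polys K n))" for k r s
      using that End_mult_smult[of s K n r k] by (simp del: End_simps)
    show "operator (*) n (var i) \<in> gens K n" if "i < n" for i
      using that by (auto simp: gens_def)
    fix g assume "g \<in> gens K n"
    then consider i where "i < n" "g = operator (*) n (var i)"
      | i where "i < n" "g = operator contract n (var i)" by (auto simp: gens_def)
    then show "\<exists>c\<in>polys n. c \<noteq> 0 \<and>
        operator (*) n c \<otimes>\<^bsub>opposite (End_polys K n)\<^esub> g \<in> operator (*) n ` polys n"
    proof cases
      case 1
      have "operator (*) n 1 \<otimes>\<^bsub>opposite (End_polys K n)\<^esub> g = operator (*) n (var i)"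
        using 1 eta_mult[of 1 "var i"] by simp
      then show ?thesis using 1 by (intro bexI[of _ 1]) (auto simp del: End_simps opposite_simps)
    next
      case 2
      have "operator (*) n (var i) \<otimes>\<^bsub>opposite (End_polys K n)\<^esub> g = operator (*) n 1"
        using 2 partial_integration[of i n K] eta_one by (simp del: End_simps)
      then show ?thesis using 2
        by (intro bexI[of _ "var i"]) (auto simp del: End_simps opposite_simps simp: var_neq_0)
    qed
  qed
qed


section \<open>Free algebras\<close>

lemma free_simps [simp]:
  "carrier (free_algebra K G) = {f. Poly_Mapping.keys f \<subseteq> lists G}"
  "\<one>\<^bsub>free_algebra K G\<^esub> = word []" "\<zero>\<^bsub>free_algebra K G\<^esub> = 0"
  "f \<oplus>\<^bsub>free_algebra K G\<^esub> g = f + g"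
  by (simp_all add: free_algebra_def word_def)

lemma free_mult_0 [simp]:
  "0 \<otimes>\<^bsub>free_algebra K G\<^esub> g = 0" "f \<otimes>\<^bsub>free_algebra K G\<^esub> 0 = 0"
  by (simp_all add: free_algebra_def)

lemma free_mult_single [simp]:
  "Poly_Mapping.single u a \<otimes>\<^bsub>free_algebra K G\<^esub> Poly_Mapping.single v b = Poly_Mapping.single (u @ v) (a * b)"
  by (cases "a = 0"; cases "b = 0") (auto simp: free_algebra_def)

lemma free_distrib_left:
  "f \<otimes>\<^bsub>free_algebra K G\<^esub> (g + h) = (f \<otimes>\<^bsub>free_algebra K G\<^esub> g) + (f \<otimes>\<^bsub>free_algebra K G\<^esub> h)"
proof -
  have "(\<Sum>v\<in>Poly_Mapping.keys (g + h). Poly_Mapping.single (u @ v) (a * Poly_Mapping.lookup (g + h) v)) =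
      (\<Sum>v\<in>Poly_Mapping.keys g. Poly_Mapping.single (u @ v) (a * Poly_Mapping.lookup g v)) +
      (\<Sum>v\<in>Poly_Mapping.keys h. Poly_Mapping.single (u @ v) (a * Poly_Mapping.lookup h v))" for u a
    by (rule setsum_keys_plus_distrib) (auto simp: distrib_left single_add)
  then show ?thesis by (simp add: free_algebra_def sum.distrib)
qed

lemma free_distrib_right:
  "(f + g) \<otimes>\<^bsub>free_algebra K G\<^esub> h = (f \<otimes>\<^bsub>free_algebra K G\<^esub> h) + (g \<otimes>\<^bsub>free_algebra K G\<^esub> h)"
  unfolding free_algebra_def monoid.simps
  by (rule setsum_keys_plus_distrib) (auto simp: distrib_right single_add sum.distrib)

lemma free_assoc:
  fixes f g h :: "'g list \<Rightarrow>\<^sub>0 'k::field"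
  shows "(f \<otimes>\<^bsub>free_algebra K G\<^esub> g) \<otimes>\<^bsub>free_algebra K G\<^esub> h = f \<otimes>\<^bsub>free_algebra K G\<^esub> (g \<otimes>\<^bsub>free_algebra K G\<^esub> h)"
proof -
  have univ: "Poly_Mapping.keys p \<subseteq> UNIV" for p :: "'g list \<Rightarrow>\<^sub>0 'k" by simp
  show ?thesis
    using univ[of f]
  proof (induction f rule: poly_mapping_induct_keys)
    case (single u a)
    show ?case
      using univ[of g]
    proof (induction g rule: poly_mapping_induct_keys)
      case (single v b)
      show ?case
        using univ[of h]
        by (induction h rule: poly_mapping_induct_keys)
           (auto simp: free_distrib_left mult.assoc)
    qed (auto simp: free_distrib_left free_distrib_right)
  qed (auto simp: free_distrib_right)
qed

lemma free_one:
  "word [] \<otimes>\<^bsub>free_algebra K G\<^esub> f = f" "f \<otimes>\<^bsub>free_algebra K G\<^esub> word [] = f"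
proof -
  have "Poly_Mapping.keys f \<subseteq> UNIV" by simp
  then show "word [] \<otimes>\<^bsub>free_algebra K G\<^esub> f = f"
    by (induction f rule: poly_mapping_induct_keys) (auto simp: free_distrib_left word_def)
  have "Poly_Mapping.keys f \<subseteq> UNIV" by simp
  then show "f \<otimes>\<^bsub>free_algebra K G\<^esub> word [] = f"
    by (induction f rule: poly_mapping_induct_keys) (auto simp: free_distrib_right word_def)
qed

lemma free_closed:
  assumes "Poly_Mapping.keys f \<subseteq> lists G" "Poly_Mapping.keys g \<subseteq> lists G"
  shows "Poly_Mapping.keys (f \<otimes>\<^bsub>free_algebra K G\<^esub> g) \<subseteq> lists G"
  using assms(1)
proof (induction f rule: poly_mapping_induct_keys)
  case (single u a)
  note u = single
  show ?case
    using assms(2)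
  proof (induction g rule: poly_mapping_induct_keys)
    case (single v b)
    then show ?case using u by simp
  next
    case (add p q)
    then show ?case
      unfolding free_distrib_left by (intro order_trans[OF keys_add]) auto
  qed auto
next
  case (add p q)
  then show ?case
    unfolding free_distrib_right by (intro order_trans[OF keys_add]) auto
qed auto

lemma ring_free: "ring (free_algebra K G)"
proof (rule ringI)
  show "abelian_group (free_algebra K G)"
  proof (rule abelian_groupI)
    fix f g assume "f \<in> carrier (free_algebra K G)" "g \<in> carrier (free_algebra K G)"
    then show "f \<oplus>\<^bsub>free_algebra K G\<^esub> g \<in> carrier (free_algebra K G)"
      using keys_add[of f g] by auto
  next
    fix f assume f: "f \<in> carrier (free_algebra K G)"
    have "Poly_Mapping.keys (- f) = Poly_Mapping.keys f" by (auto simp: in_keys_iff)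
    then show "\<exists>g\<in>carrier (free_algebra K G). g \<oplus>\<^bsub>free_algebra K G\<^esub> f = \<zero>\<^bsub>free_algebra K G\<^esub>"
      using f by (intro bexI[of _ "- f"]) auto
  qed (auto simp: ac_simps)
  show "monoid (free_algebra K G)"
  proof (rule monoidI)
    fix f g assume "f \<in> carrier (free_algebra K G)" "g \<in> carrier (free_algebra K G)"
    then show "f \<otimes>\<^bsub>free_algebra K G\<^esub> g \<in> carrier (free_algebra K G)"
      using free_closed[of f G g K] by simp
  next
    show "\<one>\<^bsub>free_algebra K G\<^esub> \<in> carrier (free_algebra K G)" by (simp add: word_def)
  qed (auto simp: free_assoc free_one)
qed (auto simp: free_distrib_left free_distrib_right)

lemma free_smult_single [simp]:
  "k \<odot>\<^bsub>free_algebra K G\<^esub> Poly_Mapping.single w a = Poly_Mapping.single w (k * a)"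
  by (simp add: free_algebra_def)

lemma lookup_free_smult [simp]:
  "Poly_Mapping.lookup (k \<odot>\<^bsub>free_algebra K G\<^esub> f) w = k * Poly_Mapping.lookup f w"
  by (simp add: free_algebra_def map.rep_eq when_def)

lemma free_smult_0 [simp]: "k \<odot>\<^bsub>free_algebra K G\<^esub> 0 = 0"
  by (rule poly_mapping_eqI) simp

lemma free_smult_add: "k \<odot>\<^bsub>free_algebra K G\<^esub> (f + g) = (k \<odot>\<^bsub>free_algebra K G\<^esub> f) + (k \<odot>\<^bsub>free_algebra K G\<^esub> g)"
  by (rule poly_mapping_eqI) (simp add: lookup_add distrib_left)

text \<open>Scalars act as multiples of the empty word, so every two-sided ideal of the ring is
  closed under scalar multiplication; see \<open>ideal_smult\<close>.\<close>

lemma free_smult_eq: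
  "k \<odot>\<^bsub>free_algebra K G\<^esub> f = Poly_Mapping.single [] k \<otimes>\<^bsub>free_algebra K G\<^esub> f"
proof -
  have "Poly_Mapping.keys f \<subseteq> UNIV" by simp
  then show ?thesis
    by (induction f rule: poly_mapping_induct_keys) (auto simp: free_distrib_left free_smult_add)
qed

lemma free_smult_closed:
  "f \<in> carrier (free_algebra K G) \<Longrightarrow> k \<odot>\<^bsub>free_algebra K G\<^esub> f \<in> carrier (free_algebra K G)"
  by (auto simp: in_keys_iff subset_iff)

section \<open>Congruence of words modulo an ideal\<close>

locale free_algebra_ideal =
  fixes K :: "'k::field itself" and G :: "'g set" and I
  assumes ideal: "ideal I (free_algebra K G)"
begin

sublocale I: ideal I "free_algebra K G" by (rule ideal)

lemma ideal_0: "0 \<in> I"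
  using additive_subgroup.zero_closed[OF I.is_additive_subgroup] by simp

lemma ideal_add: "f \<in> I \<Longrightarrow> g \<in> I \<Longrightarrow> f + g \<in> I"
  using additive_subgroup.a_closed[OF I.is_additive_subgroup, of f g] by simp

lemma ideal_sum: "(\<And>i. i \<in> J \<Longrightarrow> f i \<in> I) \<Longrightarrow> (\<Sum>i\<in>J. f i) \<in> I"
  by (induction J rule: infinite_finite_induct) (auto simp: ideal_0 ideal_add)

lemma ideal_smult: "f \<in> I \<Longrightarrow> k \<odot>\<^bsub>free_algebra K G\<^esub> f \<in> I"
  unfolding free_smult_eq by (rule I.I_l_closed) auto

lemma ideal_uminus: "f \<in> I \<Longrightarrow> - f \<in> I"
proof -
  assume "f \<in> I"
  then have "(- 1) \<odot>\<^bsub>free_algebra K G\<^esub> f \<in> I" by (rule ideal_smult)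
  moreover have "(- 1) \<odot>\<^bsub>free_algebra K G\<^esub> f = - f" by (rule poly_mapping_eqI) simp
  ultimately show ?thesis by simp
qed

definition cong :: "'g list \<Rightarrow> 'g list \<Rightarrow> bool" (infix "\<approx>" 50) where
  "u \<approx> v \<longleftrightarrow> word u - word v \<in> I"

lemma cong_refl [simp]: "u \<approx> u"
  by (simp add: cong_def ideal_0)

lemma cong_sym: "u \<approx> v \<Longrightarrow> v \<approx> u"
  unfolding cong_def using ideal_uminus by fastforce

lemma cong_trans [trans]: "u \<approx> v \<Longrightarrow> v \<approx> w \<Longrightarrow> u \<approx> w"
  unfolding cong_def using ideal_add[of "word u - word v" "word v - word w"] by simp

lemma cong_append:
  assumes "u \<approx> v" "a \<in> lists G" "b \<in> lists G"
  shows "a @ u @ b \<approx> a @ v @ b"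
proof -
  have minus: "f - g = f + (- 1) \<odot>\<^bsub>free_algebra K G\<^esub> g" for f g :: "'g list \<Rightarrow>\<^sub>0 'k"
    by (rule poly_mapping_eqI) (simp add: lookup_add lookup_minus)
  have "word a \<otimes>\<^bsub>free_algebra K G\<^esub> (word u - word v) \<otimes>\<^bsub>free_algebra K G\<^esub> word b \<in> I"
    using assms unfolding cong_def word_def by (intro I.I_r_closed I.I_l_closed) auto
  then show ?thesis
    unfolding cong_def minus by (simp add: free_distrib_left free_distrib_right word_def)
qed

lemma cong_Cons: "u \<approx> v \<Longrightarrow> g \<in> G \<Longrightarrow> g # u \<approx> g # v"
  using cong_append[of u v "[g]" "[]"] by simp

lemma cong_appendI: "u \<approx> v \<Longrightarrow> b \<in> lists G \<Longrightarrow> u @ b \<approx> v @ b"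
  using cong_append[of u v "[]" b] by simp

lemma cong_move:
  assumes "\<And>h. h \<in> set u \<Longrightarrow> [g, h] \<approx> [h, g]" "g \<in> G" "u \<in> lists G"
  shows "g # u \<approx> u @ [g]"
  using assms
proof (induction u)
  case (Cons h u)
  have "g # h # u \<approx> h # g # u"
    using cong_appendI[of "[g, h]" "[h, g]" u] Cons.prems by simp
  also have "h # g # u \<approx> h # u @ [g]"
    using Cons by (intro cong_Cons) auto
  finally show ?case by simp
qed simp

text \<open>Sorting by induction: the tail of \<open>u\<close> is congruent to \<open>v\<close> with
  one occurrence of \<open>g\<close> deleted, and \<open>g\<close> is then moved to the place of
  that occurrence. Commutation is asked only within \<open>H\<close>, since the rule is applied to
  the x's and to the y's separately.\<close>

lemma cong_mset:
  assumes "\<And>g h. g \<in> H \<Longrightarrow> h \<in> H \<Longrightarrow> [g, h] \<approx> [h, g]" "H \<subseteq> G"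
    and "u \<in> lists H" "mset u = mset v"
  shows "u \<approx> v"
  using assms(3,4)
proof (induction u arbitrary: v rule: list.induct)
  case (Cons g u)
  have vH: "v \<in> lists H" using Cons.prems mset_eq_setD[OF Cons.prems(2)] by auto
  have "g \<in> set v" using mset_eq_setD[OF Cons.prems(2)] by auto
  then obtain a b where v: "v = a @ g # b" by (meson split_list)
  have ab: "a \<in> lists G" "b \<in> lists G" using vH assms(2) by (auto simp: v)
  have "g # u \<approx> g # (a @ b)"
    using Cons assms(2) v by (intro cong_Cons Cons.IH) auto
  also have "g # (a @ b) \<approx> a @ g # b"
    using cong_appendI[OF cong_move[of a g], of b] assms(1,2) Cons.prems vH v ab by auto
  finally show ?case by (simp add: v)
qed simp

text \<open>Replace each word by a chosen representative of its class. Every replacement changes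
  \<open>f\<close> by an element of the ideal, and afterwards the representative of a class carries
  the sum of the coefficients in that class, which is zero.\<close>

lemma in_ideal_if_class_sums_0:
  assumes cong: "\<And>u v. u \<in> Poly_Mapping.keys f \<Longrightarrow> v \<in> Poly_Mapping.keys f \<Longrightarrow> N u = N v \<Longrightarrow> u \<approx> v"
    and sums: "\<And>x. x \<in> N ` Poly_Mapping.keys f \<Longrightarrow>
      (\<Sum>w | w \<in> Poly_Mapping.keys f \<and> N w = x. Poly_Mapping.lookup f w) = 0"
  shows "f \<in> I"
proof -
  let ?W = "Poly_Mapping.keys f"
  define rep where "rep = inv_into ?W N"
  have rep: "w \<approx> rep (N w)" if "w \<in> ?W" for w
    using that unfolding rep_def by (intro cong) (auto intro: inv_into_into simp: f_inv_into_f)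
  have "(\<Sum>w\<in>?W. Poly_Mapping.lookup f w \<odot>\<^bsub>free_algebra K G\<^esub> (word w - word (rep (N w)))) \<in> I"
    using rep by (intro ideal_sum ideal_smult) (auto simp: cong_def)
  moreover have "Poly_Mapping.lookup f w \<odot>\<^bsub>free_algebra K G\<^esub> (word w - word (rep (N w)))
      = Poly_Mapping.single w (Poly_Mapping.lookup f w) - Poly_Mapping.single (rep (N w)) (Poly_Mapping.lookup f w)" for w
    by (rule poly_mapping_eqI) (simp add: word_def lookup_minus lookup_single when_def)
  moreover have "(\<Sum>w\<in>?W. Poly_Mapping.single (rep (N w)) (Poly_Mapping.lookup f w)) = 0"
  proof -
    have "(\<Sum>w\<in>?W. Poly_Mapping.single (rep (N w)) (Poly_Mapping.lookup f w)) =
      (\<Sum>x\<in>N ` ?W. \<Sum>w | w \<in> ?W \<and> N w = x. Poly_Mapping.single (rep (N w)) (Poly_Mapping.lookup f w))"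
      by (rule sum.image_gen) simp
    also have "\<dots> = (\<Sum>x\<in>N ` ?W. Poly_Mapping.single (rep x) (\<Sum>w | w \<in> ?W \<and> N w = x. Poly_Mapping.lookup f w))"
    proof (rule sum.cong[OF refl])
      fix x
      show "(\<Sum>w | w \<in> ?W \<and> N w = x. Poly_Mapping.single (rep (N w)) (Poly_Mapping.lookup f w)) =
        Poly_Mapping.single (rep x) (\<Sum>w | w \<in> ?W \<and> N w = x. Poly_Mapping.lookup f w)"
        by (subst additive_sum[of "Poly_Mapping.single (rep x)"]) (auto simp: single_add)
    qed
    also have "\<dots> = 0" by (rule sum.neutral) (auto simp: sums)
    finally show ?thesis .
  qed
  ultimately show ?thesis
    using poly_mapping_sum_single[of f] by (simp add: sum_subtractf)
qed

end


section \<open>The algebra of one-sided inverses acts faithfully on polynomials\<close>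

definition exponent :: "nat list \<Rightarrow> (nat \<Rightarrow>\<^sub>0 nat)" where
  "exponent a = (\<Sum>i\<leftarrow>a. Poly_Mapping.single i 1)"

lemma lookup_exponent: "Poly_Mapping.lookup (exponent a) i = count (mset a) i"
  by (induction a) (auto simp: exponent_def lookup_add lookup_single when_def)

lemma exponent_eq_imp_mset_eq: "exponent a = exponent b \<Longrightarrow> mset a = mset b"
  by (rule multiset_eqI) (simp flip: lookup_exponent)

lemma keys_exponent: "Poly_Mapping.keys (exponent a) = set a"
  by (auto simp: in_keys_iff lookup_exponent)

abbreviation monomial :: "(nat \<Rightarrow>\<^sub>0 nat) \<Rightarrow> 'k::field mpol" where
  "monomial m \<equiv> Poly_Mapping.single m 1"

text \<open>A nonzero contraction requires \<open>b = c + g\<close> for some \<open>g\<close>, which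
  would give \<open>c \<le> b\<close>.\<close>

lemma contract_monomial_eq_0:
  assumes "b < c"
  shows "contract (monomial c) (monomial b) = 0"
proof (rule poly_mapping_eqI)
  fix g
  have "b \<noteq> c + g" using assms add_nonneg_exponent[of c g] by auto
  then show "Poly_Mapping.lookup (contract (monomial c) (monomial b)) g = Poly_Mapping.lookup 0 g"
    by (simp add: lookup_single when_def)
qed

lemma contract_monomial_self: "contract (monomial b) (monomial b) = 1"
proof (rule poly_mapping_eqI)
  fix g
  have "b = b + g \<longleftrightarrow> g = 0" by simp
  then show "Poly_Mapping.lookup (contract (monomial b) (monomial b)) g = Poly_Mapping.lookup 1 g"
    by (auto simp: lookup_single lookup_one when_def)
qed

text \<open>The least \<open>\<beta>\<close> occurring in a relation is isolated by applying the relation to the divided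
  power with exponent \<open>\<beta>\<close>.\<close>

lemma monomial_operators_independent:
  fixes c :: "_ \<Rightarrow> 'k::field"
  assumes P: "finite P" and keys: "\<And>a b. (a, b) \<in> P \<Longrightarrow> Poly_Mapping.keys b \<subseteq> {..<n}"
    and zero: "\<And>f. f \<in> polys n \<Longrightarrow>
      (\<Sum>(a, b)\<in>P. const_pol (c (a, b)) * (monomial a * contract (monomial b) f)) = 0"
    and x: "x \<in> P"
  shows "c x = 0"
proof (rule ccontr)
  assume "c x \<noteq> 0"
  define B where "B = snd ` {x \<in> P. c x \<noteq> 0}"
  have B: "finite B" using P by (simp add: B_def)
  have "snd x \<in> B" using x \<open>c x \<noteq> 0\<close> by (auto simp: B_def)
  define b0 where "b0 = Min B"
  have min: "b0 \<le> b" if "(a, b) \<in> P" "c (a, b) \<noteq> 0" for a b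
    using that B unfolding b0_def by (intro Min_le) (force simp: B_def)+
  have "b0 \<in> B" unfolding b0_def using B \<open>snd x \<in> B\<close> by (intro Min_in) auto
  then obtain a0 where a0: "(a0, b0) \<in> P" "c (a0, b0) \<noteq> 0" by (auto simp: B_def)
  \<comment> \<open>A summand with nonzero coefficient has \<open>b0 \<le> b\<close>. If
    \<open>b0 < b\<close>, the contraction kills the test monomial; if \<open>b = b0\<close>, it
    yields 1.\<close>
  have summand: "const_pol (c (a, b)) * (monomial a * contract (monomial b) (monomial b0)) =
      (if b = b0 then Poly_Mapping.single a (c (a, b)) else 0)" if "(a, b) \<in> P" for a b
  proof (cases "c (a, b) = 0")
    case True
    then show ?thesis by (auto simp: const_pol_def)
  next
    case False
    then have "b0 \<le> b" using min that by blast
    then consider "b = b0" | "b0 < b" by fastforce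
    then show ?thesis
    proof cases
      case 1
      then show ?thesis by (simp add: contract_monomial_self const_pol_def mult_single)
    next
      case 2
      then show ?thesis by (auto simp: contract_monomial_eq_0)
    qed
  qed
  have "0 = (\<Sum>(a, b)\<in>P. const_pol (c (a, b)) * (monomial a * contract (monomial b) (monomial b0)))"
    using zero[of "monomial b0"] keys[OF a0(1)] by (simp add: polys_single)
  also have "\<dots> = (\<Sum>(a, b)\<in>P. if b = b0 then Poly_Mapping.single a (c (a, b)) else 0)"
    by (rule sum.cong) (use summand in auto)
  \<comment> \<open>The surviving summands are distinct monomials, so the coefficient at
    \<open>a0\<close> singles out one of them.\<close>
  finally have "0 = Poly_Mapping.lookup (\<Sum>(a, b)\<in>P. if b = b0 then Poly_Mapping.single a (c (a, b)) else 0) a0"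
    by (metis lookup_zero)
  also have "\<dots> = (\<Sum>x\<in>P. if x = (a0, b0) then c (a0, b0) else 0)"
    unfolding lookup_sum by (rule sum.cong) (auto simp: lookup_single when_def split: if_splits)
  also have "\<dots> = c (a0, b0)" using P a0 by simp
  finally show False using a0 by simp
qed

section \<open>Words and free algebra elements as operators\<close>

fun letter_op :: "nat \<Rightarrow> Sn_gen \<Rightarrow> 'k::field_char_0 mpol \<Rightarrow> 'k mpol" where
  "letter_op n (Gen_x i) = operator (*) n (var i)"
| "letter_op n (Gen_y i) = operator contract n (var i)"

fun word_op :: "nat \<Rightarrow> Sn_gen list \<Rightarrow> 'k::field_char_0 mpol \<Rightarrow> 'k mpol" where
  "word_op n [] = (\<lambda>p\<in>polys n. p)"
| "word_op n (g # w) = compose (polys n) (letter_op n g) (word_op n w)"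

definition free_op :: "nat \<Rightarrow> (Sn_gen list \<Rightarrow>\<^sub>0 'k::field_char_0) \<Rightarrow> 'k mpol \<Rightarrow> 'k mpol" where
  "free_op n f = (\<lambda>p\<in>polys n. \<Sum>w\<in>Poly_Mapping.keys f. const_pol (Poly_Mapping.lookup f w) * word_op n w p)"

abbreviation Sn_gens :: "nat \<Rightarrow> Sn_gen set" where
  "Sn_gens n \<equiv> Gen_x ` {..<n} \<union> Gen_y ` {..<n}"

context
  fixes K :: "'k::field_char_0 itself" and n :: nat
begin

private abbreviation "E \<equiv> End_polys K n"
private abbreviation "F \<equiv> Sn_free K n"

interpretation E: ring E by (rule ring_End)
interpretation F: ring F unfolding Sn_free_def by (rule ring_free)
interpretation dx: polynomial_action contract n by (rule polynomial_action_contract)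
interpretation mx: polynomial_action "(*)" n by (rule polynomial_action_times)

lemma letter_op_closed: "g \<in> Sn_gens n \<Longrightarrow> letter_op n g \<in> carrier E"
  by (auto intro!: dx.operator_closed mx.operator_closed)

lemma word_op_Nil: "word_op n [] = \<one>\<^bsub>E\<^esub>"
  by simp

lemma word_op_Cons: "word_op n (g # w) = letter_op n g \<otimes>\<^bsub>E\<^esub> word_op n w"
  by simp

lemma word_op_closed: "w \<in> lists (Sn_gens n) \<Longrightarrow> word_op n w \<in> carrier E"
proof (induction w rule: list.induct)
  case Nil
  show ?case unfolding word_op_Nil by (rule E.one_closed)
next
  case (Cons g w)
  then show ?case unfolding word_op_Cons by (intro E.m_closed letter_op_closed) auto
qed

lemma word_op_append:
  assumes "u \<in> lists (Sn_gens n)" "v \<in> lists (Sn_gens n)"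
  shows "word_op n (u @ v) = word_op n u \<otimes>\<^bsub>E\<^esub> word_op n v"
  using assms(1)
proof (induction u rule: list.induct)
  case Nil
  show ?case
    unfolding append_Nil word_op_Nil by (rule E.l_one[symmetric, OF word_op_closed[OF assms(2)]])
next
  case (Cons g u)
  then have "g \<in> Sn_gens n" "u \<in> lists (Sn_gens n)" by auto
  then show ?case
    unfolding append_Cons word_op_Cons Cons.IH[OF \<open>u \<in> _\<close>]
    using E.m_assoc letter_op_closed word_op_closed assms(2) by metis
qed

lemma free_op_superset:
  assumes "finite A" "Poly_Mapping.keys f \<subseteq> A" "p \<in> polys n"
  shows "free_op n f p = (\<Sum>w\<in>A. const_pol (Poly_Mapping.lookup f w) * word_op n w p)"
  using assms unfolding free_op_def
  by (simp, intro sum.mono_neutral_left) (auto simp: in_keys_iff const_pol_def)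

lemma free_op_extensional: "free_op n f \<in> extensional (polys n)"
  by (simp add: free_op_def)

lemma free_op_0: "free_op n 0 = \<zero>\<^bsub>E\<^esub>"
  by (auto simp: free_op_def)

lemma free_op_single: "free_op n (Poly_Mapping.single w k) = k \<odot>\<^bsub>E\<^esub> word_op n w"
  by (rule End_eqI[OF free_op_extensional]) (auto simp: free_op_superset[of "{w}"])

lemma free_op_add: "free_op n (f + g) = free_op n f \<oplus>\<^bsub>E\<^esub> free_op n g"
proof (rule End_eqI[OF free_op_extensional])
  fix p :: "'k mpol" assume p: "p \<in> polys n"
  let ?A = "Poly_Mapping.keys f \<union> Poly_Mapping.keys g"
  have const: "const_pol (a + b) = const_pol a + (const_pol b :: 'k mpol)" for a b
    by (simp add: const_pol_def single_add)
  show "free_op n (f + g) p = (free_op n f \<oplus>\<^bsub>E\<^esub> free_op n g) p"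
    using p keys_add[of f g]
    by (simp add: free_op_superset[of ?A] lookup_add const distrib_right sum.distrib)
qed simp

lemma F_simps: "carrier F = {f. Poly_Mapping.keys f \<subseteq> lists (Sn_gens n)}"
  "\<one>\<^bsub>F\<^esub> = word []" "\<zero>\<^bsub>F\<^esub> = 0" "f \<oplus>\<^bsub>F\<^esub> g = f + g"
  by (simp_all add: Sn_free_def)

lemma free_op_closed:
  assumes "f \<in> carrier F"
  shows "free_op n f \<in> carrier E"
proof -
  have "Poly_Mapping.keys f \<subseteq> lists (Sn_gens n)" using assms by (simp add: F_simps)
  then show ?thesis
  proof (induction f rule: poly_mapping_induct_keys)
    case zero
    show ?case unfolding free_op_0 by (rule E.zero_closed)
  next
    case (single w k)
    then show ?case unfolding free_op_single by (intro End_smult_closed word_op_closed)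
  next
    case (add f g)
    then show ?case unfolding free_op_add by (intro E.a_closed)
  qed
qed

lemma free_op_mult:
  assumes "f \<in> carrier F" "g \<in> carrier F"
  shows "free_op n (f \<otimes>\<^bsub>F\<^esub> g) = free_op n f \<otimes>\<^bsub>E\<^esub> free_op n g"
proof -
  have f: "Poly_Mapping.keys f \<subseteq> lists (Sn_gens n)" and g: "Poly_Mapping.keys g \<subseteq> lists (Sn_gens n)"
    using assms by (auto simp: F_simps)
  have closed: "free_op n f \<in> carrier E" if "Poly_Mapping.keys f \<subseteq> lists (Sn_gens n)" for f :: "Sn_gen list \<Rightarrow>\<^sub>0 'k"
    using that free_op_closed by (simp add: F_simps)
  show ?thesis
    using f
  proof (induction f rule: poly_mapping_induct_keys)
    case zero
    show ?case
      using E.l_null[OF closed[OF g]] by (simp add: Sn_free_def free_op_0 del: End_simps)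
  next
    case (single u a)
    note u = single
    show ?case
      using g
    proof (induction g rule: poly_mapping_induct_keys)
      case zero
      show ?case
        using E.r_null[of "free_op n (Poly_Mapping.single u a)"] closed[of "Poly_Mapping.single u a"] u
        by (simp add: Sn_free_def free_op_0 del: End_simps)
    next
      case (single v b)
      have "free_op n (Poly_Mapping.single u a \<otimes>\<^bsub>F\<^esub> Poly_Mapping.single v b)
          = (a * b) \<odot>\<^bsub>E\<^esub> (word_op n u \<otimes>\<^bsub>E\<^esub> word_op n v)"
        unfolding Sn_free_def free_mult_single free_op_single word_op_append[OF u single] ..
      also have "\<dots> = a \<odot>\<^bsub>E\<^esub> (b \<odot>\<^bsub>E\<^esub> (word_op n u \<otimes>\<^bsub>E\<^esub> word_op n v))"
        by (auto intro!: End_eqI simp: const_pol_def mult_single simp flip: mult.assoc)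
      also have "\<dots> = free_op n (Poly_Mapping.single u a) \<otimes>\<^bsub>E\<^esub> free_op n (Poly_Mapping.single v b)"
        unfolding free_op_single
        using End_smult_mult End_mult_smult word_op_closed u single End_smult_closed by metis
      finally show ?case .
    next
      case (add g h)
      then show ?case
        unfolding Sn_free_def free_distrib_left free_op_add
        using E.r_distr[OF closed closed closed, of g h "Poly_Mapping.single u a"] u
        by (simp del: End_simps)
    qed
  next
    case (add f h)
    then show ?case
      unfolding Sn_free_def free_distrib_right free_op_add
      using E.l_distr[OF closed closed closed[OF g], of f h] by (simp del: End_simps)
  qed
qed

lemma free_op_word:
  assumes "w \<in> lists (Sn_gens n)"
  shows "free_op n (word w) = (word_op n w :: 'k mpol \<Rightarrow> 'k mpol)"
  by (rule End_eqI[OF free_op_extensional End_carrierD(1)[OF word_op_closed[OF assms]]])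
     (simp add: word_def free_op_single const_pol_def)

lemma free_op_hom: "ring_hom_ring F E (free_op n)"
proof (rule ring_hom_ringI[OF F.ring_axioms E.ring_axioms])
  show "free_op n \<one>\<^bsub>F\<^esub> = \<one>\<^bsub>E\<^esub>" by (simp add: F_simps free_op_word)
qed (auto simp: free_op_closed free_op_mult F_simps(4) free_op_add simp del: End_simps)

interpretation rho: ring_hom_ring F E "free_op n" by (rule free_op_hom)

lemma free_op_smult: "free_op n (k \<odot>\<^bsub>F\<^esub> f) = k \<odot>\<^bsub>E\<^esub> free_op n f"
proof (rule End_eqI[OF free_op_extensional])
  fix p :: "'k mpol" assume p: "p \<in> polys n"
  have const: "const_pol (a * b) = const_pol a * (const_pol b :: 'k mpol)" for a b
    by (simp add: const_pol_def mult_single)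
  have "Poly_Mapping.keys (k \<odot>\<^bsub>F\<^esub> f) \<subseteq> Poly_Mapping.keys f"
    by (auto simp: in_keys_iff Sn_free_def)
  then show "free_op n (k \<odot>\<^bsub>F\<^esub> f) p = (k \<odot>\<^bsub>E\<^esub> free_op n f) p"
    using p by (simp add: free_op_superset[of "Poly_Mapping.keys f"] Sn_free_def const sum_distrib_left mult.assoc)
qed simp

lemma free_op_image: "free_op n ` carrier F = carrier (integro_differential K n)"
proof (rule subset_antisym)
  \<comment> \<open>The generators of the operator algebra are the operators of words of length one,
    so they lie in the image.\<close>
  have G: "gens K n = word_op n ` (\<lambda>g. [g]) ` Sn_gens n"
  proof -
    have "word_op n [g] = (letter_op n g :: 'k mpol \<Rightarrow> 'k mpol)" if "g \<in> Sn_gens n" for g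
      using E.r_one[OF letter_op_closed[OF that]] unfolding word_op_Cons word_op_Nil .
    then have "word_op n ` (\<lambda>g. [g]) ` Sn_gens n = (letter_op n ` Sn_gens n :: ('k mpol \<Rightarrow> 'k mpol) set)"
      unfolding image_image by (rule image_cong[OF refl])
    also have "\<dots> = gens K n"
      unfolding gens_def image_Un image_image letter_op.simps by (auto simp: image_iff)
    finally show ?thesis ..
  qed
  show "carrier (integro_differential K n) \<subseteq> free_op n ` carrier F"
    unfolding integro_differential_eq
  proof (rule carrier_generated_subalgebra_subset)
    show "subring (free_op n ` carrier F) E"
      by (rule rho.img_is_subring[OF F.carrier_is_subring])
    show "k \<odot>\<^bsub>E\<^esub> b \<in> free_op n ` carrier F" if b: "b \<in> free_op n ` carrier F" for k b
    proof -
      obtain f where f: "f \<in> carrier F" "b = free_op n f" using b by (elim imageE)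
      moreover have "k \<odot>\<^bsub>F\<^esub> f \<in> carrier F" using f(1) unfolding Sn_free_def by (rule free_smult_closed)
      ultimately show ?thesis unfolding f(2) by (intro image_eqI[of _ _ "k \<odot>\<^bsub>F\<^esub> f"]) (simp_all only: free_op_smult)
    qed
    show "gens K n \<subseteq> free_op n ` carrier F"
    proof
      fix h assume "h \<in> gens K n"
      then obtain g where g: "g \<in> Sn_gens n" "h = word_op n [g]" unfolding G by blast
      then have "h = free_op n (word [g] :: _ \<Rightarrow>\<^sub>0 'k)" using free_op_word[of "[g]"] by simp
      moreover have "(word [g] :: _ \<Rightarrow>\<^sub>0 'k) \<in> carrier F" using g by (auto simp: F_simps word_def)
      ultimately show "h \<in> free_op n ` carrier F" by (rule image_eqI)
    qed
  qed
  have sub: "subring (carrier (integro_differential K n)) E"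
    unfolding integro_differential_eq
    by (rule subring_generated_subalgebra[OF ring_End gens_subset End_smult_closed])
  have sm: "k \<odot>\<^bsub>E\<^esub> a \<in> carrier (integro_differential K n)" if "a \<in> carrier (integro_differential K n)" for k a
    using that unfolding integro_differential_eq by (rule generated_subalgebra_smult_closed)
  have letter: "letter_op n g \<in> carrier (integro_differential K n)" if "g \<in> Sn_gens n" for g
    unfolding integro_differential_eq using that
    by (intro subsetD[OF generators_subset]) (auto simp: gens_def)
  have wd: "word_op n w \<in> carrier (integro_differential K n)" if "w \<in> lists (Sn_gens n)" for w
    using that
  proof (induction w rule: list.induct)
    case Nil
    show ?case unfolding word_op_Nil by (rule subringE(3)[OF sub])
  next
    case (Cons g w)
    then show ?case unfolding word_op_Cons by (intro subringE(6)[OF sub] letter) auto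
  qed
  show "free_op n ` carrier F \<subseteq> carrier (integro_differential K n)"
  proof clarify
    fix f assume "f \<in> carrier F"
    then have "Poly_Mapping.keys f \<subseteq> lists (Sn_gens n)" by (simp add: F_simps)
    then show "free_op n f \<in> carrier (integro_differential K n)"
    proof (induction f rule: poly_mapping_induct_keys)
      case zero
      show ?case unfolding free_op_0 by (rule subringE(2)[OF sub])
    next
      case (single w k)
      then show ?case unfolding free_op_single by (intro sm wd)
    next
      case (add f g)
      then show ?case unfolding free_op_add by (intro subringE(7)[OF sub])
    qed
  qed
qed

section \<open>Normal forms of words modulo the relators\<close>

lemma word_op_x:
  "set a \<subseteq> {..<n} \<Longrightarrow> word_op n (map Gen_x a) = (operator (*) n (monomial (exponent a)) :: 'k mpol \<Rightarrow> 'k mpol)"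
proof (induction a)
  case Nil
  then show ?case unfolding list.map word_op_Nil by (simp only: exponent_def sum_list.Nil list.map single_one mx.operator_one[of K])
next
  case (Cons i a)
  then have "word_op n (map Gen_x (i # a)) =
      (operator (*) n (var i * monomial (exponent a)) :: 'k mpol \<Rightarrow> 'k mpol)"
    using mx.operator_mult[of "monomial (exponent a)" "var i" K] polys_single[of "exponent a" n "1 :: 'k"]
    by (simp add: keys_exponent)
  then show ?case by (simp add: var_def mult_single exponent_def)
qed

lemma word_op_y:
  "set b \<subseteq> {..<n} \<Longrightarrow> word_op n (map Gen_y b) = (operator contract n (monomial (exponent b)) :: 'k mpol \<Rightarrow> 'k mpol)"
proof (induction b)
  case Nil
  then show ?case unfolding list.map word_op_Nil by (simp only: exponent_def sum_list.Nil list.map single_one dx.operator_one[of K])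
next
  case (Cons i b)
  then have "word_op n (map Gen_y (i # b)) =
      (operator contract n (var i * monomial (exponent b)) :: 'k mpol \<Rightarrow> 'k mpol)"
    using dx.operator_mult[of "monomial (exponent b)" "var i" K] polys_single[of "exponent b" n "1 :: 'k"]
    by (simp add: keys_exponent)
  then show ?case by (simp add: var_def mult_single exponent_def)
qed

lemma map_Gen_in_lists:
  "set c \<subseteq> {..<n} \<Longrightarrow> map Gen_x c \<in> lists (Sn_gens n)"
  "set c \<subseteq> {..<n} \<Longrightarrow> map Gen_y c \<in> lists (Sn_gens n)"
  by (auto simp: subset_iff)

lemma word_op_normal:
  fixes p :: "'k mpol"
  assumes "set a \<subseteq> {..<n}" "set b \<subseteq> {..<n}" "p \<in> polys n"
  shows "word_op n (map Gen_x a @ map Gen_y b) p =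
    undivided (monomial (exponent a) * contract (monomial (exponent b)) (divided p))"
proof -
  have "word_op n (map Gen_x a @ map Gen_y b) = word_op n (map Gen_x a) \<otimes>\<^bsub>E\<^esub> word_op n (map Gen_y b)"
    by (rule word_op_append[OF map_Gen_in_lists(1)[OF assms(1)] map_Gen_in_lists(2)[OF assms(2)]])
  then show ?thesis
    unfolding word_op_x[OF assms(1)] word_op_y[OF assms(2)]
    using assms by (simp add: compose_def operator_def contract_in_polys)
qed

abbreviation "Sn_ideal \<equiv> Idl\<^bsub>F\<^esub> (Sn_relators n)"

lemma word_diff_closed:
  "u \<in> lists (Sn_gens n) \<Longrightarrow> v \<in> lists (Sn_gens n) \<Longrightarrow> word u - word v \<in> carrier F"
  using keys_diff[of "word u :: _ \<Rightarrow>\<^sub>0 'k" "word v"] by (auto simp: F_simps word_def)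

lemma relators_subset: "Sn_relators n \<subseteq> carrier F"
  unfolding Sn_relators_def using word_diff_closed by auto

lemma ideal_Sn_ideal: "ideal Sn_ideal F"
  by (rule F.genideal_ideal[OF relators_subset])

interpretation J: free_algebra_ideal K "Sn_gens n" Sn_ideal
  by (rule free_algebra_ideal.intro) (use ideal_Sn_ideal in \<open>simp add: Sn_free_def\<close>)

lemma relators_subset_Sn_ideal: "Sn_relators n \<subseteq> Sn_ideal"
  by (rule F.genideal_self[OF relators_subset])

lemma cong_relators:
  assumes "i < n" "j < n"
  shows "J.cong [Gen_y i, Gen_x i] []"
    "J.cong [Gen_x i, Gen_x j] [Gen_x j, Gen_x i]"
    "J.cong [Gen_y i, Gen_y j] [Gen_y j, Gen_y i]"
    "i \<noteq> j \<Longrightarrow> J.cong [Gen_y i, Gen_x j] [Gen_x j, Gen_y i]"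
proof -
  show "J.cong [Gen_y i, Gen_x i] []"
    unfolding J.cong_def using assms by (intro subsetD[OF relators_subset_Sn_ideal]) (auto simp: Sn_relators_def)
  \<comment> \<open>The relators cover distinct indices only; for equal indices the two words
    coincide.\<close>
  have "J.cong [Gen_x i, Gen_x j] [Gen_x j, Gen_x i] \<and> J.cong [Gen_y i, Gen_y j] [Gen_y j, Gen_y i]"
  proof (cases "i = j")
    case False
    then show ?thesis
      unfolding J.cong_def using assms by (intro conjI subsetD[OF relators_subset_Sn_ideal]) (auto simp: Sn_relators_def)
  qed simp
  then show "J.cong [Gen_x i, Gen_x j] [Gen_x j, Gen_x i]"
    "J.cong [Gen_y i, Gen_y j] [Gen_y j, Gen_y i]" by auto
  assume "i \<noteq> j"
  then have "J.cong [Gen_x j, Gen_y i] [Gen_y i, Gen_x j]"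
    unfolding J.cong_def using assms by (intro subsetD[OF relators_subset_Sn_ideal]) (auto simp: Sn_relators_def)
  then show "J.cong [Gen_y i, Gen_x j] [Gen_x j, Gen_y i]" by (rule J.cong_sym)
qed

text \<open>Prepend a letter to a word already in normal form. An x joins the front. A y_i moves
  right through the x's: it cancels against the first x_i if there is one, and otherwise reaches the
  block of y's.\<close>

lemma normal_form_exists:
  assumes "w \<in> lists (Sn_gens n)"
  shows "\<exists>a b. set a \<subseteq> {..<n} \<and> set b \<subseteq> {..<n} \<and> J.cong w (map Gen_x a @ map Gen_y b)"
  using assms
proof (induction w rule: list.induct)
  case Nil
  show ?case by (intro exI[of _ "[]"]) simp
next
  case (Cons g w)
  then obtain a b where ab: "set a \<subseteq> {..<n}" "set b \<subseteq> {..<n}"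
    "J.cong w (map Gen_x a @ map Gen_y b)" by auto
  have g: "g \<in> Sn_gens n" using Cons by simp
  have lists: "map Gen_x c @ map Gen_y d \<in> lists (Sn_gens n)" if "set c \<subseteq> {..<n}" "set d \<subseteq> {..<n}" for c d
    using that by (simp add: map_Gen_in_lists)
  have gw: "J.cong (g # w) (g # map Gen_x a @ map Gen_y b)"
    by (rule J.cong_Cons[OF ab(3) g])
  have move: "J.cong (Gen_y i # map Gen_x c @ u) (map Gen_x c @ Gen_y i # u)"
    if "i < n" "i \<notin> set c" "set c \<subseteq> {..<n}" "u \<in> lists (Sn_gens n)" for i c u
  proof -
    have "J.cong (Gen_y i # map Gen_x c) (map Gen_x c @ [Gen_y i])"
      using that map_Gen_in_lists(1)[OF that(3)]
      by (intro J.cong_move) (auto intro!: cong_relators(4) simp: subset_iff simp del: in_lists_conv_set)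
    from J.cong_appendI[OF this that(4)] show ?thesis by simp
  qed
  consider i where "i < n" "g = Gen_x i" | i where "i < n" "g = Gen_y i" "i \<notin> set a"
    | i where "i < n" "g = Gen_y i" "i \<in> set a" using g by auto
  then show ?case
  proof cases
    case 1
    then show ?thesis using ab gw by (intro exI[of _ "i # a"] exI[of _ b]) auto
  next
    case 2
    have "J.cong (g # w) (map Gen_x a @ map Gen_y (i # b))"
      using J.cong_trans[OF gw] move[of i a "map Gen_y b"] 2 ab lists[of "[]" b] by simp
    then show ?thesis using ab 2 by (intro exI[of _ a] exI[of _ "i # b"]) auto
  next
    case 3
    \<comment> \<open>The first occurrence is taken so that y_i commutes with all letters of
      \<open>c\<close>.\<close>
    obtain c d where a: "a = c @ i # d" "i \<notin> set c" using split_list_first[OF 3(3)] by blast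
    have cd: "set c \<subseteq> {..<n}" "set d \<subseteq> {..<n}" using ab a by auto
    let ?u = "map Gen_x d @ map Gen_y b"
    note gw
    also have "J.cong (g # map Gen_x a @ map Gen_y b) (map Gen_x c @ [Gen_y i, Gen_x i] @ ?u)"
      using move[of i c "Gen_x i # ?u"] 3 cd a lists[OF cd(2) ab(2)] by simp
    also have "J.cong (map Gen_x c @ [Gen_y i, Gen_x i] @ ?u) (map Gen_x c @ [] @ ?u)"
      by (intro J.cong_append cong_relators(1)[OF 3(1) 3(1)] map_Gen_in_lists lists cd ab)
    finally have "J.cong (g # w) (map Gen_x (c @ d) @ map Gen_y b)" by simp
    then show ?thesis using ab cd by (intro exI[of _ "c @ d"] exI[of _ b]) auto
  qed
qed

section \<open>The kernel of the action is the ideal of relations\<close>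

lemma Sn_ideal_subset_kernel: "Sn_ideal \<subseteq> a_kernel F E (free_op n)"
proof (rule F.genideal_minimal[OF rho.kernel_is_ideal])
  let ?w = "word_op n :: Sn_gen list \<Rightarrow> 'k mpol \<Rightarrow> 'k mpol"
  have "word u - word v \<in> a_kernel F E (free_op n)"
    if that: "u \<in> lists (Sn_gens n)" "v \<in> lists (Sn_gens n)" "?w u = ?w v" for u v
  proof -
    let ?d = "word u - word v :: _ \<Rightarrow>\<^sub>0 'k"
    have d: "?d \<in> carrier F" by (rule word_diff_closed[OF that(1,2)])
    have v: "free_op n (word v :: _ \<Rightarrow>\<^sub>0 'k) \<in> carrier E"
      unfolding free_op_word[OF that(2)] by (rule word_op_closed[OF that(2)])
    \<comment> \<open>Additivity of \<open>free_op\<close> is applied to \<open>?d + word v\<close>;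
      cancelling the common summand shows that the difference acts as zero.\<close>
    have "free_op n (word v) = free_op n (?d + word v)"
      using free_op_word[OF that(1)] free_op_word[OF that(2)] that(3) by simp
    then have "free_op n (word v) = free_op n ?d \<oplus>\<^bsub>E\<^esub> free_op n (word v)"
      unfolding free_op_add .
    then have "free_op n ?d = \<zero>\<^bsub>E\<^esub>"
      using E.add.r_cancel_one'[OF v free_op_closed[OF d]] by (simp only:)
    then show ?thesis using d by (simp only: a_kernel_def' mem_Collect_eq)
  qed
  note ker = this
  have xx: "?w [Gen_x i, Gen_x j] = ?w [Gen_x j, Gen_x i]" if "i < n" "j < n" for i j
    using word_op_x[of "[i, j]"] word_op_x[of "[j, i]"] that
    by (simp add: exponent_def add.commute del: word_op.simps)
  have yy: "?w [Gen_y i, Gen_y j] = ?w [Gen_y j, Gen_y i]" if "i < n" "j < n" for i j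
    using word_op_y[of "[i, j]"] word_op_y[of "[j, i]"] that
    by (simp add: exponent_def add.commute del: word_op.simps)
  have pair: "?w [g, h] = letter_op n g \<otimes>\<^bsub>E\<^esub> letter_op n h" if "h \<in> Sn_gens n" for g h
    unfolding word_op_Cons word_op_Nil E.r_one[OF letter_op_closed[OF that]] ..
  have yx: "?w [Gen_y i, Gen_x i] = ?w []" if "i < n" for i
    using that pair[of "Gen_x i" "Gen_y i"] partial_integration[OF that, of K]
    unfolding word_op_Nil by (simp del: word_op.simps End_simps)
  have xy: "?w [Gen_x i, Gen_y j] = ?w [Gen_y j, Gen_x i]" if "i < n" "j < n" "i \<noteq> j" for i j
  proof -
    have "operator (*) n (var i) \<otimes>\<^bsub>E\<^esub> operator contract n (var j)
        = operator contract n (var j) \<otimes>\<^bsub>E\<^esub> operator (*) n (var i)"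
      using that by (auto intro!: End_eqI simp: operator_def compose_def contract_in_polys contract_var_var_mult)
    then show ?thesis
      using that pair[of "Gen_x i" "Gen_y j"] pair[of "Gen_y j" "Gen_x i"] by (simp del: word_op.simps End_simps)
  qed
  show "Sn_relators n \<subseteq> a_kernel F E (free_op n)"
    unfolding Sn_relators_def
    by (intro Un_least subsetI; elim CollectE exE conjE; hypsubst)
       (intro ker; simp add: yx xy xx yy del: word_op.simps)+
qed

lemma cong_imp_word_op_eq:
  assumes "J.cong u v" "u \<in> lists (Sn_gens n)" "v \<in> lists (Sn_gens n)"
  shows "word_op n u = (word_op n v :: 'k mpol \<Rightarrow> 'k mpol)"
proof -
  let ?d = "word u - word v :: Sn_gen list \<Rightarrow>\<^sub>0 'k"
  have "?d \<in> a_kernel F E (free_op n)"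
    using assms(1) Sn_ideal_subset_kernel unfolding J.cong_def by (rule subsetD[rotated])
  then have "free_op n ?d = \<zero>\<^bsub>E\<^esub>" by (rule rho.kernel_zero)
  then have "free_op n (?d + word v) = free_op n (word v)"
    using E.l_zero[OF word_op_closed[OF assms(3)]]
    unfolding free_op_add free_op_word[OF assms(3)] by simp
  then show ?thesis
    unfolding free_op_word[OF assms(3)] using free_op_word[OF assms(2)] by simp
qed

text \<open>Choose a normal form for each word of \<open>f\<close> and group the words by its pair
  of exponents \<open>N w\<close>. Since \<open>f\<close> acts as zero, independence of the monomial
  operators makes the coefficients of each group sum to zero. Words in one group are congruent,
  because their normal forms differ only in the order of the x's and of the y's.\<close>

lemma kernel_subset_Sn_ideal: "a_kernel F E (free_op n) \<subseteq> Sn_ideal"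
proof
  fix f assume "f \<in> a_kernel F E (free_op n)"
  then have f: "f \<in> carrier F" "free_op n f = \<zero>\<^bsub>E\<^esub>"
    by (simp_all only: a_kernel_def' mem_Collect_eq)
  let ?W = "Poly_Mapping.keys f"
  have W: "?W \<subseteq> lists (Sn_gens n)" using f by (simp add: F_simps)
  have "\<exists>a. \<forall>w\<in>?W. \<exists>b. set (a w) \<subseteq> {..<n} \<and> set b \<subseteq> {..<n} \<and> J.cong w (map Gen_x (a w) @ map Gen_y b)"
    by (intro bchoice ballI normal_form_exists subsetD[OF W])
  then obtain a where "\<forall>w\<in>?W. \<exists>b. set (a w) \<subseteq> {..<n} \<and> set b \<subseteq> {..<n} \<and>
      J.cong w (map Gen_x (a w) @ map Gen_y b)" by (rule exE)
  from bchoice[OF this] obtain b where b: "\<forall>w\<in>?W. set (a w) \<subseteq> {..<n} \<and> set (b w) \<subseteq> {..<n} \<and>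
      J.cong w (map Gen_x (a w) @ map Gen_y (b w))" by (rule exE)
  have ab: "set (a w) \<subseteq> {..<n}" "set (b w) \<subseteq> {..<n}" "J.cong w (map Gen_x (a w) @ map Gen_y (b w))"
    if "w \<in> ?W" for w using bspec[OF b that] by simp_all
  have lists_ab: "map Gen_x (a w) \<in> lists (Sn_gens n)" "map Gen_y (b w) \<in> lists (Sn_gens n)"
    if "w \<in> ?W" for w using ab(1,2)[OF that] by (simp_all add: map_Gen_in_lists)
  define N where "N w = (exponent (a w), exponent (b w))" for w
  show "f \<in> Sn_ideal"
  proof (rule J.in_ideal_if_class_sums_0)
    fix u v assume uv: "u \<in> ?W" "v \<in> ?W" "N u = N v"
    then have "mset (a u) = mset (a v)" "mset (b u) = mset (b v)"
      by (auto simp: N_def intro: exponent_eq_imp_mset_eq)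
    then have m: "mset (map Gen_x (a u)) = mset (map Gen_x (a v))"
      "mset (map Gen_y (b u)) = mset (map Gen_y (b v))" by (simp_all only: mset_map)
    have x: "J.cong (map Gen_x (a u)) (map Gen_x (a v))"
    proof (rule J.cong_mset[OF _ _ _ m(1)])
      show "map Gen_x (a u) \<in> lists (Gen_x ` {..<n})" using ab(1)[OF uv(1)] by (auto simp: subset_iff)
    qed (auto intro: cong_relators)
    have y: "J.cong (map Gen_y (b u)) (map Gen_y (b v))"
    proof (rule J.cong_mset[OF _ _ _ m(2)])
      show "map Gen_y (b u) \<in> lists (Gen_y ` {..<n})" using ab(2)[OF uv(1)] by (auto simp: subset_iff)
    qed (auto intro: cong_relators)
    have "J.cong u (map Gen_x (a u) @ map Gen_y (b u))" by (rule ab(3)[OF uv(1)])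
    also have "J.cong (map Gen_x (a u) @ map Gen_y (b u)) (map Gen_x (a v) @ map Gen_y (b u))"
      by (rule J.cong_appendI[OF x lists_ab(2)[OF uv(1)]])
    also have "J.cong (map Gen_x (a v) @ map Gen_y (b u)) (map Gen_x (a v) @ map Gen_y (b v))"
      using J.cong_append[OF y, of "map Gen_x (a v)" "[]"] lists_ab(1)[OF uv(2)] by simp
    also have "J.cong (map Gen_x (a v) @ map Gen_y (b v)) v" by (rule J.cong_sym[OF ab(3)[OF uv(2)]])
    finally show "J.cong u v" .
  next
    define c where "c x = (\<Sum>w | w \<in> ?W \<and> N w = x. Poly_Mapping.lookup f w)" for x
    have "c x = 0" if x: "x \<in> N ` ?W" for x
    proof (rule monomial_operators_independent[OF _ _ _ x])
      show "finite (N ` ?W)" by simp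
      show "Poly_Mapping.keys \<beta> \<subseteq> {..<n}" if "(\<alpha>, \<beta>) \<in> N ` ?W" for \<alpha> \<beta>
        using that ab(2) unfolding N_def by (elim imageE) (simp add: keys_exponent)
      fix p :: "'k mpol" assume p: "p \<in> polys n"
      let ?T = "\<lambda>x. monomial (fst x) * contract (monomial (snd x)) p"
      have c: "const_pol (c x) = (\<Sum>w | w \<in> ?W \<and> N w = x. const_pol (Poly_Mapping.lookup f w))" for x
        unfolding c_def by (rule additive_sum) (auto simp: const_pol_def single_add)
      have "(\<Sum>(\<alpha>, \<beta>)\<in>N ` ?W. const_pol (c (\<alpha>, \<beta>)) * (monomial \<alpha> * contract (monomial \<beta>) p))
          = (\<Sum>x\<in>N ` ?W. \<Sum>w | w \<in> ?W \<and> N w = x. const_pol (Poly_Mapping.lookup f w) * ?T (N w))"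
        by (auto simp: case_prod_beta c sum_distrib_right intro!: sum.cong)
      also have "\<dots> = (\<Sum>w\<in>?W. const_pol (Poly_Mapping.lookup f w) * ?T (N w))"
        by (rule sum.image_gen[symmetric]) simp
      \<comment> \<open>Independence is formulated in divided power coordinates, hence the test
        polynomial is \<open>undivided p\<close>. Congruent words act alike, so each word may be
        replaced by its normal form.\<close>
      also have "\<dots> = (\<Sum>w\<in>?W. divided (const_pol (Poly_Mapping.lookup f w) * word_op n w (undivided p)))"
      proof (rule sum.cong[OF refl])
        fix w assume w: "w \<in> ?W"
        have "word_op n w = (word_op n (map Gen_x (a w) @ map Gen_y (b w)) :: 'k mpol \<Rightarrow> 'k mpol)"
          using w W lists_ab[OF w] by (intro cong_imp_word_op_eq[OF ab(3)[OF w]]) auto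
        then show "const_pol (Poly_Mapping.lookup f w) * ?T (N w) =
            divided (const_pol (Poly_Mapping.lookup f w) * word_op n w (undivided p))"
          using p ab(1,2)[OF w] by (simp add: word_op_normal rescale_const_mult N_def)
      qed
      also have "\<dots> = divided (free_op n f (undivided p))"
        using p by (simp add: free_op_def additive_sum[of divided] rescale_add)
      also have "\<dots> = 0" using f(2) p by simp
      finally show "(\<Sum>(\<alpha>, \<beta>)\<in>N ` ?W. const_pol (c (\<alpha>, \<beta>)) * (monomial \<alpha> * contract (monomial \<beta>) p)) = 0" .
    qed
    then show "x \<in> N ` ?W \<Longrightarrow> (\<Sum>w | w \<in> ?W \<and> N w = x. Poly_Mapping.lookup f w) = 0" for x
      by (simp add: c_def)
  qed
qed

end


section \<open>The isomorphism with the algebra of integro-differential operators\<close>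

lemma quotient_algebra_simps [simp]:
  "carrier (quotient_algebra A I) = carrier (A Quot I)" "\<one>\<^bsub>quotient_algebra A I\<^esub> = \<one>\<^bsub>A Quot I\<^esub>"
  "\<zero>\<^bsub>quotient_algebra A I\<^esub> = \<zero>\<^bsub>A Quot I\<^esub>"
  "a \<otimes>\<^bsub>quotient_algebra A I\<^esub> b = a \<otimes>\<^bsub>A Quot I\<^esub> b" "a \<oplus>\<^bsub>quotient_algebra A I\<^esub> b = a \<oplus>\<^bsub>A Quot I\<^esub> b"
  "k \<odot>\<^bsub>quotient_algebra A I\<^esub> B = (\<Union>b\<in>B. I +>\<^bsub>A\<^esub> (k \<odot>\<^bsub>A\<^esub> b))"
  by (simp_all add: quotient_algebra_def ring.defs module.defs)

lemma ring_quotient_algebra: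
  assumes "ideal I A"
  shows "ring (quotient_algebra A I)"
proof -
  interpret Q: ring "A Quot I" by (rule ideal.quotient_is_ring[OF assms])
  have "abelian_group (quotient_algebra A I)"
    by (rule abelian_groupI) (auto simp: Q.a_ac intro: Q.l_neg Q.a_inv_closed)
  moreover have "monoid (quotient_algebra A I)"
    by (rule monoidI) (auto simp: Q.m_assoc)
  ultimately show ?thesis
    by (rule ringI) (auto simp: Q.l_distr Q.r_distr)
qed

context
  fixes K :: "'k::field_char_0 itself" and n :: nat
begin

lemma kernel_free_op:
  "a_kernel (Sn_free K n) (integro_differential K n) (free_op n) = Idl\<^bsub>Sn_free K n\<^esub> (Sn_relators n)"
  using Sn_ideal_subset_kernel[of K n] kernel_subset_Sn_ideal[of K n]
  unfolding a_kernel_def' integro_differential_eq by (simp del: End_simps)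

lemma free_op_hom_integro_differential:
  "ring_hom_ring (Sn_free K n) (integro_differential K n) (free_op n)"
proof -
  interpret ring_hom_ring "Sn_free K n" "End_polys K n" "free_op n" by (rule free_op_hom)
  show ?thesis
  proof (rule ring_hom_ringI)
    show "ring (integro_differential K n)"
      unfolding integro_differential_eq
      by (rule ring_generated_subalgebra[OF ring_End gens_subset End_smult_closed])
    show "free_op n f \<in> carrier (integro_differential K n)" if "f \<in> carrier (Sn_free K n)" for f
      using that free_op_image by blast
  qed (auto simp: R.ring_axioms integro_differential_eq simp del: End_simps)
qed

text \<open>Scalar multiplication of a coset is a union over its elements. They all have the same
  image under \<open>free_op\<close>, which commutes with scalars, so their multiples lie in one
  coset of the kernel.\<close>

lemma Sn_smult:
  assumes f: "f \<in> carrier (Sn_free K n)"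
  shows "k \<odot>\<^bsub>Sn_algebra K n\<^esub> (Sn_ideal K n +>\<^bsub>Sn_free K n\<^esub> f) = Sn_ideal K n +>\<^bsub>Sn_free K n\<^esub> (k \<odot>\<^bsub>Sn_free K n\<^esub> f)"
proof -
  interpret h: ring_hom_ring "Sn_free K n" "integro_differential K n" "free_op n"
    by (rule free_op_hom_integro_differential)
  interpret J: ideal "Sn_ideal K n" "Sn_free K n" by (rule ideal_Sn_ideal)
  have sm: "k \<odot>\<^bsub>Sn_free K n\<^esub> g \<in> carrier (Sn_free K n)" if "g \<in> carrier (Sn_free K n)" for g k
    using that unfolding Sn_free_def by (rule free_smult_closed)
  have "Sn_ideal K n +>\<^bsub>Sn_free K n\<^esub> (k \<odot>\<^bsub>Sn_free K n\<^esub> b) = Sn_ideal K n +>\<^bsub>Sn_free K n\<^esub> (k \<odot>\<^bsub>Sn_free K n\<^esub> f)"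
    if b: "b \<in> Sn_ideal K n +>\<^bsub>Sn_free K n\<^esub> f" for b
  proof -
    have bF: "b \<in> carrier (Sn_free K n)"
      using J.a_elemrcos_carrier[OF f b] .
    have "free_op n b = free_op n f"
      using h.rcos_imp_homeq[OF f] b by (simp only: kernel_free_op)
    then have "free_op n (k \<odot>\<^bsub>Sn_free K n\<^esub> b) = free_op n (k \<odot>\<^bsub>Sn_free K n\<^esub> f)"
      by (simp only: free_op_smult)
    then have "k \<odot>\<^bsub>Sn_free K n\<^esub> b \<in> Sn_ideal K n +>\<^bsub>Sn_free K n\<^esub> (k \<odot>\<^bsub>Sn_free K n\<^esub> f)"
      using h.homeq_imp_rcos[OF sm[OF f] sm[OF bF]] by (simp only: kernel_free_op)
    then show ?thesis
      by (rule h.R.a_repr_independence[symmetric, OF _ sm[OF f]])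
         (rule J.a_subgroup)
  qed
  moreover have "f \<in> Sn_ideal K n +>\<^bsub>Sn_free K n\<^esub> f" using f by (rule J.a_rcos_self)
  ultimately show ?thesis unfolding Sn_algebra_def quotient_algebra_simps by blast
qed

lemma Sn_carrierE:
  assumes "X \<in> carrier (Sn_algebra K n)"
  obtains f where "f \<in> carrier (Sn_free K n)" "X = Sn_ideal K n +>\<^bsub>Sn_free K n\<^esub> f"
  using assms unfolding Sn_algebra_def quotient_algebra_simps FactRing_def A_RCOSETS_def' by auto

lemma Sn_cosetI:
  "f \<in> carrier (Sn_free K n) \<Longrightarrow> Sn_ideal K n +>\<^bsub>Sn_free K n\<^esub> f \<in> carrier (Sn_algebra K n)"
  unfolding Sn_algebra_def quotient_algebra_simps FactRing_def A_RCOSETS_def' by auto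

lemma Sn_smult_closed:
  assumes "X \<in> carrier (Sn_algebra K n)"
  shows "k \<odot>\<^bsub>Sn_algebra K n\<^esub> X \<in> carrier (Sn_algebra K n)"
proof -
  obtain f where f: "f \<in> carrier (Sn_free K n)" "X = Sn_ideal K n +>\<^bsub>Sn_free K n\<^esub> f"
    using Sn_carrierE[OF assms] .
  have "k \<odot>\<^bsub>Sn_free K n\<^esub> f \<in> carrier (Sn_free K n)"
    using f(1) unfolding Sn_free_def by (rule free_smult_closed)
  then show ?thesis unfolding f(2) Sn_smult[OF f(1)] by (rule Sn_cosetI)
qed

lemma ring_Sn: "ring (Sn_algebra K n)"
  unfolding Sn_algebra_def by (rule ring_quotient_algebra[OF ideal_Sn_ideal])

text \<open>The first isomorphism theorem for \<open>free_op\<close>, whose kernel and image are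
  known; compatibility with scalars is checked on coset representatives.\<close>

lemma Sn_iso: "Sn_algebra K n \<simeq>\<^sub>a\<^sub>l\<^sub>g integro_differential K n"
proof -
  interpret h: ring_hom_ring "Sn_free K n" "integro_differential K n" "free_op n"
    by (rule free_op_hom_integro_differential)
  let ?h = "\<lambda>X. the_elem (free_op n ` X)"
  have "?h \<in> ring_hom (Sn_free K n Quot Sn_ideal K n) (integro_differential K n)"
    using h.the_elem_hom unfolding kernel_free_op .
  then have hom: "?h \<in> ring_hom (Sn_algebra K n) (integro_differential K n)"
    unfolding ring_hom_def Sn_algebra_def by simp
  have elem: "?h (Sn_ideal K n +>\<^bsub>Sn_free K n\<^esub> f) = free_op n f" if "f \<in> carrier (Sn_free K n)" for f
    using h.the_elem_simp[OF that] unfolding kernel_free_op .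
  have carr: "carrier (Sn_algebra K n) = carrier (Sn_free K n Quot Sn_ideal K n)"
    by (simp add: Sn_algebra_def)
  have "bij_betw ?h (carrier (Sn_algebra K n)) (carrier (integro_differential K n))"
    unfolding bij_betw_def inj_on_def carr
    using h.the_elem_inj h.the_elem_surj free_op_image unfolding kernel_free_op by simp
  moreover have "?h (k \<odot>\<^bsub>Sn_algebra K n\<^esub> X) = k \<odot>\<^bsub>integro_differential K n\<^esub> ?h X"
    if X: "X \<in> carrier (Sn_algebra K n)" for k X
  proof -
    obtain f where f: "f \<in> carrier (Sn_free K n)" "X = Sn_ideal K n +>\<^bsub>Sn_free K n\<^esub> f"
      using Sn_carrierE[OF X] .
    have "k \<odot>\<^bsub>Sn_free K n\<^esub> f \<in> carrier (Sn_free K n)"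
      using f(1) unfolding Sn_free_def by (rule free_smult_closed)
    then show ?thesis
      unfolding f(2) Sn_smult[OF f(1)]
      by (simp add: elem f(1) free_op_smult integro_differential_eq del: End_simps)
  qed
  ultimately show ?thesis unfolding alg_iso_def using hom by blast
qed

end

theorem corollary3p18:
  fixes K :: "'k::field_char_0 itself" and n :: nat
  assumes "n \<ge> 1"
  shows
    "(left_denominator_set (integro_differential K n) (left_regular (integro_differential K n)) \<and>
      left_regular (integro_differential K n) = left_S (integro_differential K n) \<and>
      left_Q_cl (integro_differential K n) = left_Q (integro_differential K n) \<and>
      left_Q (integro_differential K n) \<simeq>\<^sub>a\<^sub>l\<^sub>g left_Q (Sn_algebra K n) \<and>
      left_Q (Sn_algebra K n) \<simeq>\<^sub>a\<^sub>l\<^sub>g rational_functions K n) \<and>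
     (right_denominator_set (integro_differential K n) (right_regular (integro_differential K n)) \<and>
      right_regular (integro_differential K n) = right_S (integro_differential K n) \<and>
      right_Q_cl (integro_differential K n) = right_Q (integro_differential K n) \<and>
      right_Q (integro_differential K n) \<simeq>\<^sub>a\<^sub>l\<^sub>g right_Q (Sn_algebra K n) \<and>
      right_Q (Sn_algebra K n) \<simeq>\<^sub>a\<^sub>l\<^sub>g rational_functions K n)"
proof -
  let ?I = "integro_differential K n" and ?S = "Sn_algebra K n"
  interpret I: left_polynomial_ring ?I n "operator contract n"
    by (rule left_polynomial_ring_integro_differential)
  interpret I': left_polynomial_ring "opposite ?I" n "operator (*) n"
    by (rule left_polynomial_ring_opposite_integro_differential)
  obtain \<theta> where \<theta>: "left_polynomial_ring ?S n \<theta>"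
    using left_polynomial_ring_iso[OF I.left_polynomial_ring_axioms Sn_iso ring_Sn Sn_smult_closed] ..
  interpret S: left_polynomial_ring ?S n \<theta> by (rule \<theta>)
  have "\<exists>\<theta>'. left_polynomial_ring (opposite ?S) n \<theta>'"
    by (rule left_polynomial_ring_iso[OF I'.left_polynomial_ring_axioms alg_iso_opposite[OF Sn_iso]
        ring_opposite[OF ring_Sn]]) (simp only: opposite_simps Sn_smult_closed)
  then obtain \<theta>' where \<theta>': "left_polynomial_ring (opposite ?S) n \<theta>'" ..
  interpret S': left_polynomial_ring "opposite ?S" n \<theta>' by (rule \<theta>')
  \<comment> \<open>This reduces the second half of the theorem to the first half for the opposite
    algebras.\<close>
  have right_Q: "right_Q R = opposite (left_Q (opposite R))" for R :: "('k, 'x) module"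
    by (simp add: right_Q_def right_localization_def left_Q_def right_S_opposite)
  have "left_Q ?I \<simeq>\<^sub>a\<^sub>l\<^sub>g left_Q ?S"
    by (rule alg_iso_trans[OF I.left_Q_iso(1) S.left_Q_iso(2)])
  moreover have "right_Q ?I \<simeq>\<^sub>a\<^sub>l\<^sub>g right_Q ?S"
    unfolding right_Q
    by (rule alg_iso_opposite[OF alg_iso_trans[OF I'.left_Q_iso(1) S'.left_Q_iso(2)]])
  \<comment> \<open>The field of rational functions is commutative, hence its own opposite.\<close>
  moreover have "right_Q ?S \<simeq>\<^sub>a\<^sub>l\<^sub>g rational_functions K n"
    using alg_iso_opposite[OF S'.left_Q_iso(1)[of K]] by (simp add: right_Q)
  ultimately show ?thesis
    using I.left_denominator_set_C I.left_S_eq S.left_Q_iso(1)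
      I'.left_denominator_set_C I'.left_S_eq
    by (simp add: right_denominator_set_opposite right_regular_opposite right_S_opposite
        left_Q_cl_def left_Q_def right_Q_cl_def right_Q_def)
qed

end
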